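(* Let $\mathcal{R}_{a,b,c}$ be the lattice of congruent triangles with sides $a,b,c$ and opposite angles $\alpha,\beta,\gamma$ (as defined in the context), where the triangles are acute or right. Let $\mathcal{C}$ be a rectangle with side lengths $g$ and $h$, with support function $s$, satisfying $\max_{0\le\phi<2\pi}c^*(\phi)\le c$, where $$c^*(\phi)=s(\phi)\csc\alpha+s(\phi+\alpha+\beta)\csc\beta+s(\phi+\alpha+\pi)(\cot\alpha+\cot\beta).$$ Put $u=2(g+h)$, $F=gh$, $Q=ab\sin\gamma$. Then the probabilities $p(i)$ that the randomly thrown rectangle $\mathcal{C}$ hits exactly $i$ triangles of $\mathcal{R}_{a,b,c}$ are $$p(1)=1-\frac{(a+b+c)u}{\pi Q}+\frac{(\alpha a^2+\beta b^2+\gamma c^2)(g^2+h^2)}{2\pi Q^2}+\frac{3(g^2+h^2)}{2\pi Q}+\frac{(a^2+b^2+c^2)F}{\pi Q^2}+\frac{F}{Q},$$ $$p(2)=\frac{(a+b+c)u}{\pi Q}-\frac{(a^2+b^2+c^2)(g^2+h^2)}{4Q^2}-\frac{(\alpha a^2+\beta b^2+\gamma c^2)(g^2+h^2)}{2\pi Q^2}-\frac{3(g^2+h^2)}{2\pi Q}-\frac{2(a^2+b^2+c^2)F}{\pi Q^2}-\frac{F}{Q},$$ $$p(3)=\frac{(a^2+b^2+c^2)(g^2+h^2)}{2Q^2}-\frac{(\alpha a^2+\beta b^2+\gamma c^2)(g^2+h^2)}{2\pi Q^2}-\frac{3(g^2+h^2)}{2\pi Q}+\frac{(a^2+b^2+c^2)F}{\pi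 Q^2}-\frac{F}{Q},$$ $$p(4)=\frac{3(g^2+h^2)}{2\pi Q}-\frac{(a^2+b^2+c^2)(g^2+h^2)}{4Q^2}+\frac{(\alpha a^2+\beta b^2+\gamma c^2)(g^2+h^2)}{2\pi Q^2},$$ $$p(5)=0,\qquad p(6)=\frac{F}{Q}.$$
   Context: Lattice. Fix a triangle with sides $a,b,c$ and opposite angles $\alpha,\beta,\gamma$, and altitudes $h_a=b\sin\gamma=c\sin\beta$, $h_b=a\sin\gamma=c\sin\alpha$, $h_c=a\sin\beta=b\sin\alpha$. The lattice $\mathcal{R}_{a,b,c}$ is the union of the three families of parallel lines $\{x\sin\beta+y\cos\beta=kh_a\}$, $\{x\sin\alpha-y\cos\alpha=kh_b\}$, $\{y=kh_c\}$, $k\in\mathbb{Z}$, in $\mathbb{R}^2$. These lines cut the plane into triangles ("the triangles of $\mathcal{R}_{a,b,c}$"), all congruent to $\mathcal{T}=\{(x,y): 0\le y\le h_c,\ y\cot\alpha\le x\le c-y\cot\beta\}$. Two triangles form a parallelogram congruent to $\mathcal{Q}=\{(x,y): 0\le y\le h_c,\ y\cot\alpha\le x\le c+y\cot\alpha\}$, whose area is $Q=ab\sin\gamma=ac\sin\beta=bc\sin\alpha$. Body. The planar convex body $\mathcal{C}$ is provided with a fixed reference point $O$ in $\mathcal{C}$ and a fixed oriented line segment $\sigma$ starting in $O$, both moving rigidly with $\mathcal{C}$. Support function $s:\mathbb{R}\to\mathbb{R}$: place $\mathcal{C}$ with $O$ at the origin of a Cartesian coordinate system and rotated so that the (counterclockwise)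 angle from the positive $x$-axis to $\sigma$ is $\phi$; then $s(\phi)$ is the distance from the origin to the support line of $\mathcal{C}$ perpendicular to the $x$-axis on the side of the positive $x$-axis, i.e. $s(\phi)$ is the maximal $x$-coordinate of the points of $\mathcal{C}$ in this position. Random throw of $\mathcal{C}$ onto $\mathcal{R}_{a,b,c}$: only rotations and translations of $\mathcal{C}$ are used; the position $(x,y)$ of $O$ is uniformly distributed in $\mathcal{Q}$ (so $y$ is uniform in $[0,h_c]$ and, given $y$, $x$ is uniform in $[y\cot\alpha,\,h_b\csc\alpha+y\cot\alpha]$, where $h_b\csc\alpha=c$), and the angle $\phi$ from a fixed direction perpendicular to the sides $b$ to the segment $\sigma$ is uniformly distributed in $[0,2\pi]$ and independent of $(x,y)$. The body hits a triangle if it has nonempty intersection with it; $p(i)$ is the probability that exactly $i$ triangles of $\mathcal{R}_{a,b,c}$ are hit. The quantity $c^*(\phi)$ is the length of the side corresponding to $c$ of the triangle similar to $\mathcal{T}$ (with parallel sides) all of whose sides touch $\mathcal{C}$ in direction $\phi$; the condition $\max c^*\le c$ expresses that in every direction $\mathcal{C}$ fits into a single triangle of the lattice. *)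

theory Defs
  imports "HOL-Analysis.Analysis"
begin

definition angle_at :: "real \<times> real \<Rightarrow> real \<times> real \<Rightarrow> real \<times> real \<Rightarrow> real" where
  "angle_at X V Y = arccos (((X - V) \<bullet> (Y - V)) / (norm (X - V) * norm (Y - V)))"

definition is_triangle ::
    "real \<Rightarrow> real \<Rightarrow> real \<Rightarrow> real \<Rightarrow> real \<Rightarrow> real \<Rightarrow> bool" where
  "is_triangle a b c \<alpha> \<beta> \<gamma> \<longleftrightarrow>
    (\<exists>A B C :: real \<times> real. \<not> collinear {A, B, C} \<and>
       a = dist B C \<and> b = dist C A \<and> c = dist A B \<and>
       \<alpha> = angle_at B A C \<and> \<beta> = angle_at C B A \<and> \<gamma> = angle_at A C B)"

text \<open>The altitudes are \<open>h\<^sub>a = b sin \<gamma>\<close>, \<open>h\<^sub>b = a sin \<gamma>\<close> and \<open>h\<^sub>c = a sin \<beta>\<close>.\<close>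

definition lattice_lines ::
    "real \<Rightarrow> real \<Rightarrow> real \<Rightarrow> real \<Rightarrow> real \<Rightarrow> (real \<times> real) set" where
  "lattice_lines a b \<alpha> \<beta> \<gamma> =
     (\<Union>k::int. {(x, y). x * sin \<beta> + y * cos \<beta> = of_int k * (b * sin \<gamma>)}) \<union>
     (\<Union>k::int. {(x, y). x * sin \<alpha> - y * cos \<alpha> = of_int k * (a * sin \<gamma>)}) \<union>
     (\<Union>k::int. {(x, y). y = of_int k * (a * sin \<beta>)})"

definition lattice_triangles ::
    "real \<Rightarrow> real \<Rightarrow> real \<Rightarrow> real \<Rightarrow> real \<Rightarrow> (real \<times> real) set set" where
  "lattice_triangles a b \<alpha> \<beta> \<gamma> = closure ` components (- lattice_lines a b \<alpha> \<beta> \<gamma>)"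

definition parallelogram_Q ::
    "real \<Rightarrow> real \<Rightarrow> real \<Rightarrow> real \<Rightarrow> (real \<times> real) set" where
  "parallelogram_Q a c \<alpha> \<beta> =
     {(x, y). 0 \<le> y \<and> y \<le> a * sin \<beta> \<and> y * cot \<alpha> \<le> x \<and> x \<le> c + y * cot \<alpha>}"

definition is_rectangle :: "real \<Rightarrow> real \<Rightarrow> (real \<times> real) set \<Rightarrow> bool" where
  "is_rectangle g h C \<longleftrightarrow> g > 0 \<and> h > 0 \<and>
    (\<exists>p u v. norm u = 1 \<and> norm v = 1 \<and> u \<bullet> v = 0 \<and>
       C = {p + s *\<^sub>R u + t *\<^sub>R v | s t. 0 \<le> s \<and> s \<le> g \<and> 0 \<le> t \<and> t \<le> h})"

definition rotate2 :: "real \<Rightarrow> real \<times> real \<Rightarrow> real \<times> real" where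
  "rotate2 \<theta> w = (fst w * cos \<theta> - snd w * sin \<theta>, fst w * sin \<theta> + snd w * cos \<theta>)"

definition direction_angle :: "real \<times> real \<Rightarrow> real" where
  "direction_angle w = Arg (Complex (fst w) (snd w))"

text \<open>
  The body \<open>C\<close> carries the reference point \<open>P\<close> and the oriented segment \<open>\<sigma>\<close> from \<open>P\<close> to \<open>E\<close>.
  In \<open>placed C P E z \<theta>\<close> the body has been moved by the orientation-preserving isometry that takes
  \<open>P\<close> to \<open>z\<close> and makes the counterclockwise angle from the positive \<open>x\<close>-axis to \<open>\<sigma>\<close> equal to \<open>\<theta>\<close>.
\<close>

definition placed ::
    "(real \<times> real) set \<Rightarrow> real \<times> real \<Rightarrow> real \<times> real \<Rightarrow> real \<times> real \<Rightarrow> real \<Rightarrow> (real \<times> real) set" where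
  "placed C P E z \<theta> = (\<lambda>w. z + rotate2 (\<theta> - direction_angle (E - P)) (w - P)) ` C"

definition support_fun ::
    "(real \<times> real) set \<Rightarrow> real \<times> real \<Rightarrow> real \<times> real \<Rightarrow> real \<Rightarrow> real" where
  "support_fun C P E \<phi> = (SUP w \<in> placed C P E (0, 0) \<phi>. fst w)"

definition c_star :: "(real \<Rightarrow> real) \<Rightarrow> real \<Rightarrow> real \<Rightarrow> real \<Rightarrow> real" where
  "c_star s \<alpha> \<beta> \<phi> =
     s \<phi> / sin \<alpha> + s (\<phi> + \<alpha> + \<beta>) / sin \<beta> + s (\<phi> + \<alpha> + pi) * (cot \<alpha> + cot \<beta>)"

definition throw_measure ::
    "real \<Rightarrow> real \<Rightarrow> real \<Rightarrow> real \<Rightarrow> ((real \<times> real) \<times> real) measure" where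
  "throw_measure a c \<alpha> \<beta> =
     uniform_measure lborel (parallelogram_Q a c \<alpha> \<beta>) \<Otimes>\<^sub>M uniform_measure lborel {0..2 * pi}"

text \<open>
  The sides \<open>b\<close> have direction angle \<open>\<alpha>\<close>.  The fixed direction from which \<open>\<phi>\<close> is measured is the
  normal of the sides \<open>b\<close> with direction angle \<open>\<alpha> + \<pi>/2\<close>; it is the outward one for the triangle
  with vertices \<open>(0, 0)\<close>, \<open>(c, 0)\<close>, \<open>(b cos \<alpha>, b sin \<alpha>)\<close>.  With this choice \<open>s \<phi>\<close>,
  \<open>s (\<phi> + \<alpha> + \<beta>)\<close>, \<open>s (\<phi> + \<alpha> + \<pi>)\<close> are the support distances of the thrown body in the outward
  normal directions of the sides \<open>b\<close>, \<open>a\<close>, \<open>c\<close> of that triangle, in agreement with \<open>c_star\<close>.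
\<close>

definition hit_prob ::
    "real \<Rightarrow> real \<Rightarrow> real \<Rightarrow> real \<Rightarrow> real \<Rightarrow> real \<Rightarrow>
     (real \<times> real) set \<Rightarrow> real \<times> real \<Rightarrow> real \<times> real \<Rightarrow> nat \<Rightarrow> real" where
  "hit_prob a b c \<alpha> \<beta> \<gamma> C P E i =
     measure (throw_measure a c \<alpha> \<beta>)
       {(z, \<phi>) \<in> space (throw_measure a c \<alpha> \<beta>).
          card {T \<in> lattice_triangles a b \<alpha> \<beta> \<gamma>. T \<inter> placed C P E z (\<phi> + \<alpha> + pi / 2) \<noteq> {}} = i}"

end

theory Submission
  imports Defs
begin

text \<open>
  Write \<open>X\<close>, \<open>Y\<close> for the oblique coordinates in which a point of the plane is \<open>X\<close> times the side vector
  \<open>(c, 0)\<close> plus \<open>Y\<close> times the side vector \<open>(b cos \<alpha>, b sin \<alpha>)\<close>. In these coordinates the three families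
  of lattice lines are \<open>X \<in> \<int>\<close>, \<open>Y \<in> \<int>\<close>, \<open>X + Y \<in> \<int>\<close>, the sampling parallelogram is the unit square, and
  the thrown rectangle at a fixed angle is a centrally symmetric parallelogram.

  The count. A convex body whose width across each family is at most the distance between
  consecutive lines meets at most one line of each family, up to null sets. Since any two lattice
  lines of different families cross at a point of \<open>\<int> \<times> \<int>\<close>, through which a line of the third family
  passes as well, cutting the body successively by the lines it meets gives
  \<open>1 + (number of lines met) + 2 [the body contains a lattice vertex]\<close> pieces: each line adds one piece,
  and the second and third line add one more each exactly if the vertex lies in the body
  (\<open>card_cells_hit\<close>). A body containing a vertex meets all three lines. So one, two, three or four
  triangles are hit if no vertex is covered and zero, one, two or three lines are met; six are hit
  if a vertex is covered; five never.

  The probabilities at a fixed angle. Let \<open>t\<^sub>a\<close>, \<open>t\<^sub>b\<close>, \<open>t\<^sub>c\<close> be the widths of the rectangle across the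
  three families, each divided by the distance of the lines. Any two of \<open>X\<close>, \<open>Y\<close>, \<open>X + Y\<close> are
  independent and uniform modulo 1, so family \<open>i\<close> is met with probability \<open>t\<^sub>i\<close> and families \<open>i\<close> and \<open>j\<close>
  are both met with probability \<open>t\<^sub>i t\<^sub>j\<close>. No line is met exactly if the body lies in a single triangle.
  The admissible positions form two triangles, one for each orientation of the cells, with total area
  \<open>(1 - (t\<^sub>a + t\<^sub>b + t\<^sub>c) / 2)\<^sup>2\<close> (\<open>emeasure_square_avoid_all_lines\<close>); here the hypothesis on \<open>c_star\<close> enters, which
  says exactly that \<open>t\<^sub>a + t\<^sub>b + t\<^sub>c \<le> 2\<close>. A vertex is covered with probability equal to the area of the
  body in oblique coordinates, \<open>F / Q\<close>. Inclusion and exclusion gives the remaining probabilities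
  (\<open>measure_event_counts\<close>) as polynomials in \<open>t\<^sub>a\<close>, \<open>t\<^sub>b\<close>, \<open>t\<^sub>c\<close>.

  Averaging over the angle. The width of a rectangle in direction \<open>x\<close> is \<open>g \<bar>cos x\<bar> + h \<bar>sin x\<bar>\<close>, and
  the mean of a product of two widths in directions at angle \<open>d\<close> follows from the integral
  \<open>\<integral> \<bar>cos x\<bar> \<bar>cos (x + d)\<bar> dx = 2 (sin d + (\<pi> / 2 - d) cos d)\<close> over a full period, where \<open>0 \<le> d \<le> \<pi>\<close>. It
  is applied to the angle between two sides and, for the mixed terms \<open>\<bar>cos\<bar> \<bar>sin\<bar>\<close>, to this angle plus \<open>\<pi> / 2\<close>,
  which is admissible because the triangle is not obtuse. The cosine theorem and the area
  formula turn \<open>b c cos \<alpha>\<close>, \<open>b c sin \<alpha>\<close> and their analogues into the symmetric expressions of the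
  statement.
\<close>

section \<open>Area in the plane\<close>

lemma emeasure_lborel_translate:
  fixes A :: "'a::euclidean_space set"
  assumes [measurable]: "A \<in> sets borel"
  shows "emeasure lborel {z. z + v \<in> A} = emeasure lborel A"
proof -
  have "emeasure lborel A = emeasure (distr lborel borel ((+) v)) A"
    by (simp only: lborel_distr_plus)
  also have "\<dots> = emeasure lborel ((+) v -` A \<inter> space lborel)"
    by (rule emeasure_distr) auto
  also have "(+) v -` A \<inter> space lborel = {z. z + v \<in> A}"
    by (auto simp: add.commute)
  finally show ?thesis by simp
qed

text \<open>
  Cut \<open>A\<close> along the translates of the fundamental domain \<open>D\<close> and move every piece back into \<open>D\<close>; by
  \<open>inj\<close> the moved pieces do not overlap. This computes the probability that a random point
  of \<open>D\<close> has a lattice translate in \<open>A\<close>.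
\<close>

lemma emeasure_fundamental_domain:
  fixes A D :: "'a::euclidean_space set"
  assumes G: "countable G"
    and D[measurable]: "D \<in> sets borel" and A[measurable]: "A \<in> sets borel"
    and tiling: "\<And>z. \<exists>!g. g \<in> G \<and> z - g \<in> D"
    and inj: "\<And>z g g'. \<lbrakk>g \<in> G; g' \<in> G; z + g \<in> A; z + g' \<in> A\<rbrakk> \<Longrightarrow> g = g'"
  shows "emeasure lborel {z \<in> D. \<exists>g\<in>G. z + g \<in> A} = emeasure lborel A"
proof -
  define X where "X g = {z. z \<in> A \<and> z - g \<in> D}" for g
  define Y where "Y g = {z. z + g \<in> A \<and> z \<in> D}" for g
  have X[measurable]: "X g \<in> sets borel" and Y[measurable]: "Y g \<in> sets borel" for g
    unfolding X_def Y_def by measurable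
  have shift: "emeasure lborel (X g) = emeasure lborel (Y g)" for g
    using emeasure_lborel_translate[OF X, of g g] by (simp add: X_def Y_def)
  have "A = (\<Union>g\<in>G. X g)"
    using tiling unfolding X_def by blast
  then have "emeasure lborel A = emeasure lborel (\<Union>g\<in>G. X g)" by simp
  also have "\<dots> = (\<integral>\<^sup>+g. emeasure lborel (X g) \<partial>count_space G)"
  proof (rule emeasure_UN_countable[OF _ G])
    show "disjoint_family_on X G"
      using tiling unfolding disjoint_family_on_def X_def by blast
  qed auto
  also have "\<dots> = (\<integral>\<^sup>+g. emeasure lborel (Y g) \<partial>count_space G)"
    by (simp add: shift)
  also have "\<dots> = emeasure lborel (\<Union>g\<in>G. Y g)"
  proof (rule emeasure_UN_countable[OF _ G, symmetric])
    show "disjoint_family_on Y G"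
      using inj unfolding disjoint_family_on_def Y_def by blast
  qed auto
  also have "(\<Union>g\<in>G. Y g) = {z \<in> D. \<exists>g\<in>G. z + g \<in> A}"
    by (auto simp: Y_def)
  finally show ?thesis by simp
qed

lemma nn_integral_lborel_pair:
  fixes f :: "real \<times> real \<Rightarrow> ennreal"
  assumes [measurable]: "f \<in> borel_measurable borel"
  shows "(\<integral>\<^sup>+z. f z \<partial>lborel) = (\<integral>\<^sup>+x. \<integral>\<^sup>+y. f (x, y) \<partial>lborel \<partial>lborel)"
    and "(\<integral>\<^sup>+z. f z \<partial>lborel) = (\<integral>\<^sup>+y. \<integral>\<^sup>+x. f (x, y) \<partial>lborel \<partial>lborel)"
proof -
  have [measurable]: "f \<in> borel_measurable (lborel \<Otimes>\<^sub>M lborel)"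
    by (simp add: lborel_prod)
  show "(\<integral>\<^sup>+z. f z \<partial>lborel) = (\<integral>\<^sup>+x. \<integral>\<^sup>+y. f (x, y) \<partial>lborel \<partial>lborel)"
    by (subst lborel_prod[symmetric], subst lborel.nn_integral_fst[symmetric]) auto
  show "(\<integral>\<^sup>+z. f z \<partial>lborel) = (\<integral>\<^sup>+y. \<integral>\<^sup>+x. f (x, y) \<partial>lborel \<partial>lborel)"
    by (subst lborel_prod[symmetric], subst lborel_pair.nn_integral_snd[symmetric]) auto
qed

lemma linear_plane_measurable [measurable]:
  "(\<lambda>z. (a * fst z + b * snd z, c * fst z + d * snd z) :: real \<times> real) \<in> borel \<rightarrow>\<^sub>M borel"
  by (intro borel_measurable_continuous_onI continuous_intros)

lemma nn_integral_linear_plane_aux: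
  fixes f :: "real \<times> real \<Rightarrow> ennreal"
  assumes f[measurable]: "f \<in> borel_measurable borel" and a: "a \<noteq> 0" and det: "a * d - b * c \<noteq> 0"
  shows "(\<integral>\<^sup>+z. f z \<partial>lborel)
       = ennreal \<bar>a * d - b * c\<bar> * (\<integral>\<^sup>+z. f (a * fst z + b * snd z, c * fst z + d * snd z) \<partial>lborel)"
proof -
  \<comment> \<open>The second pivot of Gaussian elimination.\<close>
  define e where "e = d - b * c / a"
  have e: "e \<noteq> 0" "a * e = a * d - b * c" using a det by (auto simp: e_def field_simps)
  have "(\<integral>\<^sup>+z. f z \<partial>lborel) = (\<integral>\<^sup>+x. \<integral>\<^sup>+y. f (x, y) \<partial>lborel \<partial>lborel)"
    by (rule nn_integral_lborel_pair) fact
  also have "\<dots> = (\<integral>\<^sup>+x. ennreal \<bar>e\<bar> * (\<integral>\<^sup>+y. f (x, c * x / a + e * y) \<partial>lborel) \<partial>lborel)"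
    by (intro nn_integral_cong nn_integral_real_affine e) auto
  also have "\<dots> = ennreal \<bar>e\<bar> * (\<integral>\<^sup>+x. \<integral>\<^sup>+y. f (x, c * x / a + e * y) \<partial>lborel \<partial>lborel)"
    by (rule nn_integral_cmult) measurable
  also have "(\<integral>\<^sup>+x. \<integral>\<^sup>+y. f (x, c * x / a + e * y) \<partial>lborel \<partial>lborel)
      = (\<integral>\<^sup>+y. \<integral>\<^sup>+x. f (x, c * x / a + e * y) \<partial>lborel \<partial>lborel)"
    by (rule lborel_pair.Fubini'[symmetric]) measurable
  also have "\<dots> = (\<integral>\<^sup>+y. ennreal \<bar>a\<bar> * (\<integral>\<^sup>+x. f (b * y + a * x, c * (b * y + a * x) / a + e * y) \<partial>lborel) \<partial>lborel)"
    by (intro nn_integral_cong nn_integral_real_affine a) auto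
  also have "\<dots> = ennreal \<bar>a\<bar> * (\<integral>\<^sup>+y. \<integral>\<^sup>+x. f (b * y + a * x, c * (b * y + a * x) / a + e * y) \<partial>lborel \<partial>lborel)"
    by (rule nn_integral_cmult) measurable
  also have "(\<lambda>y x. f (b * y + a * x, c * (b * y + a * x) / a + e * y)) = (\<lambda>y x. f (a * x + b * y, c * x + d * y))"
    using a by (auto intro!: ext arg_cong[of _ _ f] simp: e_def field_simps)
  also have "(\<integral>\<^sup>+y. \<integral>\<^sup>+x. f (a * x + b * y, c * x + d * y) \<partial>lborel \<partial>lborel)
      = (\<integral>\<^sup>+z. f (a * fst z + b * snd z, c * fst z + d * snd z) \<partial>lborel)"
    by (subst nn_integral_lborel_pair(2)) auto
  finally show ?thesis
    unfolding e(2)[symmetric] abs_mult by (simp add: ennreal_mult mult_ac)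
qed

text \<open>
  Instead of the transformation formula for Cartesian powers, two one-dimensional affine
  substitutions and Fubini suffice on \<open>real \<times> real\<close>. The auxiliary lemma needs a nonzero pivot \<open>a\<close>;
  otherwise the coordinates are exchanged.
\<close>

lemma nn_integral_linear_plane:
  fixes f :: "real \<times> real \<Rightarrow> ennreal"
  assumes f[measurable]: "f \<in> borel_measurable borel" and det: "a * d - b * c \<noteq> 0"
  shows "(\<integral>\<^sup>+z. f z \<partial>lborel)
       = ennreal \<bar>a * d - b * c\<bar> * (\<integral>\<^sup>+z. f (a * fst z + b * snd z, c * fst z + d * snd z) \<partial>lborel)"
proof (cases "a = 0")
  case False
  then show ?thesis using nn_integral_linear_plane_aux assms by blast
next
  case True
  then have b: "b \<noteq> 0" "b * c - a * d \<noteq> 0" using det by auto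
  have "(\<integral>\<^sup>+z. f z \<partial>lborel)
       = ennreal \<bar>b * c - a * d\<bar> * (\<integral>\<^sup>+z. f (b * fst z + a * snd z, d * fst z + c * snd z) \<partial>lborel)"
    by (rule nn_integral_linear_plane_aux[OF f b])
  also have "(\<integral>\<^sup>+z. f (b * fst z + a * snd z, d * fst z + c * snd z) \<partial>lborel)
      = (\<integral>\<^sup>+y. \<integral>\<^sup>+x. f (b * x + a * y, d * x + c * y) \<partial>lborel \<partial>lborel)"
    by (subst nn_integral_lborel_pair(2)) auto
  also have "\<dots> = (\<integral>\<^sup>+z. f (a * fst z + b * snd z, c * fst z + d * snd z) \<partial>lborel)"
    by (subst nn_integral_lborel_pair(1)) (auto simp: add.commute)
  finally show ?thesis by (simp add: abs_minus_commute)
qed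

lemma emeasure_linear_preimage_plane:
  fixes A :: "(real \<times> real) set"
  assumes A[measurable]: "A \<in> sets borel" and det: "a * d - b * c \<noteq> 0"
  shows "emeasure lborel A = ennreal \<bar>a * d - b * c\<bar>
     * emeasure lborel {z. (a * fst z + b * snd z, c * fst z + d * snd z) \<in> A}"
proof -
  have "emeasure lborel A = (\<integral>\<^sup>+z. indicator A z \<partial>lborel)" by simp
  also have "\<dots> = ennreal \<bar>a * d - b * c\<bar>
    * (\<integral>\<^sup>+z. indicator A (a * fst z + b * snd z, c * fst z + d * snd z) \<partial>lborel)"
    by (rule nn_integral_linear_plane[OF _ det]) auto
  also have "(\<lambda>z. indicator A (a * fst z + b * snd z, c * fst z + d * snd z) :: ennreal)
    = indicator {z. (a * fst z + b * snd z, c * fst z + d * snd z) \<in> A}"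
    by (auto simp: indicator_def)
  also have "integral\<^sup>N lborel \<dots> = emeasure lborel {z. (a * fst z + b * snd z, c * fst z + d * snd z) \<in> A}"
    by (intro nn_integral_indicator) measurable
  finally show ?thesis .
qed

section \<open>Counting the cells of the integer triangular lattice\<close>

text \<open>
  The one-dimensional case of the count: an open interval shorter than 1 contains at most one
  integer, and if it contains one, it has points on both sides of it.
\<close>

lemma card_unit_intervals_hit:
  fixes J :: "real set"
  assumes "open J" "convex J" "J \<noteq> {}" and width: "\<forall>x\<in>J. \<forall>y\<in>J. x - y < 1"
  shows "finite {i::int. \<exists>x\<in>J. of_int i < x \<and> x < of_int i + 1}" (is "finite ?H")
    and "card {i::int. \<exists>x\<in>J. of_int i < x \<and> x < of_int i + 1} = 1 + of_bool (\<exists>x\<in>J. x \<in> \<int>)"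
proof -
  have "finite ?H \<and> card ?H = 1 + of_bool (\<exists>x\<in>J. x \<in> \<int>)"
  proof (cases "\<exists>x\<in>J. x \<in> \<int>")
    case True
    then obtain n :: int where n: "of_int n \<in> J" by (auto elim!: Ints_cases)
    obtain e where e: "e > 0" "ball (of_int n) e \<subseteq> J"
      using \<open>open J\<close> n by (meson open_contains_ball)
    define d where "d = min (e / 2) (1 / 2)"
    have d: "0 < d" "d < e" "d < 1" using e(1) by (auto simp: d_def)
    then have "of_int n + d \<in> J" "of_int n - d \<in> J"
      using e(2) by (auto simp: subset_iff dist_real_def)
    then have "\<exists>x\<in>J. of_int n < x \<and> x < of_int n + 1"
      using d by (intro bexI[of _ "of_int n + d"]) simp_all
    moreover have "\<exists>x\<in>J. of_int (n - 1) < x \<and> x < of_int (n - 1) + 1"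
      using d \<open>of_int n - d \<in> J\<close> by (intro bexI[of _ "of_int n - d"]) simp_all
    ultimately have "{n - 1, n} \<subseteq> ?H" by (simp only: insert_subset mem_Collect_eq empty_subsetI simp_thms)
    moreover have "?H \<subseteq> {n - 1, n}"
    proof
      fix i assume "i \<in> ?H"
      then obtain x where x: "x \<in> J" "of_int i < x" "x < of_int i + 1" by auto
      then have "x - of_int n < 1" "of_int n - x < 1" using width n by auto
      then have "real_of_int i < of_int (n + 1)" "real_of_int (n - 1) < of_int (i + 1)" using x by auto
      then show "i \<in> {n - 1, n}" unfolding of_int_less_iff by auto
    qed
    ultimately have "?H = {n - 1, n}" by (rule equalityI[rotated])
    then show ?thesis using True by simp
  next
    case False
    then obtain x0 where x0: "x0 \<in> J" using assms by auto
    have "?H = {\<lfloor>x0\<rfloor>}"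
    proof (intro equalityI subsetI)
      fix i assume "i \<in> ?H"
      then obtain x where x: "x \<in> J" "of_int i < x" "x < of_int i + 1" by auto
      have conn: "y \<in> J" if "(x \<le> y \<and> y \<le> x0) \<or> (x0 \<le> y \<and> y \<le> x)" for y
        using \<open>convex J\<close> x0 x(1) that mem_is_interval_1_I unfolding is_interval_convex_1[symmetric] by blast
      have "i = \<lfloor>x0\<rfloor>"
      proof (rule ccontr)
        assume "i \<noteq> \<lfloor>x0\<rfloor>"
        then consider "of_int i + 1 \<le> x0" | "x0 < of_int i" by linarith
        then have "of_int (i + 1) \<in> J \<or> of_int i \<in> J"
          using conn[of "of_int (i + 1)"] conn[of "of_int i"] x by cases auto
        then show False using False by (meson Ints_of_int)
      qed
      then show "i \<in> {\<lfloor>x0\<rfloor>}" by simp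
    next
      fix i assume "i \<in> {\<lfloor>x0\<rfloor>}"
      moreover have "x0 \<noteq> of_int \<lfloor>x0\<rfloor>" using False x0 by (metis Ints_of_int)
      ultimately show "i \<in> ?H" using x0
        by (auto intro!: bexI[of _ x0]) linarith
    qed
    then show ?thesis using False by simp
  qed
  then show "finite ?H" "card ?H = 1 + of_bool (\<exists>x\<in>J. x \<in> \<int>)" by auto
qed

text \<open>
  Cutting each of finitely many sets by the integer levels of \<open>f\<close> adds one piece for every set that
  meets such a level.
\<close>

lemma card_refine_by_integer_levels:
  fixes V :: "'c \<Rightarrow> 'd set" and f :: "'d \<Rightarrow> real"
  assumes "finite I"
    and "\<And>c. c \<in> I \<Longrightarrow> open (f ` V c)" "\<And>c. c \<in> I \<Longrightarrow> convex (f ` V c)" "\<And>c. c \<in> I \<Longrightarrow> V c \<noteq> {}"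
    and "\<And>c p q. \<lbrakk>c \<in> I; p \<in> V c; q \<in> V c\<rbrakk> \<Longrightarrow> f p - f q < 1"
  shows "finite {(c, k::int). c \<in> I \<and> (\<exists>p\<in>V c. of_int k < f p \<and> f p < of_int k + 1)}"
    and "card {(c, k::int). c \<in> I \<and> (\<exists>p\<in>V c. of_int k < f p \<and> f p < of_int k + 1)}
       = card I + card {c \<in> I. \<exists>p\<in>V c. f p \<in> \<int>}"
proof -
  define H where "H c = {k::int. \<exists>x \<in> f ` V c. of_int k < x \<and> x < of_int k + 1}" for c
  have H: "finite (H c)" "card (H c) = 1 + of_bool (\<exists>p\<in>V c. f p \<in> \<int>)" if "c \<in> I" for c
    using card_unit_intervals_hit[of "f ` V c"] assms that unfolding H_def by auto
  have eq: "{(c, k::int). c \<in> I \<and> (\<exists>p\<in>V c. of_int k < f p \<and> f p < of_int k + 1)} = Sigma I H"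
    by (auto simp: H_def)
  show "finite {(c, k::int). c \<in> I \<and> (\<exists>p\<in>V c. of_int k < f p \<and> f p < of_int k + 1)}"
    unfolding eq using assms(1) H(1) by auto
  have "card (Sigma I H) = (\<Sum>c\<in>I. 1 + of_bool (\<exists>p\<in>V c. f p \<in> \<int>))"
    using assms(1) H by (simp add: card_SigmaI)
  also have "\<dots> = card I + card {c \<in> I. \<exists>p\<in>V c. f p \<in> \<int>}"
    using sum_of_bool_eq[of I "\<lambda>c. \<exists>p\<in>V c. f p \<in> \<int>", where ?'a = nat] assms(1)
    by (simp only: sum.distrib card_eq_sum Int_def mem_Collect_eq of_nat_id if_True simp_thms)
  finally show "card {(c, k::int). c \<in> I \<and> (\<exists>p\<in>V c. of_int k < f p \<and> f p < of_int k + 1)}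
       = card I + card {c \<in> I. \<exists>p\<in>V c. f p \<in> \<int>}" unfolding eq .
qed

text \<open>
  The open triangles between the lines \<open>x \<in> \<int>\<close>, \<open>y \<in> \<int>\<close>, \<open>x + y \<in> \<int>\<close>, indexed by the integer parts of
  \<open>x\<close>, \<open>y\<close>, \<open>x + y\<close>. The cell is empty unless \<open>k\<close> is \<open>i + j\<close> or \<open>i + j + 1\<close>. The nesting of the index
  follows the order in which the families of lines cut a set.
\<close>

definition cell :: "(int \<times> int) \<times> int \<Rightarrow> (real \<times> real) set" where
  "cell = (\<lambda>((i, j), k). {(x, y). of_int i < x \<and> x < of_int i + 1 \<and> of_int j < y \<and> y < of_int j + 1
      \<and> of_int k < x + y \<and> x + y < of_int k + 1})"

lemma linear_coordinate_sum: "linear (\<lambda>p::real \<times> real. fst p + snd p)"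
  by (rule linear_compose_add[OF linear_fst linear_snd])

lemma open_image_coordinate_sum:
  fixes V :: "(real \<times> real) set"
  assumes "open V" shows "open ((\<lambda>p. fst p + snd p) ` V)"
proof (rule open_surjective_linear_image[OF assms linear_coordinate_sum])
  show "surj (\<lambda>p::real \<times> real. fst p + snd p)"
    by (rule surjI[of _ "\<lambda>x. (x, 0)"]) simp
qed

lemma int_eq_of_close: "\<lbrakk>x - y < (1::real); y - x < 1; x \<in> \<int>; y \<in> \<int>\<rbrakk> \<Longrightarrow> x = y"
  by (metis Ints_diff Ints_nonzero_abs_less1 abs_less_iff eq_iff_diff_eq_0 minus_diff_eq)

text \<open>
  The set \<open>U\<close> is cut by the vertical line that meets it, then by the horizontal and finally by the
  diagonal one. The number of pieces added by a line is the number of pieces into which the earlier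
  lines cut its chord in \<open>U\<close>, and the chord can only be cut at a lattice vertex.
\<close>

lemma card_cells_hit:
  fixes U :: "(real \<times> real) set"
  assumes U: "open U" "convex U" "U \<noteq> {}"
    and w1: "\<And>p q. \<lbrakk>p \<in> U; q \<in> U\<rbrakk> \<Longrightarrow> fst p - fst q < 1"
    and w2: "\<And>p q. \<lbrakk>p \<in> U; q \<in> U\<rbrakk> \<Longrightarrow> snd p - snd q < 1"
    and w3: "\<And>p q. \<lbrakk>p \<in> U; q \<in> U\<rbrakk> \<Longrightarrow> (fst p + snd p) - (fst q + snd q) < 1"
  shows "card {c. cell c \<inter> U \<noteq> {}} = 1 + of_bool (\<exists>p\<in>U. fst p \<in> \<int>) + of_bool (\<exists>p\<in>U. snd p \<in> \<int>)
      + of_bool (\<exists>p\<in>U. fst p + snd p \<in> \<int>) + 2 * of_bool (\<exists>p\<in>U. fst p \<in> \<int> \<and> snd p \<in> \<int>)"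
proof -
  let ?v = "\<exists>p\<in>U. fst p \<in> \<int> \<and> snd p \<in> \<int>"
  define A where "A = {i::int. \<exists>x\<in>fst ` U. of_int i < x \<and> x < of_int i + 1}"
  define VA where "VA i = {p\<in>U. of_int i < fst p \<and> fst p < of_int i + 1}" for i :: int
  define AB where "AB = {(i, j::int). i \<in> A \<and> (\<exists>p\<in>VA i. of_int j < snd p \<and> snd p < of_int j + 1)}"
  define VB where "VB c = {p\<in>VA (fst c). of_int (snd c) < snd p \<and> snd p < of_int (snd c) + 1}" for c :: "int \<times> int"
  define ABC where "ABC = {(c, k::int). c \<in> AB \<and> (\<exists>p\<in>VB c. of_int k < fst p + snd p \<and> fst p + snd p < of_int k + 1)}"
  have slab: "{p::real\<times>real. r < fst p \<and> fst p < t} = {r<..<t} \<times> UNIV"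
    "{p::real\<times>real. r < snd p \<and> snd p < t} = UNIV \<times> {r<..<t}" for r t by auto
  have VA_eq: "VA i = U \<inter> ({of_int i<..<of_int i + 1} \<times> UNIV)" for i by (auto simp: VA_def)
  have VB_eq: "VB c = VA (fst c) \<inter> (UNIV \<times> {of_int (snd c)<..<of_int (snd c) + 1})" for c by (auto simp: VB_def)
  have VA: "open (VA i)" "convex (VA i)" "VA i \<subseteq> U" for i
    unfolding VA_eq using U by (auto intro!: open_Times convex_Int convex_Times)
  have VB: "open (VB c)" "convex (VB c)" "VB c \<subseteq> U" for c
    using VA unfolding VB_eq by (auto intro!: open_Times convex_Int convex_Times)
  have lin: "linear (\<lambda>p::real \<times> real. fst p)" "linear (\<lambda>p::real \<times> real. snd p)" "linear (\<lambda>p::real \<times> real. fst p + snd p)"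
    by (rule linear_fst linear_snd linear_coordinate_sum)+
  have A: "finite A" "card A = 1 + of_bool (\<exists>p\<in>U. fst p \<in> \<int>)"
  proof -
    have "\<forall>x\<in>fst ` U. \<forall>y\<in>fst ` U. x - y < 1" using w1 by blast
    from card_unit_intervals_hit[OF open_image_fst[OF U(1)] convex_linear_image[OF lin(1) U(2)] _ this]
    show "finite A" "card A = 1 + of_bool (\<exists>p\<in>U. fst p \<in> \<int>)" using U(3) unfolding A_def by (simp_all add: image_iff)
  qed
  have VA_ne: "VA i \<noteq> {}" if "i \<in> A" for i using that by (auto simp: A_def VA_def)
  have AB: "finite AB" "card AB = card A + card {i \<in> A. \<exists>p\<in>VA i. snd p \<in> \<int>}"
  proof -
    have "snd p - snd q < 1" if "p \<in> VA i" "q \<in> VA i" for i p q using that VA(3) w2 by blast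
    from card_refine_by_integer_levels[of A snd VA, OF A(1) open_image_snd[OF VA(1)] convex_linear_image[OF lin(2) VA(2)] VA_ne this]
    show "finite AB" "card AB = card A + card {i \<in> A. \<exists>p\<in>VA i. snd p \<in> \<int>}" unfolding AB_def by simp_all
  qed
  have VB_ne: "VB c \<noteq> {}" if "c \<in> AB" for c using that by (cases c) (fastforce simp: AB_def VB_def)
  have ABC: "finite ABC" "card ABC = card AB + card {c \<in> AB. \<exists>p\<in>VB c. fst p + snd p \<in> \<int>}"
  proof -
    have "(fst p + snd p) - (fst q + snd q) < 1" if "p \<in> VB c" "q \<in> VB c" for c p q using that VB(3) w3 by blast
    from card_refine_by_integer_levels[of AB "\<lambda>p. fst p + snd p" VB, OF AB(1) open_image_coordinate_sum[OF VB(1)]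
        convex_linear_image[OF lin(3) VB(2)] VB_ne this]
    show "finite ABC" "card ABC = card AB + card {c \<in> AB. \<exists>p\<in>VB c. fst p + snd p \<in> \<int>}"
      unfolding ABC_def by simp_all
  qed
  have hit: "{c. cell c \<inter> U \<noteq> {}} = ABC"
  proof (rule set_eqI)
    fix c :: "(int \<times> int) \<times> int"
    obtain i j k where c: "c = ((i, j), k)" by (metis prod.collapse)
    have "c \<in> {c. cell c \<inter> U \<noteq> {}} \<longleftrightarrow> (\<exists>p\<in>U. of_int i < fst p \<and> fst p < of_int i + 1
        \<and> of_int j < snd p \<and> snd p < of_int j + 1 \<and> of_int k < fst p + snd p \<and> fst p + snd p < of_int k + 1)"
      by (force simp: c cell_def)
    also have "\<dots> \<longleftrightarrow> c \<in> ABC"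
      by (auto simp: c ABC_def AB_def A_def VB_def VA_def image_iff Bex_def)
    finally show "c \<in> {c. cell c \<inter> U \<noteq> {}} \<longleftrightarrow> c \<in> ABC" .
  qed
  have Y: "card {i \<in> A. \<exists>p\<in>VA i. snd p \<in> \<int>} = of_bool (\<exists>p\<in>U. snd p \<in> \<int>) + of_bool ?v"
  proof (cases "\<exists>p\<in>U. snd p \<in> \<int>")
    case True
    then obtain p0 where p0: "p0 \<in> U" "snd p0 \<in> \<int>" by blast
    \<comment> \<open>The chord of the horizontal line, parametrised by its first coordinate.\<close>
    define J where "J = (\<lambda>x. (x, snd p0)) -` U"
    have only: "snd p = snd p0" if "p \<in> U" "snd p \<in> \<int>" for p
      using int_eq_of_close w2 that p0 by blast
    have "open J" unfolding J_def using U(1) by (intro continuous_open_vimage) (auto intro!: continuous_intros)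
    moreover have "convex J" unfolding J_def
    proof (rule convexI)
      fix x y u v :: real assume *: "x \<in> (\<lambda>x. (x, snd p0)) -` U" "y \<in> (\<lambda>x. (x, snd p0)) -` U" "0 \<le> u" "0 \<le> v" "u + v = 1"
      then have "u *\<^sub>R (x, snd p0) + v *\<^sub>R (y, snd p0) \<in> U" using U(2) by (intro convexD) auto
      moreover have "u * snd p0 + v * snd p0 = snd p0" using *(5) by (metis distrib_right mult_1)
      ultimately show "u *\<^sub>R x + v *\<^sub>R y \<in> (\<lambda>x. (x, snd p0)) -` U" by simp
    qed
    moreover have "fst p0 \<in> J" using p0 by (simp add: J_def)
    then have "J \<noteq> {}" by blast
    moreover have "\<forall>x\<in>J. \<forall>y\<in>J. x - y < 1" using w1 unfolding J_def by fastforce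
    ultimately have "card {i::int. \<exists>x\<in>J. of_int i < x \<and> x < of_int i + 1} = 1 + of_bool (\<exists>x\<in>J. x \<in> \<int>)"
      by (rule card_unit_intervals_hit)
    moreover have "{i \<in> A. \<exists>p\<in>VA i. snd p \<in> \<int>} = {i::int. \<exists>x\<in>J. of_int i < x \<and> x < of_int i + 1}"
    proof (intro equalityI subsetI)
      fix i assume "i \<in> {i \<in> A. \<exists>p\<in>VA i. snd p \<in> \<int>}"
      then obtain p where p: "p \<in> U" "of_int i < fst p" "fst p < of_int i + 1" "snd p \<in> \<int>"
        by (auto simp: VA_def)
      then have "fst p \<in> J" using only[of p] by (auto simp: J_def) (metis prod.collapse)
      then show "i \<in> {i::int. \<exists>x\<in>J. of_int i < x \<and> x < of_int i + 1}" using p by auto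
    next
      fix i assume "i \<in> {i::int. \<exists>x\<in>J. of_int i < x \<and> x < of_int i + 1}"
      then obtain x where "x \<in> J" "of_int i < x" "x < of_int i + 1" by auto
      then show "i \<in> {i \<in> A. \<exists>p\<in>VA i. snd p \<in> \<int>}"
        using p0 by (force simp: J_def A_def VA_def)
    qed
    moreover have "(\<exists>x\<in>J. x \<in> \<int>) \<longleftrightarrow> ?v"
      using only p0 unfolding J_def by (metis fst_conv snd_conv prod.collapse vimage_eq)
    ultimately show ?thesis using True by simp
  next
    case False
    then have "{i \<in> A. \<exists>p\<in>VA i. snd p \<in> \<int>} = {}" using VA by blast
    moreover have "\<not> ?v" using False by blast
    ultimately show ?thesis using False by (simp only: card.empty of_bool_eq)
  qed
  have S: "card {c \<in> AB. \<exists>p\<in>VB c. fst p + snd p \<in> \<int>} = of_bool (\<exists>p\<in>U. fst p + snd p \<in> \<int>) + of_bool ?v"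
  proof (cases "\<exists>p\<in>U. fst p + snd p \<in> \<int>")
    case True
    then obtain p0 where p0: "p0 \<in> U" "fst p0 + snd p0 \<in> \<int>" by blast
    then obtain k where k: "fst p0 + snd p0 = of_int k" by (auto elim: Ints_cases)
    \<comment> \<open>The chord of the diagonal line, again parametrised by its first coordinate.\<close>
    define J where "J = (\<lambda>x. (x, of_int k - x)) -` U"
    have only: "snd p = of_int k - fst p" if "p \<in> U" "fst p + snd p \<in> \<int>" for p
      using int_eq_of_close[of "fst p + snd p" "fst p0 + snd p0"] w3 that p0 k by fastforce
    have "open J" unfolding J_def using U(1) by (intro continuous_open_vimage) (auto intro!: continuous_intros)
    moreover have "convex J" unfolding J_def
    proof (rule convexI)
      fix x y u v :: real assume *: "x \<in> (\<lambda>x. (x, of_int k - x)) -` U" "y \<in> (\<lambda>x. (x, of_int k - x)) -` U" "0 \<le> u" "0 \<le> v" "u + v = 1"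
      then have "u *\<^sub>R (x, of_int k - x) + v *\<^sub>R (y, of_int k - y) \<in> U" using U(2) by (intro convexD) auto
      moreover have "u * (of_int k - x) + v * (of_int k - y) = (u + v) * of_int k - (u * x + v * y)"
        by (simp add: algebra_simps)
      then have "u * (of_int k - x) + v * (of_int k - y) = of_int k - (u * x + v * y)"
        using *(5) by simp
      ultimately show "u *\<^sub>R x + v *\<^sub>R y \<in> (\<lambda>x. (x, of_int k - x)) -` U" by simp
    qed
    moreover have "fst p0 \<in> J" using p0 by (simp add: J_def flip: k)
    then have "J \<noteq> {}" by blast
    moreover have "\<forall>x\<in>J. \<forall>y\<in>J. x - y < 1" using w1 unfolding J_def by fastforce
    ultimately have "card {i::int. \<exists>x\<in>J. of_int i < x \<and> x < of_int i + 1} = 1 + of_bool (\<exists>x\<in>J. x \<in> \<int>)"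
      by (rule card_unit_intervals_hit)
    \<comment> \<open>On the line x + y = k the integer part of x determines that of y, with a loss of 1 because neither is an integer.\<close>
    moreover have "{c \<in> AB. \<exists>p\<in>VB c. fst p + snd p \<in> \<int>} = (\<lambda>i. (i, k - i - 1)) ` {i::int. \<exists>x\<in>J. of_int i < x \<and> x < of_int i + 1}"
    proof (intro equalityI subsetI)
      fix c assume "c \<in> {c \<in> AB. \<exists>p\<in>VB c. fst p + snd p \<in> \<int>}"
      then obtain p where p: "p \<in> U" "of_int (fst c) < fst p" "fst p < of_int (fst c) + 1"
        "of_int (snd c) < snd p" "snd p < of_int (snd c) + 1" "fst p + snd p \<in> \<int>"
        by (auto simp: VA_def VB_def)
      have sp: "snd p = of_int k - fst p" using only p by blast
      then have "fst p \<in> J" using p(1) by (auto simp: J_def) (metis prod.collapse)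
      moreover have "snd c = k - fst c - 1" using p sp by linarith
      ultimately show "c \<in> (\<lambda>i. (i, k - i - 1)) ` {i::int. \<exists>x\<in>J. of_int i < x \<and> x < of_int i + 1}"
        using p by (intro image_eqI[of _ _ "fst c"]) (auto simp: prod_eq_iff)
    next
      fix c assume "c \<in> (\<lambda>i. (i, k - i - 1)) ` {i::int. \<exists>x\<in>J. of_int i < x \<and> x < of_int i + 1}"
      then obtain i x where x: "x \<in> J" "of_int i < x" "x < of_int i + 1" "c = (i, k - i - 1)" by auto
      then have "(x, of_int k - x) \<in> U" by (simp add: J_def)
      then have "(x, of_int k - x) \<in> VB c" "(x, of_int k - x) \<in> VA i" using x by (auto simp: VA_def VB_def)
      then have "i \<in> A" by (force simp: A_def VA_def)
      moreover have "\<exists>p\<in>VA i. of_int (k - i - 1) < snd p \<and> snd p < of_int (k - i - 1) + 1"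
        using \<open>(x, of_int k - x) \<in> VA i\<close> x by (intro bexI[of _ "(x, of_int k - x)"]) simp_all
      ultimately have "c \<in> AB" unfolding AB_def x(4) by blast
      moreover have "fst (x, of_int k - x) + snd (x, of_int k - x) \<in> \<int>" by simp
      ultimately show "c \<in> {c \<in> AB. \<exists>p\<in>VB c. fst p + snd p \<in> \<int>}"
        using \<open>(x, of_int k - x) \<in> VB c\<close> by blast
    qed
    moreover have "inj_on (\<lambda>i. (i, k - i - 1)) X" for X by (auto intro: inj_onI)
    moreover have "(\<exists>x\<in>J. x \<in> \<int>) \<longleftrightarrow> ?v"
    proof
      assume "\<exists>x\<in>J. x \<in> \<int>"
      then show ?v by (force simp: J_def)
    next
      assume ?v
      then obtain p where p: "p \<in> U" "fst p \<in> \<int>" "snd p \<in> \<int>" by blast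
      then have "snd p = of_int k - fst p" using only by simp
      then have "fst p \<in> J" using p(1) by (auto simp: J_def) (metis prod.collapse)
      then show "\<exists>x\<in>J. x \<in> \<int>" using p by blast
    qed
    ultimately show ?thesis using True by (simp add: card_image)
  next
    case False
    then have "{c \<in> AB. \<exists>p\<in>VB c. fst p + snd p \<in> \<int>} = {}" using VB by blast
    moreover have "\<not> ?v" using False by (meson Ints_add)
    ultimately show ?thesis using False by (simp only: card.empty of_bool_eq)
  qed
  show ?thesis unfolding hit ABC(2) AB(2) A(2) Y S by simp
qed

section \<open>Areas in the unit square\<close>

text \<open>
  Half open, so that its integer translates tile the plane without overlap.
\<close>

definition unit_square :: "(real \<times> real) set" where
  "unit_square = {0..<1} \<times> {0..<1}"

definition near_int :: "real \<Rightarrow> real set" where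
  "near_int r = {x. \<exists>n::int. \<bar>x - of_int n\<bar> < r}"

lemma near_int_measurable [measurable]: "near_int r \<in> sets borel"
proof -
  have "near_int r = (\<Union>n::int. ball (of_int n) r)"
    by (auto simp: near_int_def dist_real_def abs_minus_commute)
  then show ?thesis by (auto intro: borel_open)
qed

lemma coordinate_measurable [measurable]:
  "(fst :: real \<times> real \<Rightarrow> real) \<in> borel \<rightarrow>\<^sub>M borel"
  "(snd :: real \<times> real \<Rightarrow> real) \<in> borel \<rightarrow>\<^sub>M borel"
  by (intro borel_measurable_continuous_onI continuous_intros)+

lemma unit_square_measurable [measurable]: "unit_square \<in> sets borel"
  unfolding unit_square_def by (auto simp flip: borel_prod)

lemma emeasure_unit_square: "emeasure lborel unit_square = 1"
  unfolding unit_square_def lborel_prod[symmetric]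
  by (subst lborel.emeasure_pair_measure_Times) auto

lemma unit_interval_tiling: "\<exists>!g. g \<in> \<int> \<and> (z::real) - g \<in> {0..<1}"
proof (rule ex1I[of _ "of_int \<lfloor>z\<rfloor>"])
  fix g assume g: "g \<in> \<int> \<and> z - g \<in> {0..<1}"
  then obtain n where "g = of_int n" by (auto elim: Ints_cases)
  with g show "g = of_int \<lfloor>z\<rfloor>" by (simp add: floor_unique[of n z])
qed (auto, linarith)

lemma unit_square_tiling: "\<exists>!g. g \<in> \<int> \<times> \<int> \<and> (z::real \<times> real) - g \<in> unit_square"
proof -
  obtain a where a: "a \<in> \<int>" "fst z - a \<in> {0..<1}" "\<And>b. b \<in> \<int> \<and> fst z - b \<in> {0..<1} \<Longrightarrow> b = a"
    using unit_interval_tiling[of "fst z"] by blast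
  obtain b where b: "b \<in> \<int>" "snd z - b \<in> {0..<1}" "\<And>c. c \<in> \<int> \<and> snd z - c \<in> {0..<1} \<Longrightarrow> c = b"
    using unit_interval_tiling[of "snd z"] by blast
  show ?thesis
  proof (rule ex1I[of _ "(a, b)"])
    show "(a, b) \<in> \<int> \<times> \<int> \<and> z - (a, b) \<in> unit_square"
      using a(1,2) b(1,2) by (simp add: unit_square_def mem_Times_iff)
    fix g assume "g \<in> \<int> \<times> \<int> \<and> z - g \<in> unit_square"
    then show "g = (a, b)" using a(3)[of "fst g"] b(3)[of "snd g"]
      by (simp add: unit_square_def mem_Times_iff prod_eq_iff)
  qed
qed

lemma unit_square_translate_unique:
  assumes "g \<in> \<int> \<times> \<int>" "g' \<in> \<int> \<times> \<int>" "z - g \<in> unit_square" "z - g' \<in> unit_square"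
  shows "g = g'"
proof -
  obtain h where h: "\<forall>g. g \<in> \<int> \<times> \<int> \<and> z - g \<in> unit_square \<longrightarrow> g = h"
    using unit_square_tiling[of z] unfolding Ex1_def by (elim exE conjE)
  have "g = h" by (rule h[rule_format]) (intro conjI assms)
  moreover have "g' = h" by (rule h[rule_format]) (intro conjI assms)
  ultimately show ?thesis by simp
qed

lemma countable_Ints_real: "countable (\<int> :: real set)"
  unfolding Ints_def by simp

text \<open>
  The points of a period within distance \<open>r\<close> of an integer, after a shift: folding the interval of
  length \<open>2 r\<close> into the period does not change its length.
\<close>

lemma emeasure_near_int:
  assumes "0 \<le> r" "r \<le> 1 / 2"
  shows "emeasure lborel {x \<in> {0..<1}. x + m \<in> near_int r} = ennreal (2 * r)"
proof -
  define A where "A = {- m - r<..<- m + r}"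
  have "{x \<in> {0..<1}. x + m \<in> near_int r} = {x \<in> {0..<1}. \<exists>g\<in>\<int>. x + g \<in> A}"
  proof (intro Collect_cong conj_cong refl)
    fix x :: real
    show "x + m \<in> near_int r \<longleftrightarrow> (\<exists>g\<in>\<int>. x + g \<in> A)"
    proof
      assume "x + m \<in> near_int r"
      then obtain n :: int where "\<bar>x + m - of_int n\<bar> < r" by (auto simp: near_int_def)
      then show "\<exists>g\<in>\<int>. x + g \<in> A" by (intro bexI[of _ "of_int (- n)"]) (auto simp: A_def abs_less_iff)
    next
      assume "\<exists>g\<in>\<int>. x + g \<in> A"
      then obtain n :: int where "x + of_int n \<in> A" by (auto elim: Ints_cases)
      then show "x + m \<in> near_int r"
        unfolding near_int_def by (auto simp: A_def abs_less_iff intro!: exI[of _ "- n"])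
    qed
  qed
  also have "emeasure lborel \<dots> = emeasure lborel A"
  proof (rule emeasure_fundamental_domain[OF countable_Ints_real _ _ unit_interval_tiling])
    fix z g g' :: real assume "g \<in> \<int>" "g' \<in> \<int>" "z + g \<in> A" "z + g' \<in> A"
    then show "g = g'" using assms by (intro int_eq_of_close) (auto simp: A_def)
  qed (auto simp: A_def)
  also have "\<dots> = ennreal (2 * r)" using assms by (simp add: A_def)
  finally show ?thesis .
qed

text \<open>
  Independence of one coordinate and the sum of the coordinates modulo 1: for every fixed value of
  the coordinate, the fibre is again a shifted neighbourhood of the integers.
\<close>

lemma emeasure_square_sum_near_int:
  fixes A :: "real set"
  assumes A[measurable]: "A \<in> sets borel" and r: "0 \<le> r" "r \<le> 1 / 2"
  shows "emeasure lborel {z \<in> unit_square. fst z \<in> A \<and> fst z + snd z + m \<in> near_int r}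
      = emeasure lborel {x \<in> {0..<1}. x \<in> A} * ennreal (2 * r)" (is ?fst)
    and "emeasure lborel {z \<in> unit_square. snd z \<in> A \<and> fst z + snd z + m \<in> near_int r}
      = emeasure lborel {x \<in> {0..<1}. x \<in> A} * ennreal (2 * r)" (is ?snd)
proof -
  have slice: "(\<integral>\<^sup>+y. indicator ({0..<1} \<inter> A) x * indicator {y \<in> {0..<1}. y + (x + m) \<in> near_int r} y \<partial>lborel)
    = indicator ({0..<1} \<inter> A) x * ennreal (2 * r)" for x :: real
    using emeasure_near_int[OF r, of "x + m"] by (simp add: nn_integral_cmult)
  have total: "(\<integral>\<^sup>+x. indicator ({0..<1} \<inter> A) x * ennreal (2 * r) \<partial>lborel)
    = emeasure lborel {x \<in> {0..<1}. x \<in> A} * ennreal (2 * r)"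
    by (simp add: nn_integral_multc Int_def)
  have "emeasure lborel {z \<in> unit_square. fst z \<in> A \<and> fst z + snd z + m \<in> near_int r}
      = (\<integral>\<^sup>+z. indicator {z \<in> unit_square. fst z \<in> A \<and> fst z + snd z + m \<in> near_int r} z \<partial>lborel)"
    by (rule nn_integral_indicator[symmetric]) measurable
  also have "\<dots> = (\<integral>\<^sup>+x. \<integral>\<^sup>+y. indicator {z \<in> unit_square. fst z \<in> A \<and> fst z + snd z + m \<in> near_int r} (x, y) \<partial>lborel \<partial>lborel)"
    by (rule nn_integral_lborel_pair(1)) measurable
  also have "\<dots> = (\<integral>\<^sup>+x. \<integral>\<^sup>+y. indicator ({0..<1} \<inter> A) x * indicator {y \<in> {0..<1}. y + (x + m) \<in> near_int r} y \<partial>lborel \<partial>lborel)"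
    by (intro nn_integral_cong) (auto simp: indicator_def unit_square_def ac_simps)
  also have "\<dots> = emeasure lborel {x \<in> {0..<1}. x \<in> A} * ennreal (2 * r)"
    unfolding slice total ..
  finally show ?fst .
  have "emeasure lborel {z \<in> unit_square. snd z \<in> A \<and> fst z + snd z + m \<in> near_int r}
      = (\<integral>\<^sup>+z. indicator {z \<in> unit_square. snd z \<in> A \<and> fst z + snd z + m \<in> near_int r} z \<partial>lborel)"
    by (rule nn_integral_indicator[symmetric]) measurable
  also have "\<dots> = (\<integral>\<^sup>+x. \<integral>\<^sup>+y. indicator {z \<in> unit_square. snd z \<in> A \<and> fst z + snd z + m \<in> near_int r} (y, x) \<partial>lborel \<partial>lborel)"
    by (rule nn_integral_lborel_pair(2)) measurable
  also have "\<dots> = (\<integral>\<^sup>+x. \<integral>\<^sup>+y. indicator ({0..<1} \<inter> A) x * indicator {y \<in> {0..<1}. y + (x + m) \<in> near_int r} y \<partial>lborel \<partial>lborel)"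
    by (intro nn_integral_cong) (auto simp: indicator_def unit_square_def ac_simps)
  also have "\<dots> = emeasure lborel {x \<in> {0..<1}. x \<in> A} * ennreal (2 * r)"
    unfolding slice total ..
  finally show ?snd .
qed

lemma emeasure_square_Times:
  assumes [measurable]: "A \<in> sets borel" "B \<in> sets borel"
  shows "emeasure lborel {z \<in> unit_square. fst z \<in> A \<and> snd z \<in> B}
      = emeasure lborel {x \<in> {0..<1}. x \<in> A} * emeasure lborel {x \<in> {0..<1}. x \<in> B}"
proof -
  have "{z \<in> unit_square. fst z \<in> A \<and> snd z \<in> B} = {x \<in> {0..<1}. x \<in> A} \<times> {x \<in> {0..<1}. x \<in> B}"
    by (auto simp: unit_square_def)
  then show ?thesis
    unfolding lborel_prod[symmetric] by (simp add: lborel.emeasure_pair_measure_Times)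
qed

lemma emeasure_right_triangle:
  assumes L: "0 \<le> L"
  shows "emeasure lborel {z. a \<le> fst z \<and> b \<le> snd z \<and> fst z + snd z \<le> a + b + (L::real)} = ennreal (L\<^sup>2 / 2)"
proof -
  let ?T = "{z. a \<le> fst z \<and> b \<le> snd z \<and> fst z + snd z \<le> a + b + L}"
  have "closed ?T"
    by (intro closed_Collect_conj closed_Collect_le continuous_intros)
  then have [measurable]: "?T \<in> sets borel" by (rule borel_closed)
  have "emeasure lborel ?T = (\<integral>\<^sup>+z. indicator ?T z \<partial>lborel)"
    by (rule nn_integral_indicator[symmetric]) measurable
  also have "\<dots> = (\<integral>\<^sup>+x. \<integral>\<^sup>+y. indicator ?T (x, y) \<partial>lborel \<partial>lborel)"
    by (rule nn_integral_lborel_pair(1)) measurable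
  also have "\<dots> = (\<integral>\<^sup>+x. ennreal (a + L - x) * indicator {a..a + L} x \<partial>lborel)"
  proof (rule nn_integral_cong)
    fix x :: real
    have "(\<integral>\<^sup>+y. indicator ?T (x, y) \<partial>lborel) = (\<integral>\<^sup>+y. indicator {a..a + L} x * indicator {b..a + b + L - x} y \<partial>lborel)"
      using L by (intro nn_integral_cong) (auto simp: indicator_def)
    also have "\<dots> = indicator {a..a + L} x * emeasure lborel {b..a + b + L - x}"
      by (simp add: nn_integral_cmult)
    also have "\<dots> = ennreal (a + L - x) * indicator {a..a + L} x"
      by (auto simp: indicator_def)
    finally show "(\<integral>\<^sup>+y. indicator ?T (x, y) \<partial>lborel) = ennreal (a + L - x) * indicator {a..a + L} x" .
  qed
  also have "\<dots> = ennreal ((\<lambda>x. - (a + L - x)\<^sup>2 / 2) (a + L) - (\<lambda>x. - (a + L - x)\<^sup>2 / 2) a)"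
    by (rule nn_integral_FTC_Icc) (use L in \<open>auto intro!: derivative_eq_intros simp: field_simps\<close>)
  finally show ?thesis by simp
qed

text \<open>
  By periodicity the shift \<open>(m1, m2)\<close> may be dropped. Without it, the admissible set in the unit
  square consists of two right isosceles triangles with legs \<open>1 - (r1 + r2 + r3)\<close>, one in each of the
  two cells of the square. The triangle inequalities between the \<open>r\<close> make
  the three lines bounding a cell the only ones that matter.
\<close>

lemma emeasure_square_avoid_all_lines:
  assumes r: "0 < r1" "0 < r2" "0 < r3" "r1 \<le> r2 + r3" "r2 \<le> r1 + r3" "r3 \<le> r1 + r2" "r1 + r2 + r3 \<le> 1"
  shows "emeasure lborel {z \<in> unit_square. fst z + m1 \<notin> near_int r1 \<and> snd z + m2 \<notin> near_int r2
            \<and> fst z + snd z + (m1 + m2) \<notin> near_int r3} = ennreal ((1 - (r1 + r2 + r3))\<^sup>2)"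
proof -
  define L where "L = 1 - (r1 + r2 + r3)"
  have L: "0 \<le> L" using r by (simp add: L_def)
  define E where "E = {z. fst z \<notin> near_int r1 \<and> snd z \<notin> near_int r2 \<and> fst z + snd z \<notin> near_int r3}"
  \<comment> \<open>The positions of the centre for which the body lies in the lower or the upper cell of the square.\<close>
  define Up where "Up = {z. r1 \<le> fst z \<and> r2 \<le> snd z \<and> fst z + snd z \<le> r1 + r2 + L}"
  define Dn where "Dn = {z. fst z \<le> 1 - r1 \<and> snd z \<le> 1 - r2 \<and> (1 - r1) + (1 - r2) - L \<le> fst z + snd z}"
  have [measurable]: "E \<in> sets borel" unfolding E_def by measurable
  have shift: "x + of_int n \<in> near_int r \<longleftrightarrow> x \<in> near_int r" for x r n
  proof
    assume "x + of_int n \<in> near_int r"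
    then obtain k :: int where "\<bar>x + of_int n - of_int k\<bar> < r" by (auto simp: near_int_def)
    then have "\<bar>x - of_int (k - n)\<bar> < r" by (simp add: algebra_simps)
    then show "x \<in> near_int r" unfolding near_int_def by blast
  next
    assume "x \<in> near_int r"
    then obtain k :: int where "\<bar>x - of_int k\<bar> < r" by (auto simp: near_int_def)
    then have "\<bar>x + of_int n - of_int (k + n)\<bar> < r" by simp
    then show "x + of_int n \<in> near_int r" unfolding near_int_def by blast
  qed
  have Eshift: "z + g \<in> E \<longleftrightarrow> z \<in> E" if "g \<in> \<int> \<times> \<int>" for z g
  proof -
    have "fst g \<in> \<int>" "snd g \<in> \<int>" using that by (simp_all add: mem_Times_iff)
    then obtain i j where ij: "fst g = of_int i" "snd g = of_int j" by (elim Ints_cases)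
    have "fst (z + g) + snd (z + g) = (fst z + snd z) + of_int (i + j)" by (simp add: ij)
    then show ?thesis unfolding E_def by (simp only: mem_Collect_eq shift fst_add snd_add ij)
  qed
  have disj: "x \<notin> near_int r \<longleftrightarrow> r \<le> x \<and> x \<le> 1 - r" if "0 \<le> x" "x < 1" "0 < r" "r \<le> 1 / 2" for x r
  proof
    assume *: "x \<notin> near_int r"
    then have "\<not> \<bar>x - of_int 0\<bar> < r" "\<not> \<bar>x - of_int 1\<bar> < r" unfolding near_int_def by blast+
    then show "r \<le> x \<and> x \<le> 1 - r" using that by simp
  next
    assume *: "r \<le> x \<and> x \<le> 1 - r"
    show "x \<notin> near_int r"
    proof
      assume "x \<in> near_int r"
      then obtain n :: int where n: "\<bar>x - of_int n\<bar> < r" by (auto simp: near_int_def)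
      consider "n \<le> 0" | "n \<ge> 1" by linarith
      then show False using n * by cases linarith+
    qed
  qed
  have rr: "r1 \<le> 1 / 2" "r2 \<le> 1 / 2" "r3 \<le> 1 / 2" using r by auto
  have E_eq: "{z \<in> unit_square. z \<in> E} = Up \<union> Dn"
  proof (intro set_eqI iffI)
    fix z assume "z \<in> {z \<in> unit_square. z \<in> E}"
    then have z: "0 \<le> fst z" "fst z < 1" "0 \<le> snd z" "snd z < 1" "z \<in> E"
      by (auto simp: unit_square_def)
    have "r1 \<le> fst z" "fst z \<le> 1 - r1" "r2 \<le> snd z" "snd z \<le> 1 - r2"
      using z disj r rr by (auto simp: E_def)
    moreover have "fst z + snd z \<le> 1 - r3 \<or> 1 + r3 \<le> fst z + snd z"
    proof -
      have "\<not> \<bar>fst z + snd z - of_int 1\<bar> < r3" using z(5) unfolding E_def near_int_def by blast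
      then show ?thesis by auto
    qed
    ultimately show "z \<in> Up \<union> Dn" by (auto simp: Up_def Dn_def L_def)
  next
    fix z assume "z \<in> Up \<union> Dn"
    then have z: "r1 \<le> fst z" "fst z \<le> 1 - r1" "r2 \<le> snd z" "snd z \<le> 1 - r2"
       "(r3 \<le> fst z + snd z \<and> fst z + snd z \<le> 1 - r3) \<or> (r3 \<le> (fst z + snd z) - 1 \<and> (fst z + snd z) - 1 \<le> 1 - r3)"
      using r by (auto simp: Up_def Dn_def L_def)
    have sq: "0 \<le> fst z" "fst z < 1" "0 \<le> snd z" "snd z < 1" using z r by auto
    have "fst z + snd z \<notin> near_int r3"
      using z(5)
    proof
      assume "r3 \<le> fst z + snd z \<and> fst z + snd z \<le> 1 - r3"
      then show ?thesis using disj[of "fst z + snd z" r3] r rr by auto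
    next
      assume "r3 \<le> fst z + snd z - 1 \<and> fst z + snd z - 1 \<le> 1 - r3"
      then show ?thesis using disj[of "fst z + snd z - 1" r3] shift[of "fst z + snd z - 1" 1] r rr by auto
    qed
    then show "z \<in> {z \<in> unit_square. z \<in> E}"
      using z sq disj r rr by (auto simp: E_def unit_square_def mem_Times_iff)
  qed
  define A where "A = {z. z + (m1, m2) \<in> unit_square \<and> z + (m1, m2) \<in> E}"
  have [measurable]: "A \<in> sets borel" unfolding A_def by measurable
  have UpDn: "closed Up" "closed Dn" unfolding Up_def Dn_def
    by (intro closed_Collect_conj closed_Collect_le continuous_intros)+
  have "{z \<in> unit_square. fst z + m1 \<notin> near_int r1 \<and> snd z + m2 \<notin> near_int r2
            \<and> fst z + snd z + (m1 + m2) \<notin> near_int r3} = {z \<in> unit_square. z + (m1, m2) \<in> E}"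
    by (auto simp: E_def ac_simps)
  also have "\<dots> = {z \<in> unit_square. \<exists>g\<in>\<int> \<times> \<int>. z + g \<in> A}"
  proof (intro Collect_cong conj_cong refl)
    fix z
    have per: "z + g + (m1, m2) \<in> E \<longleftrightarrow> z + (m1, m2) \<in> E" if "g \<in> \<int> \<times> \<int>" for g
      using Eshift[OF that, of "z + (m1, m2)"] by (simp add: ac_simps)
    obtain g where "g \<in> \<int> \<times> \<int>" "z + (m1, m2) - g \<in> unit_square"
      using unit_square_tiling by blast
    then have g: "- g \<in> \<int> \<times> \<int>" "z + (- g) + (m1, m2) \<in> unit_square" by (auto simp: mem_Times_iff algebra_simps)
    show "z + (m1, m2) \<in> E \<longleftrightarrow> (\<exists>g\<in>\<int> \<times> \<int>. z + g \<in> A)"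
    proof
      assume "z + (m1, m2) \<in> E"
      then have "z + (- g) \<in> A" using g per[OF g(1)] by (simp add: A_def)
      then show "\<exists>g\<in>\<int> \<times> \<int>. z + g \<in> A" using g(1) by (rule rev_bexI[rotated])
    next
      assume "\<exists>g\<in>\<int> \<times> \<int>. z + g \<in> A"
      then obtain g' where "g' \<in> \<int> \<times> \<int>" "z + g' \<in> A" by (elim bexE)
      then show "z + (m1, m2) \<in> E" using per[of g'] by (simp add: A_def)
    qed
  qed
  also have "emeasure lborel \<dots> = emeasure lborel A"
  proof (rule emeasure_fundamental_domain[OF _ _ _ unit_square_tiling])
    fix z g g' :: "real \<times> real" assume "g \<in> \<int> \<times> \<int>" "g' \<in> \<int> \<times> \<int>" "z + g \<in> A" "z + g' \<in> A"
    then have "- g \<in> \<int> \<times> \<int>" "- g' \<in> \<int> \<times> \<int>" "(z + (m1, m2)) - (- g) \<in> unit_square" "(z + (m1, m2)) - (- g') \<in> unit_square"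
      by (auto simp: A_def mem_Times_iff algebra_simps)
    then have "- g = - g'" by (rule unit_square_translate_unique)
    then show "g = g'" by simp
  qed (auto simp: countable_Ints_real)
  also have "emeasure lborel A = emeasure lborel {z \<in> unit_square. z \<in> E}"
    using emeasure_lborel_translate[of "{z \<in> unit_square. z \<in> E}" "(m1, m2)"] by (simp add: A_def)
  also have "\<dots> = emeasure lborel Up + emeasure lborel Dn"
    unfolding E_eq
  proof (rule plus_emeasure[symmetric])
    show "Up \<inter> Dn = {}" using r by (auto simp: Up_def Dn_def L_def)
  qed (use UpDn in auto)
  also have "emeasure lborel Up = ennreal (L\<^sup>2 / 2)"
    unfolding Up_def by (rule emeasure_right_triangle[OF L])
  also have "emeasure lborel Dn = ennreal (L\<^sup>2 / 2)"
  proof -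
    have "{z. (- 1 * fst z + 0 * snd z, 0 * fst z + - 1 * snd z) \<in> Dn}
      = {z. - (1 - r1) \<le> fst z \<and> - (1 - r2) \<le> snd z \<and> fst z + snd z \<le> - (1 - r1) + - (1 - r2) + L}"
      by (auto simp: Dn_def)
    then show ?thesis
      using emeasure_linear_preimage_plane[of Dn "-1" "-1" 0 0] UpDn
        emeasure_right_triangle[OF L, of "- (1 - r1)" "- (1 - r2)"] by simp
  qed
  also have "ennreal (L\<^sup>2 / 2) + ennreal (L\<^sup>2 / 2) = ennreal (L\<^sup>2)"
    by (subst ennreal_plus[symmetric]) auto
  finally show ?thesis unfolding L_def .
qed

section \<open>Centred parallelograms and the cells they meet\<close>

text \<open>
  The parallelogram with centre \<open>m\<close> and half-sides \<open>p\<close>, \<open>q\<close>. Centring makes the range of a linear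
  functional \<open>f\<close> on it the interval of radius \<open>\<bar>f p\<bar> + \<bar>f q\<bar>\<close> around \<open>f m\<close>.
\<close>

definition open_par :: "real \<times> real \<Rightarrow> real \<times> real \<Rightarrow> real \<times> real \<Rightarrow> (real \<times> real) set" where
  "open_par m p q = (\<lambda>w. m + (fst w *\<^sub>R p + snd w *\<^sub>R q)) ` ({-1<..<1} \<times> {-1<..<1})"

definition closed_par :: "real \<times> real \<Rightarrow> real \<times> real \<Rightarrow> real \<times> real \<Rightarrow> (real \<times> real) set" where
  "closed_par m p q = (\<lambda>w. m + (fst w *\<^sub>R p + snd w *\<^sub>R q)) ` ({-1..1} \<times> {-1..1})"

definition det2 :: "real \<times> real \<Rightarrow> real \<times> real \<Rightarrow> real" where
  "det2 p q = fst p * snd q - snd p * fst q"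

lemma linear_combination_plane: "linear (\<lambda>w::real \<times> real. fst w *\<^sub>R p + snd w *\<^sub>R (q :: real \<times> real))"
  by (rule linearI) (auto simp: algebra_simps)

lemma mem_open_par_shift: "z \<in> open_par m p q \<longleftrightarrow> z - m \<in> open_par 0 p q"
  unfolding open_par_def by (force simp: image_iff algebra_simps)

lemma open_open_par:
  assumes "det2 p q \<noteq> 0"
  shows "open (open_par m p q)"
proof -
  let ?T = "\<lambda>w::real \<times> real. fst w *\<^sub>R p + snd w *\<^sub>R q"
  have "surj ?T"
  proof (rule surjI)
    fix z :: "real \<times> real"
    define x y where "x = (fst z * snd q - snd z * fst q) / det2 p q" and "y = (fst p * snd z - snd p * fst z) / det2 p q"
    have "x * det2 p q = fst z * snd q - snd z * fst q" "y * det2 p q = fst p * snd z - snd p * fst z"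
      using assms by (simp_all add: x_def y_def)
    then have "(x * fst p + y * fst q - fst z) * det2 p q = 0" "(x * snd p + y * snd q - snd z) * det2 p q = 0"
      unfolding det2_def by algebra+
    then have "?T (x, y) = z" using assms by (simp add: prod_eq_iff)
    then show "?T ((fst z * snd q - snd z * fst q) / det2 p q, (fst p * snd z - snd p * fst z) / det2 p q) = z"
      unfolding x_def y_def .
  qed
  then have "open (?T ` ({-1<..<1} \<times> {-1<..<1}))"
    by (intro open_surjective_linear_image[OF _ linear_combination_plane] open_Times) auto
  then have "open ((+) m ` ?T ` ({-1<..<1} \<times> {-1<..<1}))"
    by (rule open_translation)
  then show ?thesis unfolding open_par_def image_image .
qed

lemma convex_open_par: "convex (open_par m p q)"
proof -
  let ?T = "\<lambda>w::real \<times> real. fst w *\<^sub>R p + snd w *\<^sub>R q"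
  have "convex ((+) m ` ?T ` ({-1<..<1} \<times> {-1<..<1}))"
    by (intro convex_translation convex_linear_image[OF linear_combination_plane] convex_Times) auto
  then show ?thesis unfolding open_par_def image_image .
qed

lemma open_par_nonempty: "m \<in> open_par m p q"
  unfolding open_par_def by (rule image_eqI[of _ _ "(0, 0)"]) auto

lemma open_par_subset_closed_par: "open_par m p q \<subseteq> closed_par m p q"
  unfolding open_par_def closed_par_def by (intro image_mono) auto

lemma closed_par_subset_closure: "closed_par m p q \<subseteq> closure (open_par m p q)"
proof -
  have "{-1..1} \<times> {-1..1} = closure ({-1<..<1::real} \<times> {-1<..<1::real})"
    by (simp add: closure_Times)
  moreover have "continuous_on UNIV (\<lambda>w. m + (fst w *\<^sub>R p + snd w *\<^sub>R q))"
    by (intro continuous_intros)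
  ultimately show ?thesis
    unfolding open_par_def closed_par_def by (simp only: continuous_image_closure_subset subset_UNIV)
qed

lemma compact_closed_par: "compact (closed_par m p q)"
  unfolding closed_par_def by (intro compact_continuous_image compact_Times continuous_intros) auto

lemma emeasure_open_par:
  assumes det: "det2 p q \<noteq> 0"
  shows "emeasure lborel (open_par 0 p q) = ennreal (4 * \<bar>det2 p q\<bar>)"
proof -
  let ?A = "open_par 0 p q"
  have d: "fst p * snd q - fst q * snd p \<noteq> 0" "\<bar>fst p * snd q - fst q * snd p\<bar> = \<bar>det2 p q\<bar>"
    using det by (simp_all add: det2_def mult.commute)
  have "emeasure lborel ?A = ennreal \<bar>det2 p q\<bar>
     * emeasure lborel {z. (fst p * fst z + fst q * snd z, snd p * fst z + snd q * snd z) \<in> ?A}"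
    using emeasure_linear_preimage_plane[OF _ d(1), of ?A] open_open_par[OF det] d(2) by simp
  also have "{z. (fst p * fst z + fst q * snd z, snd p * fst z + snd q * snd z) \<in> ?A} = {-1<..<1} \<times> {-1<..<1}"
  proof (intro set_eqI iffI)
    fix z :: "real \<times> real" assume "z \<in> {z. (fst p * fst z + fst q * snd z, snd p * fst z + snd q * snd z) \<in> ?A}"
    then obtain w where w: "w \<in> {-1<..<1} \<times> {-1<..<1}"
      "fst p * fst z + fst q * snd z = fst w * fst p + snd w * fst q"
      "snd p * fst z + snd q * snd z = fst w * snd p + snd w * snd q"
      unfolding open_par_def mem_Collect_eq by (elim imageE) (simp add: prod_eq_iff)
    have "(fst z - fst w) * det2 p q = 0" "(snd z - snd w) * det2 p q = 0"
      using w(2,3) unfolding det2_def by algebra+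
    then have "z = w" using det by (simp add: prod_eq_iff)
    then show "z \<in> {-1<..<1} \<times> {-1<..<1}" using w by simp
  next
    fix z :: "real \<times> real" assume "z \<in> {-1<..<1} \<times> {-1<..<1}"
    then show "z \<in> {z. (fst p * fst z + fst q * snd z, snd p * fst z + snd q * snd z) \<in> ?A}"
      unfolding open_par_def mem_Collect_eq by (intro image_eqI[of _ _ z]) (auto simp: prod_eq_iff mult.commute)
  qed
  also have "emeasure lborel \<dots> = 4"
    unfolding lborel_prod[symmetric] by (subst lborel.emeasure_pair_measure_Times) (auto simp flip: ennreal_mult)
  finally show ?thesis by (simp add: ennreal_mult mult.commute)
qed

text \<open>
  Every value of modulus below \<open>\<bar>a\<bar> + \<bar>b\<bar>\<close> is attained on the diagonal through the corner
  \<open>(sgn a, sgn b)\<close>, where the functional is maximal.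
\<close>

lemma centred_combination_iff:
  fixes a b v :: real
  assumes "0 < \<bar>a\<bar> + \<bar>b\<bar>"
  shows "(\<exists>w\<in>{-1<..<1} \<times> {-1<..<1}. fst w * a + snd w * b = v) \<longleftrightarrow> \<bar>v\<bar> < \<bar>a\<bar> + \<bar>b\<bar>"
proof
  assume "\<exists>w\<in>{-1<..<1} \<times> {-1<..<1}. fst w * a + snd w * b = v"
  then obtain x y where xy: "\<bar>x\<bar> < 1" "\<bar>y\<bar> < 1" "v = x * a + y * b" by (force simp: abs_less_iff)
  have "\<bar>x * a\<bar> \<le> \<bar>a\<bar>" "\<bar>y * b\<bar> \<le> \<bar>b\<bar>" using xy by (simp_all add: abs_mult mult_left_le_one_le)
  moreover have "\<bar>x * a\<bar> < \<bar>a\<bar> \<or> \<bar>y * b\<bar> < \<bar>b\<bar>"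
    using xy assms by (cases "a = 0") (auto simp: abs_mult)
  ultimately show "\<bar>v\<bar> < \<bar>a\<bar> + \<bar>b\<bar>" unfolding xy by linarith
next
  assume v: "\<bar>v\<bar> < \<bar>a\<bar> + \<bar>b\<bar>"
  define t where "t = v / (\<bar>a\<bar> + \<bar>b\<bar>)"
  have t: "\<bar>t\<bar> < 1" "t * (\<bar>a\<bar> + \<bar>b\<bar>) = v" using v assms by (simp_all add: t_def abs_divide)
  have *: "\<bar>t * sgn c\<bar> < 1" for c :: real using t(1) by (cases "c = 0") (auto simp: abs_mult abs_sgn_eq)
  have "t * sgn a * a + t * sgn b * b = t * (\<bar>a\<bar> + \<bar>b\<bar>)"
    by (simp add: algebra_simps abs_sgn)
  then show "\<exists>w\<in>{-1<..<1} \<times> {-1<..<1}. fst w * a + snd w * b = v"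
    using *[of a] *[of b] t(2) by (intro bexI[of _ "(t * sgn a, t * sgn b)"]) (auto simp: abs_less_iff)
qed

lemma open_par_linear_image:
  fixes f :: "real \<times> real \<Rightarrow> real"
  assumes f: "linear f" and pos: "0 < \<bar>f p\<bar> + \<bar>f q\<bar>"
  shows "(\<exists>z\<in>open_par m p q. f z = v) \<longleftrightarrow> \<bar>v - f m\<bar> < \<bar>f p\<bar> + \<bar>f q\<bar>"
proof -
  have "f (m + (x *\<^sub>R p + y *\<^sub>R q)) = v \<longleftrightarrow> x * f p + y * f q = v - f m" for x y
    using f by (auto simp: linear_add linear_scale)
  then have "(\<exists>z\<in>open_par m p q. f z = v) \<longleftrightarrow> (\<exists>w\<in>{-1<..<1} \<times> {-1<..<1}. fst w * f p + snd w * f q = v - f m)"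
    unfolding open_par_def by simp
  then show ?thesis using centred_combination_iff[OF pos] by simp
qed

text \<open>
  A parallelogram whose half-widths in the three lattice directions add up to at most 1, which means
  that some translate of it fits into a closed cell.
\<close>

locale small_par =
  fixes p q :: "real \<times> real"
  assumes det: "det2 p q \<noteq> 0"
    and small: "\<bar>fst p\<bar> + \<bar>fst q\<bar> + (\<bar>snd p\<bar> + \<bar>snd q\<bar>) + (\<bar>fst p + snd p\<bar> + \<bar>fst q + snd q\<bar>) \<le> 1"
begin

text \<open>
  Half the widths of the parallelogram in the directions of the first coordinate, the second one
  and their sum.
\<close>

definition "r1 = \<bar>fst p\<bar> + \<bar>fst q\<bar>"
definition "r2 = \<bar>snd p\<bar> + \<bar>snd q\<bar>"
definition "r3 = \<bar>fst p + snd p\<bar> + \<bar>fst q + snd q\<bar>"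

lemma r_pos: "0 < r1" "0 < r2" "0 < r3"
proof -
  have "fst p \<noteq> 0 \<or> fst q \<noteq> 0" "snd p \<noteq> 0 \<or> snd q \<noteq> 0" using det by (auto simp: det2_def)
  then show "0 < r1" "0 < r2" unfolding r1_def r2_def by linarith+
  show "0 < r3"
  proof (rule ccontr)
    assume "\<not> 0 < r3"
    then have "snd p = - fst p" "snd q = - fst q" by (auto simp: r3_def)
    then show False using det by (simp add: det2_def)
  qed
qed

text \<open>
  Half-widths form a seminorm of the direction, and the third functional is the sum of the other two.
\<close>

lemma r_le: "r1 \<le> r2 + r3" "r2 \<le> r1 + r3" "r3 \<le> r1 + r2" "r1 + r2 + r3 \<le> 1"
  using small unfolding r1_def r2_def r3_def by linarith+

lemma r_half: "r1 \<le> 1 / 2" "r2 \<le> 1 / 2" "r3 \<le> 1 / 2" using r_le by auto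

lemma integer_value_iff:
  fixes f :: "real \<times> real \<Rightarrow> real"
  assumes f: "linear f" and pos: "0 < \<bar>f p\<bar> + \<bar>f q\<bar>"
  shows "(\<exists>z\<in>open_par m p q. f z \<in> \<int>) \<longleftrightarrow> f m \<in> near_int (\<bar>f p\<bar> + \<bar>f q\<bar>)"
proof -
  have "(\<exists>z\<in>open_par m p q. f z \<in> \<int>) \<longleftrightarrow> (\<exists>n::int. \<exists>z\<in>open_par m p q. f z = of_int n)"
    by (auto simp: Ints_def)
  then show ?thesis
    unfolding open_par_linear_image[OF f pos] near_int_def by (simp add: abs_minus_commute)
qed

lemma small_width:
  fixes f :: "real \<times> real \<Rightarrow> real"
  assumes f: "linear f" and pos: "0 < \<bar>f p\<bar> + \<bar>f q\<bar>" and half: "\<bar>f p\<bar> + \<bar>f q\<bar> \<le> 1 / 2"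
    and "z \<in> open_par m p q" "w \<in> open_par m p q"
  shows "f z - f w < 1"
proof -
  have "\<bar>f z - f m\<bar> < \<bar>f p\<bar> + \<bar>f q\<bar>" "\<bar>f w - f m\<bar> < \<bar>f p\<bar> + \<bar>f q\<bar>"
    using open_par_linear_image[OF f pos] assms(4,5) by blast+
  then show ?thesis using half by linarith
qed

lemma card_cells_hit_open_par:
  "card {c. cell c \<inter> open_par m p q \<noteq> {}} = 1 + of_bool (fst m \<in> near_int r1) + of_bool (snd m \<in> near_int r2)
     + of_bool (fst m + snd m \<in> near_int r3) + 2 * of_bool (open_par m p q \<inter> \<int> \<times> \<int> \<noteq> {})"
proof -
  have pos: "0 < \<bar>fst p\<bar> + \<bar>fst q\<bar>" "0 < \<bar>snd p\<bar> + \<bar>snd q\<bar>" "0 < \<bar>fst p + snd p\<bar> + \<bar>fst q + snd q\<bar>"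
    using r_pos by (simp_all add: r1_def r2_def r3_def)
  have half: "\<bar>fst p\<bar> + \<bar>fst q\<bar> \<le> 1 / 2" "\<bar>snd p\<bar> + \<bar>snd q\<bar> \<le> 1 / 2" "\<bar>fst p + snd p\<bar> + \<bar>fst q + snd q\<bar> \<le> 1 / 2"
    using r_half by (simp_all add: r1_def r2_def r3_def)
  have "card {c. cell c \<inter> open_par m p q \<noteq> {}} = 1 + of_bool (\<exists>z\<in>open_par m p q. fst z \<in> \<int>)
    + of_bool (\<exists>z\<in>open_par m p q. snd z \<in> \<int>) + of_bool (\<exists>z\<in>open_par m p q. fst z + snd z \<in> \<int>)
    + 2 * of_bool (\<exists>z\<in>open_par m p q. fst z \<in> \<int> \<and> snd z \<in> \<int>)"
  proof (rule card_cells_hit)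
    show "open (open_par m p q)" by (rule open_open_par[OF det])
    show "convex (open_par m p q)" by (rule convex_open_par)
    show "open_par m p q \<noteq> {}" using open_par_nonempty by blast
    fix z w assume zw: "z \<in> open_par m p q" "w \<in> open_par m p q"
    show "fst z - fst w < 1" by (rule small_width[OF linear_fst pos(1) half(1) zw])
    show "snd z - snd w < 1" by (rule small_width[OF linear_snd pos(2) half(2) zw])
    show "fst z + snd z - (fst w + snd w) < 1" by (rule small_width[OF linear_coordinate_sum pos(3) half(3) zw])
  qed
  also have "(\<exists>z\<in>open_par m p q. fst z \<in> \<int> \<and> snd z \<in> \<int>) \<longleftrightarrow> open_par m p q \<inter> \<int> \<times> \<int> \<noteq> {}"
    by (simp add: ex_in_conv[symmetric] mem_Times_iff Bex_def)
  finally show ?thesis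
    unfolding integer_value_iff[OF linear_fst pos(1)] integer_value_iff[OF linear_snd pos(2)]
      integer_value_iff[OF linear_coordinate_sum pos(3)] r1_def r2_def r3_def .
qed

end

section \<open>The distribution of the number of cells met\<close>

lemma par_translate:
  "open_par (z + m) p q = (+) z ` open_par m p q" "closed_par (z + m) p q = (+) z ` closed_par m p q"
  unfolding open_par_def closed_par_def image_image by (simp_all add: add.assoc)

lemma open_translates_meeting:
  fixes V U :: "'a::euclidean_space set"
  assumes "open V"
  shows "open {z. V \<inter> (+) z ` U \<noteq> {}}"
proof -
  have "{z. V \<inter> (+) z ` U \<noteq> {}} = (\<Union>u\<in>U. (+) (- u) ` V)"
    by (force simp: algebra_simps image_iff)
  then show ?thesis using open_UN[of U "\<lambda>u. (+) (- u) ` V"] open_translation[OF assms] by metis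
qed

lemma closed_translates_meeting:
  fixes V K :: "'a::euclidean_space set"
  assumes "closed V" "compact K"
  shows "closed {z. V \<inter> (+) z ` K \<noteq> {}}"
proof -
  have "{z. V \<inter> (+) z ` K \<noteq> {}} = (\<Union>x\<in>V. \<Union>y\<in>K. {x - y})"
    by (force simp: algebra_simps)
  then show ?thesis using closed_compact_differences[OF assms] by simp
qed

text \<open>
  The set of translations \<open>z\<close> for which \<open>V\<close> meets \<open>z + U\<close> is the convex difference set \<open>V - U\<close>, and for the
  closed version it lies between \<open>V - U\<close> and its closure. The boundary of a convex set is null.
\<close>

lemma AE_closure_meets_iff:
  fixes V U K :: "'a::euclidean_space set"
  assumes V: "open V" "convex V" and U: "convex U" "U \<subseteq> K" "K \<subseteq> closure U"
  shows "AE z in lborel. closure V \<inter> (+) z ` K \<noteq> {} \<longleftrightarrow> V \<inter> (+) z ` U \<noteq> {}"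
proof -
  define W where "W = (\<lambda>(v, u). v - u) ` (V \<times> U)"
  have W_eq: "W = {z. V \<inter> (+) z ` U \<noteq> {}}" by (force simp: W_def algebra_simps)
  have "open W" unfolding W_eq by (rule open_translates_meeting[OF V(1)])
  have "W = (\<Union>x\<in>V. \<Union>y\<in>U. {x - y})" by (auto simp: W_def)
  then have "convex W" using convex_differences[OF V(2) U(1)] by simp
  then have "frontier W \<in> null_sets lborel"
    using negligible_convex_frontier[of W] null_sets_completion_iff[of "frontier W" lborel]
    by (simp add: negligible_iff_null_sets)
  then have "AE z in lborel. z \<notin> frontier W" by (rule AE_not_in)
  then show ?thesis
  proof eventually_elim
    case (elim z)
    have "V \<inter> (+) z ` U \<noteq> {} \<longleftrightarrow> z \<in> W"
      by (simp add: W_eq)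
    moreover have "z \<in> closure W" if hit: "closure V \<inter> (+) z ` K \<noteq> {}"
    proof -
      obtain k where "k \<in> K" "z + k \<in> closure V" using hit by auto
      then have "(z + k, k) \<in> closure (V \<times> U)" using U(3) by (auto simp: closure_Times)
      moreover have "(\<lambda>(v, u). v - u) ` closure (V \<times> U) \<subseteq> closure W"
        unfolding W_def case_prod_unfold
        by (rule continuous_image_closure_subset[of UNIV]) (intro continuous_intros subset_UNIV)+
      ultimately have "(\<lambda>(v, u). v - u) (z + k, k) \<in> closure W" by blast
      then show ?thesis by simp
    qed
    moreover have "z \<in> W" if "z \<in> closure W"
      using elim that \<open>open W\<close> by (simp add: frontier_def interior_open)
    moreover have "closure V \<inter> (+) z ` K \<noteq> {}" if "V \<inter> (+) z ` U \<noteq> {}"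
      using that U(2) closure_subset by blast
    ultimately show ?case by blast
  qed
qed

lemma open_cell: "open (cell c)"
proof -
  have "cell c = {z. of_int (fst (fst c)) < fst z} \<inter> {z. fst z < of_int (fst (fst c)) + 1}
      \<inter> {z. of_int (snd (fst c)) < snd z} \<inter> {z. snd z < of_int (snd (fst c)) + 1}
      \<inter> {z. of_int (snd c) < fst z + snd z} \<inter> {z. fst z + snd z < of_int (snd c) + 1}"
    by (auto simp: cell_def case_prod_unfold)
  then show ?thesis by (auto intro!: open_Int open_Collect_less continuous_intros)
qed

lemma convex_cell: "convex (cell c)"
proof (rule convexI)
  fix z w :: "real \<times> real" and u v :: real
  assume zw: "z \<in> cell c" "w \<in> cell c" and uv: "0 \<le> u" "0 \<le> v" "u + v = 1"
  have between: "r < u * x + v * y \<and> u * x + v * y < s" if "r < x" "x < s" "r < y" "y < s" for x y r s :: real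
  proof -
    have "convex {r<..<s}" by simp
    then have "u *\<^sub>R x + v *\<^sub>R y \<in> {r<..<s}" using that uv by (intro convexD) auto
    then show ?thesis by simp
  qed
  have "u * (fst z + snd z) + v * (fst w + snd w) = (u * fst z + v * fst w) + (u * snd z + v * snd w)"
    by (simp add: algebra_simps)
  then show "u *\<^sub>R z + v *\<^sub>R w \<in> cell c"
    using zw between[of "of_int (fst (fst c))" "fst z" "of_int (fst (fst c)) + 1" "fst w"]
      between[of "of_int (snd (fst c))" "snd z" "of_int (snd (fst c)) + 1" "snd w"]
      between[of "of_int (snd c)" "fst z + snd z" "of_int (snd c) + 1" "fst w + snd w"]
    by (simp add: cell_def case_prod_unfold)
qed

lemma measurable_card_Collect:
  fixes P :: "'c::countable \<Rightarrow> 'a \<Rightarrow> bool"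
  assumes "\<And>c. {x \<in> space M. P c x} \<in> sets M"
  shows "(\<lambda>x. card {c. P c x}) \<in> measurable M (count_space UNIV)"
proof -
  have "card {c. P c x} = card (to_nat ` {c. P c x})" for x
    by (rule card_image[symmetric]) (rule inj_on_subset[OF inj_to_nat], simp)
  moreover have "(\<lambda>x. card (to_nat ` {c. P c x})) \<in> measurable M (count_space UNIV)"
  proof (rule measurable_card)
    fix n
    have "{x \<in> space M. n \<in> to_nat ` {c. P c x}} = (\<Union>c\<in>{c. to_nat c = n}. {x \<in> space M. P c x})" by auto
    also have "\<dots> \<in> sets M" using assms by (intro sets.countable_UN') auto
    finally show "{x \<in> space M. n \<in> to_nat ` {c. P c x}} \<in> sets M" .
  qed
  ultimately show ?thesis by simp
qed

text \<open>
  All joint probabilities of \<open>X\<close>, \<open>Y\<close>, \<open>S\<close> are determined by the single and pairwise ones together with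
  the probability that none of them occurs: inclusion and exclusion yields \<open>s3\<close> as the
  probability that all three occur.
\<close>

lemma measure_event_counts:
  assumes D: "D \<in> sets M" "emeasure M D = 1"
    and sets: "X \<in> sets M" "Y \<in> sets M" "S \<in> sets M" "V \<in> sets M"
    and sub: "X \<subseteq> D" "Y \<subseteq> D" "S \<subseteq> D" "V \<subseteq> X \<inter> Y \<inter> S"
    and N: "\<And>z. z \<in> D \<Longrightarrow> N z = 1 + of_bool (z \<in> X) + of_bool (z \<in> Y) + of_bool (z \<in> S) + 2 * of_bool (z \<in> V)"
    and s1: "measure M X + measure M Y + measure M S = s1"
    and s2: "measure M (X \<inter> Y) + measure M (X \<inter> S) + measure M (Y \<inter> S) = s2"
    and q: "measure M (D - (X \<union> Y \<union> S)) = q" and v: "measure M V = v"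
    and s3: "s3 = 1 - s1 + s2 - q"
  shows "measure M {z \<in> D. N z = (1::nat)} = q" "measure M {z \<in> D. N z = 2} = s1 - 2 * s2 + 3 * s3"
    "measure M {z \<in> D. N z = 3} = s2 - 3 * s3" "measure M {z \<in> D. N z = 4} = s3 - v"
    "measure M {z \<in> D. N z = 5} = 0" "measure M {z \<in> D. N z = 6} = v"
proof -
  have fin: "emeasure M A < \<infinity>" if "A \<in> sets M" "A \<subseteq> D" for A
    using emeasure_mono[OF that(2) D(1)] D(2) by (simp add: order_le_less_trans)
  have int[simp]: "integrable M (indicator A :: _ \<Rightarrow> real)" if "A \<in> sets M" "A \<subseteq> D" for A
    using that fin by simp
  have ms: "(\<integral>z. indicator A z \<partial>M) = measure M A" if "A \<in> sets M" for A
    using sets.sets_into_space[OF that] by (simp add: Int_absorb2)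
  have D1: "measure M D = 1" using D(2) by (simp add: measure_def)
  have XYS: "measure M (X \<inter> Y \<inter> S) = s3"
  proof -
    have "indicator (X \<inter> Y \<inter> S) z = indicator D z - (indicator X z + indicator Y z + indicator S z)
       + (indicator (X \<inter> Y) z + indicator (X \<inter> S) z + indicator (Y \<inter> S) z) - (indicator (D - (X \<union> Y \<union> S)) z :: real)" for z
      using sub by (auto simp: indicator_def)
    then have "(\<integral>z. indicator (X \<inter> Y \<inter> S) z \<partial>M) = (\<integral>z. indicator D z - (indicator X z + indicator Y z + indicator S z)
       + (indicator (X \<inter> Y) z + indicator (X \<inter> S) z + indicator (Y \<inter> S) z) - (indicator (D - (X \<union> Y \<union> S)) z :: real) \<partial>M)"
      by simp
    also have "\<dots> = measure M D - (measure M X + measure M Y + measure M S)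
       + (measure M (X \<inter> Y) + measure M (X \<inter> S) + measure M (Y \<inter> S)) - measure M (D - (X \<union> Y \<union> S))"
      using D sets sub by (simp add: ms sets.Int sets.Un sets.Diff le_infI1 le_infI2 Diff_subset)
    finally show ?thesis using sets s1 s2 q s3 D1 by (simp add: ms)
  qed
  have "{z \<in> D. N z = 1} = D - (X \<union> Y \<union> S)"
    using sub by (auto simp: N of_bool_def split: if_splits)
  then show "measure M {z \<in> D. N z = (1::nat)} = q" using q by simp
  have inD: "z \<in> D" if "z \<in> X \<or> z \<in> Y \<or> z \<in> S" for z using that sub by blast
  have "z \<in> V \<Longrightarrow> z \<in> D \<and> z \<in> X \<and> z \<in> Y \<and> z \<in> S" for z
    using sub by blast
  then have "{z \<in> D. N z = 6} = V"
    by (auto simp: N of_bool_def split: if_splits)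
  then show "measure M {z \<in> D. N z = 6} = v" using v by simp
  have "{z \<in> D. N z = 5} = {}"
    using sub by (auto simp: N of_bool_def split: if_splits)
  then show "measure M {z \<in> D. N z = 5} = 0" by (simp only: measure_empty)
  have "{z \<in> D. N z = 4} = X \<inter> Y \<inter> S - V"
    using sub by (auto simp: N of_bool_def split: if_splits)
  moreover have "measure M (X \<inter> Y \<inter> S - V) = measure M (X \<inter> Y \<inter> S) - measure M V"
  proof (rule measure_Diff)
    have "X \<inter> Y \<inter> S \<subseteq> D" using sub by blast
    then show "emeasure M (X \<inter> Y \<inter> S) \<noteq> \<infinity>" using fin[of "X \<inter> Y \<inter> S"] sets by auto
  qed (use sets sub in auto)
  ultimately show "measure M {z \<in> D. N z = 4} = s3 - v" using XYS v by simp
  define T where "T = (X \<inter> Y \<union> X \<inter> S \<union> Y \<inter> S) - X \<inter> Y \<inter> S"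
  have T[simp]: "T \<in> sets M" "T \<subseteq> D" using sets sub by (auto simp: T_def)
  have "{z \<in> D. N z = 3} = T"
    using sub by (auto simp: N T_def of_bool_def inD split: if_splits)
  moreover have "measure M T = s2 - 3 * s3"
  proof -
    have "indicator T z = indicator (X \<inter> Y) z + indicator (X \<inter> S) z + indicator (Y \<inter> S) z - 3 * (indicator (X \<inter> Y \<inter> S) z :: real)" for z
      by (auto simp: T_def indicator_def)
    then have "(\<integral>z. indicator T z \<partial>M) = (\<integral>z. indicator (X \<inter> Y) z + indicator (X \<inter> S) z + indicator (Y \<inter> S) z - 3 * (indicator (X \<inter> Y \<inter> S) z :: real) \<partial>M)"
      by simp
    also have "\<dots> = s2 - 3 * s3"
      using D sets sub XYS s2 by (simp add: ms sets.Int le_infI1 le_infI2)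
    finally show ?thesis by (simp add: ms)
  qed
  ultimately show "measure M {z \<in> D. N z = 3} = s2 - 3 * s3" by simp
  define O1 where "O1 = (X \<union> Y \<union> S) - (X \<inter> Y \<union> X \<inter> S \<union> Y \<inter> S)"
  have O1[simp]: "O1 \<in> sets M" "O1 \<subseteq> D" using sets sub by (auto simp: O1_def)
  have "{z \<in> D. N z = 2} = O1"
    using sub by (auto simp: N O1_def of_bool_def inD split: if_splits)
  moreover have "measure M O1 = s1 - 2 * s2 + 3 * s3"
  proof -
    have "indicator O1 z = (indicator X z + indicator Y z + indicator S z) - 2 * (indicator (X \<inter> Y) z + indicator (X \<inter> S) z + indicator (Y \<inter> S) z)
       + 3 * (indicator (X \<inter> Y \<inter> S) z :: real)" for z
      by (auto simp: O1_def indicator_def)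
    then have "(\<integral>z. indicator O1 z \<partial>M) = (\<integral>z. (indicator X z + indicator Y z + indicator S z) - 2 * (indicator (X \<inter> Y) z + indicator (X \<inter> S) z + indicator (Y \<inter> S) z)
       + 3 * (indicator (X \<inter> Y \<inter> S) z :: real) \<partial>M)"
      by simp
    also have "\<dots> = s1 - 2 * s2 + 3 * s3"
      using D sets sub XYS s1 s2 by (simp add: ms sets.Int le_infI1 le_infI2)
    finally show ?thesis by (simp add: ms)
  qed
  ultimately show "measure M {z \<in> D. N z = 2} = s1 - 2 * s2 + 3 * s3" by simp
qed

context small_par
begin

text \<open>
  The parallelogram has widths less than 1, so its integer translates are disjoint and fold into the
  unit square without loss of area.
\<close>

lemma emeasure_vertex_in_open_par:
  "emeasure lborel {z \<in> unit_square. open_par (z + m) p q \<inter> \<int> \<times> \<int> \<noteq> {}} = ennreal (4 * \<bar>det2 p q\<bar>)"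
  "{z \<in> unit_square. open_par (z + m) p q \<inter> \<int> \<times> \<int> \<noteq> {}} \<in> sets borel"
proof -
  have [measurable]: "open_par 0 p q \<in> sets borel" by (rule borel_open[OF open_open_par[OF det]])
  define A where "A = {z. z + m \<in> open_par 0 p q}"
  have [measurable]: "A \<in> sets borel" unfolding A_def by measurable
  have sym: "- z \<in> open_par 0 p q" if z: "z \<in> open_par 0 p q" for z
  proof -
    obtain w where "w \<in> {-1<..<1} \<times> {-1<..<1}" "z = fst w *\<^sub>R p + snd w *\<^sub>R q"
      using z unfolding open_par_def by (elim imageE) simp
    then show ?thesis unfolding open_par_def by (intro image_eqI[of _ _ "- w"]) auto
  qed
  have eq: "{z \<in> unit_square. open_par (z + m) p q \<inter> \<int> \<times> \<int> \<noteq> {}} = {z \<in> unit_square. \<exists>g\<in>\<int> \<times> \<int>. z + g \<in> A}"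
  proof (intro Collect_cong conj_cong refl)
    fix z
    show "open_par (z + m) p q \<inter> \<int> \<times> \<int> \<noteq> {} \<longleftrightarrow> (\<exists>g\<in>\<int> \<times> \<int>. z + g \<in> A)"
    proof
      assume "open_par (z + m) p q \<inter> \<int> \<times> \<int> \<noteq> {}"
      then obtain g where g: "g \<in> open_par (z + m) p q" "g \<in> \<int> \<times> \<int>" by blast
      have "- (g - (z + m)) \<in> open_par 0 p q" using g(1) by (intro sym) (simp add: mem_open_par_shift[of g "z + m"])
      then have "z + (- g) \<in> A" by (simp add: A_def algebra_simps)
      moreover have "- g \<in> \<int> \<times> \<int>" using g(2) by (auto simp: mem_Times_iff)
      ultimately show "\<exists>g\<in>\<int> \<times> \<int>. z + g \<in> A" by (rule rev_bexI[rotated])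
    next
      assume "\<exists>g\<in>\<int> \<times> \<int>. z + g \<in> A"
      then obtain g where g: "g \<in> \<int> \<times> \<int>" "z + g \<in> A" by (elim bexE)
      have "- (z + g + m) \<in> open_par 0 p q" using g(2) by (intro sym) (simp add: A_def)
      also have "- (z + g + m) = - g - (z + m)" by simp
      finally have "- g \<in> open_par (z + m) p q" by (subst mem_open_par_shift)
      moreover have "- g \<in> \<int> \<times> \<int>" using g(1) by (auto simp: mem_Times_iff)
      ultimately have "- g \<in> open_par (z + m) p q \<inter> \<int> \<times> \<int>" by (rule IntI)
      then show "open_par (z + m) p q \<inter> \<int> \<times> \<int> \<noteq> {}" by (metis empty_iff)
    qed
  qed
  have "emeasure lborel {z \<in> unit_square. \<exists>g\<in>\<int> \<times> \<int>. z + g \<in> A} = emeasure lborel A"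
  proof (rule emeasure_fundamental_domain[OF _ _ _ unit_square_tiling])
    fix z g g' :: "real \<times> real"
    assume g: "g \<in> \<int> \<times> \<int>" "g' \<in> \<int> \<times> \<int>" and A: "z + g \<in> A" "z + g' \<in> A"
    have pos: "0 < \<bar>fst p\<bar> + \<bar>fst q\<bar>" "0 < \<bar>snd p\<bar> + \<bar>snd q\<bar>"
      and half: "\<bar>fst p\<bar> + \<bar>fst q\<bar> \<le> 1 / 2" "\<bar>snd p\<bar> + \<bar>snd q\<bar> \<le> 1 / 2"
      using r_pos r_half by (simp_all add: r1_def r2_def)
    note A = A[unfolded A_def mem_Collect_eq]
    have "fst g = fst g'"
      using small_width[OF linear_fst pos(1) half(1) A] small_width[OF linear_fst pos(1) half(1) A(2,1)] g
      by (intro int_eq_of_close) (auto simp: mem_Times_iff)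
    moreover have "snd g = snd g'"
      using small_width[OF linear_snd pos(2) half(2) A] small_width[OF linear_snd pos(2) half(2) A(2,1)] g
      by (intro int_eq_of_close) (auto simp: mem_Times_iff)
    ultimately show "g = g'" by (simp add: prod_eq_iff)
  qed (auto simp: countable_Ints_real)
  also have "\<dots> = ennreal (4 * \<bar>det2 p q\<bar>)"
    unfolding A_def by (simp add: emeasure_lborel_translate emeasure_open_par[OF det])
  finally show "emeasure lborel {z \<in> unit_square. open_par (z + m) p q \<inter> \<int> \<times> \<int> \<noteq> {}} = ennreal (4 * \<bar>det2 p q\<bar>)"
    unfolding eq .
  have "{z \<in> unit_square. \<exists>g\<in>\<int> \<times> \<int>. z + g \<in> A} = unit_square \<inter> (\<Union>g\<in>\<int> \<times> \<int>. {z. z + g \<in> A})" by auto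
  also have "\<dots> \<in> sets borel"
    by (intro sets.Int unit_square_measurable sets.countable_UN'') (simp_all add: countable_Ints_real)
  finally show "{z \<in> unit_square. open_par (z + m) p q \<inter> \<int> \<times> \<int> \<noteq> {}} \<in> sets borel"
    unfolding eq .
qed

text \<open>
  The probabilities that no line and that lines of all three families are met, if the centre is
  uniform in the unit square; the second one by inclusion and exclusion.
\<close>

definition "p_none = (1 - (r1 + r2 + r3))\<^sup>2"
definition "p_all = 1 - 2 * (r1 + r2 + r3) + 4 * (r1 * r2 + r1 * r3 + r2 * r3) - p_none"

text \<open>
  The distribution of the number of open cells met, for a body whose centre is uniform in the unit
  square, in terms of its half-widths and its area.
\<close>

lemma measure_open_hits:
  fixes m
  defines "N \<equiv> \<lambda>z. card {c. cell c \<inter> open_par (z + m) p q \<noteq> {}}"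
  shows "measure lborel {z \<in> unit_square. N z = 1} = p_none"
    "measure lborel {z \<in> unit_square. N z = 2} = 2 * (r1 + r2 + r3) - 8 * (r1 * r2 + r1 * r3 + r2 * r3) + 3 * p_all"
    "measure lborel {z \<in> unit_square. N z = 3} = 4 * (r1 * r2 + r1 * r3 + r2 * r3) - 3 * p_all"
    "measure lborel {z \<in> unit_square. N z = 4} = p_all - 4 * \<bar>det2 p q\<bar>"
    "measure lborel {z \<in> unit_square. N z = 5} = 0"
    "measure lborel {z \<in> unit_square. N z = 6} = 4 * \<bar>det2 p q\<bar>"
proof -
  define X where "X = {z \<in> unit_square. fst z + fst m \<in> near_int r1}"
  define Y where "Y = {z \<in> unit_square. snd z + snd m \<in> near_int r2}"
  define S where "S = {z \<in> unit_square. fst z + snd z + (fst m + snd m) \<in> near_int r3}"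
  define V where "V = {z \<in> unit_square. open_par (z + m) p q \<inter> \<int> \<times> \<int> \<noteq> {}}"
  have [measurable]: "X \<in> sets borel" "Y \<in> sets borel" "S \<in> sets borel"
    unfolding X_def Y_def S_def by measurable
  have V[measurable]: "V \<in> sets borel" unfolding V_def by (rule emeasure_vertex_in_open_par)
  have one: "emeasure lborel {x::real. 0 \<le> x \<and> x < 1} = 1"
    using emeasure_lborel_Ico[of 0 "1::real"] unfolding atLeastLessThan_def atLeast_def lessThan_def by (simp add: Int_def)
  have nonneg: "0 \<le> r1" "0 \<le> r2" "0 \<le> r3" using r_pos by simp_all
  note near = emeasure_near_int[OF nonneg(1) r_half(1)] emeasure_near_int[OF nonneg(2) r_half(2)]
  have A1[measurable]: "{x. x + fst m \<in> near_int r1} \<in> sets borel" and A2[measurable]: "{x. x + snd m \<in> near_int r2} \<in> sets borel"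
    by measurable
  have sX: "measure lborel X = 2 * r1"
    using emeasure_square_Times[OF A1, of UNIV] near one nonneg
    by (simp add: X_def measure_def)
  have sY: "measure lborel Y = 2 * r2"
    using emeasure_square_Times[OF _ A2, of UNIV] near one nonneg
    by (simp add: Y_def measure_def)
  have sS: "measure lborel S = 2 * r3"
    using emeasure_square_sum_near_int(1)[OF _ nonneg(3) r_half(3), of UNIV "fst m + snd m"] one nonneg
    by (simp add: S_def measure_def)
  have sXY: "measure lborel (X \<inter> Y) = 4 * r1 * r2"
  proof -
    have "X \<inter> Y = {z \<in> unit_square. fst z \<in> {x. x + fst m \<in> near_int r1} \<and> snd z \<in> {x. x + snd m \<in> near_int r2}}"
      by (auto simp: X_def Y_def)
    then show ?thesis using emeasure_square_Times[OF A1 A2] near nonneg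
      by (simp add: measure_def flip: ennreal_mult)
  qed
  have sXS: "measure lborel (X \<inter> S) = 4 * r1 * r3"
  proof -
    have "X \<inter> S = {z \<in> unit_square. fst z \<in> {x. x + fst m \<in> near_int r1} \<and> fst z + snd z + (fst m + snd m) \<in> near_int r3}"
      by (auto simp: X_def S_def)
    then show ?thesis using emeasure_square_sum_near_int(1)[OF A1 nonneg(3) r_half(3)] near nonneg
      by (simp add: measure_def flip: ennreal_mult)
  qed
  have sYS: "measure lborel (Y \<inter> S) = 4 * r2 * r3"
  proof -
    have "Y \<inter> S = {z \<in> unit_square. snd z \<in> {x. x + snd m \<in> near_int r2} \<and> fst z + snd z + (fst m + snd m) \<in> near_int r3}"
      by (auto simp: Y_def S_def)
    then show ?thesis using emeasure_square_sum_near_int(2)[OF A2 nonneg(3) r_half(3)] near nonneg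
      by (simp add: measure_def flip: ennreal_mult)
  qed
  have none: "measure lborel (unit_square - (X \<union> Y \<union> S)) = p_none"
  proof -
    have "unit_square - (X \<union> Y \<union> S) = {z \<in> unit_square. fst z + fst m \<notin> near_int r1 \<and> snd z + snd m \<notin> near_int r2
            \<and> fst z + snd z + (fst m + snd m) \<notin> near_int r3}"
      by (auto simp: X_def Y_def S_def)
    then show ?thesis using emeasure_square_avoid_all_lines[OF r_pos r_le]
      by (simp add: measure_def p_none_def)
  qed
  have vert: "measure lborel V = 4 * \<bar>det2 p q\<bar>"
    unfolding V_def by (simp add: measure_def emeasure_vertex_in_open_par)
  have VXYS: "V \<subseteq> X \<inter> Y \<inter> S"
  proof
    fix z assume "z \<in> V"
    then obtain g where z: "z \<in> unit_square" and g: "g \<in> open_par (z + m) p q" "fst g \<in> \<int>" "snd g \<in> \<int>"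
      by (auto simp: V_def)
    have pos: "0 < \<bar>fst p\<bar> + \<bar>fst q\<bar>" "0 < \<bar>snd p\<bar> + \<bar>snd q\<bar>" "0 < \<bar>fst p + snd p\<bar> + \<bar>fst q + snd q\<bar>"
      using r_pos by (simp_all add: r1_def r2_def r3_def)
    have "fst (z + m) \<in> near_int r1"
      unfolding r1_def using integer_value_iff[OF linear_fst pos(1)] g by blast
    moreover have "snd (z + m) \<in> near_int r2"
      unfolding r2_def using integer_value_iff[OF linear_snd pos(2)] g by blast
    moreover have "fst (z + m) + snd (z + m) \<in> near_int r3"
      unfolding r3_def using integer_value_iff[OF linear_coordinate_sum pos(3)] g by (meson Ints_add)
    ultimately show "z \<in> X \<inter> Y \<inter> S"
      using z by (simp add: X_def Y_def S_def ac_simps)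
  qed
  have N: "N z = 1 + of_bool (z \<in> X) + of_bool (z \<in> Y) + of_bool (z \<in> S) + 2 * of_bool (z \<in> V)" if "z \<in> unit_square" for z
    unfolding N_def card_cells_hit_open_par using that by (simp add: X_def Y_def S_def V_def ac_simps)
  have "p_all = 1 - (2 * r1 + 2 * r2 + 2 * r3) + (4 * r1 * r2 + 4 * r1 * r3 + 4 * r2 * r3) - p_none"
    by (simp add: p_all_def algebra_simps)
  note ev = measure_event_counts[of unit_square lborel X Y S V N, OF _ emeasure_unit_square _ _ _ _ _ _ _ VXYS N _ _ none vert this,
      unfolded sX sY sS sXY sXS sYS]
  have sub: "X \<subseteq> unit_square" "Y \<subseteq> unit_square" "S \<subseteq> unit_square" by (auto simp: X_def Y_def S_def)
  show "measure lborel {z \<in> unit_square. N z = 1} = p_none"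
    "measure lborel {z \<in> unit_square. N z = 2} = 2 * (r1 + r2 + r3) - 8 * (r1 * r2 + r1 * r3 + r2 * r3) + 3 * p_all"
    "measure lborel {z \<in> unit_square. N z = 3} = 4 * (r1 * r2 + r1 * r3 + r2 * r3) - 3 * p_all"
    "measure lborel {z \<in> unit_square. N z = 4} = p_all - 4 * \<bar>det2 p q\<bar>"
    "measure lborel {z \<in> unit_square. N z = 5} = 0"
    "measure lborel {z \<in> unit_square. N z = 6} = 4 * \<bar>det2 p q\<bar>"
    using ev[OF _ _ _ _ _ sub _ refl refl] by (simp_all add: algebra_simps)
qed

lemma measure_closed_hits_eq_open_hits:
  "measure lborel {z \<in> unit_square. card {c. closure (cell c) \<inter> closed_par (z + m) p q \<noteq> {}} = i}
   = measure lborel {z \<in> unit_square. card {c. cell c \<inter> open_par (z + m) p q \<noteq> {}} = i}"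
proof (rule measure_eq_AE)
  have "AE z in lborel. \<forall>c. closure (cell c) \<inter> closed_par (z + m) p q \<noteq> {} \<longleftrightarrow> cell c \<inter> open_par (z + m) p q \<noteq> {}"
    unfolding AE_all_countable par_translate
    by (intro allI AE_closure_meets_iff open_cell convex_cell convex_open_par open_par_subset_closed_par closed_par_subset_closure)
  then show "AE z in lborel. z \<in> {z \<in> unit_square. card {c. closure (cell c) \<inter> closed_par (z + m) p q \<noteq> {}} = i}
      \<longleftrightarrow> z \<in> {z \<in> unit_square. card {c. cell c \<inter> open_par (z + m) p q \<noteq> {}} = i}"
    by (rule eventually_mono) (simp only: mem_Collect_eq)
  have [measurable]: "(\<lambda>z. card {c. closure (cell c) \<inter> closed_par (z + m) p q \<noteq> {}}) \<in> measurable borel (count_space UNIV)"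
    unfolding par_translate
    by (intro measurable_card_Collect) (simp add: borel_closed closed_translates_meeting compact_closed_par)
  have [measurable]: "(\<lambda>z. card {c. cell c \<inter> open_par (z + m) p q \<noteq> {}}) \<in> measurable borel (count_space UNIV)"
    unfolding par_translate
    by (intro measurable_card_Collect) (simp add: borel_open open_translates_meeting open_cell)
  show "{z \<in> unit_square. card {c. closure (cell c) \<inter> closed_par (z + m) p q \<noteq> {}} = i} \<in> sets lborel"
    "{z \<in> unit_square. card {c. cell c \<inter> open_par (z + m) p q \<noteq> {}} = i} \<in> sets lborel"
    by (simp; measurable)+
qed

end

section \<open>Averages of products of widths over all directions\<close>

text \<open>
  The derivative of the integral over a window of length \<open>T\<close> with respect to the position
  of the window is \<open>f (d + T) - f d = 0\<close>.
\<close>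

lemma integral_periodic_shift:
  fixes f :: "real \<Rightarrow> real"
  assumes cont: "continuous_on UNIV f" and per: "\<And>x. f (x + T) = f x" and T: "0 \<le> T"
  shows "integral {0..T} (\<lambda>x. f (x + c)) = integral {0..T} f"
proof -
  \<comment> \<open>A base point to the left of both windows that are compared.\<close>
  define a where "a = - \<bar>c\<bar> - 1"
  define F where "F x = integral {a..x} f" for x
  have F: "(F has_real_derivative f x) (at x)" if "a < x" for x
  proof -
    have "(F has_real_derivative f x) (at x within {a..x + 1})"
      unfolding F_def using that
      by (intro integral_has_real_derivative continuous_on_subset[OF cont]) auto
    then have "(F has_real_derivative f x) (at x within {a<..<x + 1})"
      by (rule has_field_derivative_subset) auto
    then show ?thesis using that by (subst (asm) at_within_open) auto
  qed
  have int: "integral {0..T} (\<lambda>x. f (x + d)) = F (T + d) - F d" if d: "a < d" for d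
  proof -
    have "((\<lambda>x. f (x + d)) has_integral F (T + d) - F (0 + d)) {0..T}"
    proof (rule fundamental_theorem_of_calculus[OF T, of "\<lambda>x. F (x + d)"])
      fix x assume "x \<in> {0..T}"
      then have "(F has_real_derivative f (x + d)) (at (x + d))" using d by (intro F) auto
      then have "((\<lambda>x. F (x + d)) has_real_derivative f (x + d)) (at x)"
        by (simp add: DERIV_shift)
      then show "((\<lambda>x. F (x + d)) has_vector_derivative f (x + d)) (at x within {0..T})"
        by (simp add: has_real_derivative_iff_has_vector_derivative has_vector_derivative_at_within)
    qed
    then show ?thesis by (simp add: integral_unique)
  qed
  define G where "G d = F (d + T) - F d" for d
  have "\<exists>k. \<forall>d\<in>{a<..}. G d = k"
  proof (rule has_field_derivative_zero_constant)
    fix d assume d: "d \<in> {a<..}"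
    then have "(F has_real_derivative f (d + T)) (at (d + T))" using T by (intro F) auto
    then have "((\<lambda>d. F (d + T)) has_real_derivative f (d + T)) (at d)" by (simp add: DERIV_shift)
    then have "(G has_real_derivative f (d + T) - f d) (at d)"
      unfolding G_def using F d by (intro DERIV_diff) auto
    then show "(G has_real_derivative 0) (at d within {a<..})"
      by (simp add: per has_field_derivative_at_within)
  qed simp
  moreover have a: "a < c" "a < 0" by (auto simp: a_def)
  ultimately have "G c = G 0" by auto
  then show ?thesis using int[OF a(1)] int[OF a(2)] by (simp add: G_def add.commute)
qed

text \<open>
  On this interval \<open>cos x\<close> is nonnegative, whereas \<open>cos (x + d)\<close> changes sign exactly once, at
  \<open>\<pi> / 2 - d\<close>.
\<close>

lemma has_integral_abs_cos_cos:
  assumes d: "0 \<le> d" "d \<le> pi"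
  shows "((\<lambda>x. \<bar>cos x\<bar> * \<bar>cos (x + d)\<bar>) has_integral (sin d + (pi / 2 - d) * cos d)) {- (pi / 2)..pi / 2}"
proof -
  define H where "H x = (x * cos d + sin (2 * x + d) / 2) / 2" for x
  have H: "(H has_real_derivative cos x * cos (x + d)) (at x within S)" for x S
  proof -
    have "(H has_real_derivative (cos d + cos (2 * x + d) * 2 / 2) / 2) (at x within S)"
      unfolding H_def by (auto intro!: derivative_eq_intros)
    moreover have "cos (2 * x + d) = cos (x + (x + d))" by (simp add: algebra_simps)
    moreover have "cos d = cos ((x + d) - x)" by simp
    ultimately show ?thesis unfolding cos_add[of x "x + d"] cos_diff[of "x + d" x] by (simp add: mult.commute)
  qed
  have 1: "((\<lambda>x. \<bar>cos x\<bar> * \<bar>cos (x + d)\<bar>) has_integral (H (pi / 2 - d) - H (- (pi / 2)))) {- (pi / 2)..pi / 2 - d}"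
  proof (rule has_integral_eq)
    show "((\<lambda>x. cos x * cos (x + d)) has_integral (H (pi / 2 - d) - H (- (pi / 2)))) {- (pi / 2)..pi / 2 - d}"
      by (rule fundamental_theorem_of_calculus)
         (use d H in \<open>auto simp flip: has_real_derivative_iff_has_vector_derivative\<close>)
    fix x assume x: "x \<in> {- (pi / 2)..pi / 2 - d}"
    have "0 \<le> cos x" by (rule cos_ge_zero) (use x d in auto)
    moreover have "0 \<le> cos (x + d)" by (rule cos_ge_zero) (use x d in auto)
    ultimately show "cos x * cos (x + d) = \<bar>cos x\<bar> * \<bar>cos (x + d)\<bar>" by simp
  qed
  have 2: "((\<lambda>x. \<bar>cos x\<bar> * \<bar>cos (x + d)\<bar>) has_integral ((- H (pi / 2)) - (- H (pi / 2 - d)))) {pi / 2 - d..pi / 2}"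
  proof (rule has_integral_eq)
    show "((\<lambda>x. - (cos x * cos (x + d))) has_integral ((- H (pi / 2)) - (- H (pi / 2 - d)))) {pi / 2 - d..pi / 2}"
      by (rule fundamental_theorem_of_calculus)
         (use d H in \<open>auto intro!: DERIV_minus simp flip: has_real_derivative_iff_has_vector_derivative\<close>)
    fix x assume x: "x \<in> {pi / 2 - d..pi / 2}"
    have "0 \<le> cos x" by (rule cos_ge_zero) (use x d in auto)
    moreover have "0 \<le> cos (pi - (x + d))" by (rule cos_ge_zero) (use x d in auto)
    then have "cos (x + d) \<le> 0" by simp
    ultimately show "- (cos x * cos (x + d)) = \<bar>cos x\<bar> * \<bar>cos (x + d)\<bar>" by simp
  qed
  have sins: "sin (2 * (pi / 2 - d) + d) = sin d" "sin (2 * (pi / 2) + d) = - sin d" "sin (2 * - (pi / 2) + d) = - sin d"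
    using sin_pi_minus[of d] by (simp_all add: sin_add algebra_simps)
  have "(H (pi / 2 - d) - H (- (pi / 2))) + ((- H (pi / 2)) - (- H (pi / 2 - d))) = sin d + (pi / 2 - d) * cos d"
    unfolding H_def sins by (simp add: field_simps)
  moreover have "((\<lambda>x. \<bar>cos x\<bar> * \<bar>cos (x + d)\<bar>) has_integral
     ((H (pi / 2 - d) - H (- (pi / 2))) + ((- H (pi / 2)) - (- H (pi / 2 - d))))) {- (pi / 2)..pi / 2}"
    by (rule has_integral_combine[OF _ _ 1 2]) (use d in auto)
  ultimately show ?thesis by (simp only:)
qed

lemma has_integral_pi_periodic:
  fixes f :: "real \<Rightarrow> real"
  assumes cont: "continuous_on UNIV f" and per: "\<And>x. f (x + pi) = f x"
    and I: "(f has_integral I) {- (pi / 2)..pi / 2}"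
  shows "((\<lambda>x. f (x + c)) has_integral 2 * I) {0..2 * pi}"
proof -
  have cont': "continuous_on S f" for S using cont continuous_on_subset by blast
  have comp_plus: "f \<circ> (+) e = (\<lambda>x. f (x + e))" for e by (simp add: o_def add.commute)
  have base: "integral {0..pi} f = I"
  proof -
    have "integral {0..pi} f = integral {0..pi} (\<lambda>x. f (x + (- (pi / 2))))"
      by (rule integral_periodic_shift[of f pi, symmetric]) (use cont per in auto)
    also have "((\<lambda>x. f (x + (- (pi / 2)))) has_integral I) {0..pi}"
      using I has_integral_shift_Icc_real[of f "- (pi / 2)" I 0 pi]
      unfolding comp_plus by simp
    then have "integral {0..pi} (\<lambda>x. f (x + (- (pi / 2)))) = I" by (rule integral_unique)
    finally show ?thesis .
  qed
  have "integral {0..2 * pi} (\<lambda>x. f (x + c)) = integral {0..2 * pi} f"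
  proof (rule integral_periodic_shift[of f "2 * pi" c])
    fix x
    show "f (x + 2 * pi) = f x" using per[of "x + pi"] per[of x] by (simp add: ac_simps)
  qed (use cont in auto)
  also have "\<dots> = integral {0..pi} f + integral {pi..2 * pi} f"
    by (rule Henstock_Kurzweil_Integration.integral_combine[symmetric]) (use cont' in \<open>auto intro: integrable_continuous_interval\<close>)
  also have "integral {pi..2 * pi} f = integral {0..pi} (\<lambda>x. f (x + pi))"
    using integral_shift_Icc_real[of 0 pi f pi] unfolding comp_plus by simp
  also have "\<dots> = integral {0..pi} f" unfolding per ..
  finally have "integral {0..2 * pi} (\<lambda>x. f (x + c)) = 2 * I" using base by simp
  moreover have "continuous_on {0..2 * pi} (\<lambda>x. f (x + c))"
    by (intro continuous_on_compose2[OF cont] continuous_intros) auto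
  ultimately show ?thesis
    by (metis integrable_continuous_interval integrable_integral)
qed

lemma has_integral_abs_cos: "((\<lambda>x. \<bar>cos (x + c)\<bar>) has_integral 4) {0..2 * pi}"
proof -
  have "((\<lambda>x. \<bar>cos x\<bar>) has_integral (sin (pi / 2) - sin (- (pi / 2)))) {- (pi / 2)..pi / 2}"
  proof (rule has_integral_eq)
    show "(cos has_integral (sin (pi / 2) - sin (- (pi / 2)))) {- (pi / 2)..pi / 2}"
      by (rule fundamental_theorem_of_calculus)
         (auto intro!: derivative_eq_intros simp flip: has_real_derivative_iff_has_vector_derivative)
    show "cos x = \<bar>cos x\<bar>" if "x \<in> {- (pi / 2)..pi / 2}" for x
      using that by (simp add: cos_ge_zero)
  qed
  then have "((\<lambda>x. \<bar>cos x\<bar>) has_integral 2) {- (pi / 2)..pi / 2}" by simp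
  from has_integral_pi_periodic[OF _ _ this, of c] show ?thesis
    by (simp add: continuous_intros)
qed

lemma abs_sin_eq_abs_cos: "\<bar>sin x\<bar> = \<bar>cos (x + pi / 2)\<bar>" "\<bar>sin x\<bar> = \<bar>cos (x - pi / 2)\<bar>" for x :: real
  by (simp_all add: cos_add cos_diff)

lemma has_integral_abs_cos_cos_period:
  assumes d: "0 \<le> d" "d \<le> pi"
  shows "((\<lambda>x. \<bar>cos (x + c)\<bar> * \<bar>cos (x + c + d)\<bar>) has_integral 2 * (sin d + (pi / 2 - d) * cos d)) {0..2 * pi}"
proof (rule has_integral_pi_periodic[OF _ _ has_integral_abs_cos_cos[OF d]])
  fix x
  have "cos (x + pi + d) = - cos (x + d)" using cos_periodic_pi[of "x + d"] by (simp add: ac_simps)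
  then show "\<bar>cos (x + pi)\<bar> * \<bar>cos (x + pi + d)\<bar> = \<bar>cos x\<bar> * \<bar>cos (x + d)\<bar>" by simp
qed (intro continuous_intros)

text \<open>
  The width of a rectangle with sides \<open>g\<close> and \<open>h\<close> in a direction at angle \<open>x\<close> to the side \<open>g\<close>.
\<close>

definition rect_width :: "real \<Rightarrow> real \<Rightarrow> real \<Rightarrow> real" where
  "rect_width g h x = g * \<bar>cos x\<bar> + h * \<bar>sin x\<bar>"

lemma has_integral_rect_width:
  "((\<lambda>x. rect_width g h (x + c)) has_integral 4 * (g + h)) {0..2 * pi}"
proof -
  have "((\<lambda>x. g * \<bar>cos (x + c)\<bar> + h * \<bar>cos (x + (c + pi / 2))\<bar>) has_integral g * 4 + h * 4) {0..2 * pi}"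
    by (intro has_integral_add has_integral_mult_right has_integral_abs_cos)
  then show ?thesis unfolding rect_width_def abs_sin_eq_abs_cos(1) by (simp add: algebra_simps)
qed

text \<open>
  Expanding the product, the mixed terms \<open>\<bar>cos\<bar> \<bar>sin\<bar>\<close> are products of cosines at angle \<open>d + \<pi> / 2\<close>; the
  bound on \<open>d\<close> keeps this angle at most \<open>\<pi>\<close>.
\<close>

lemma has_integral_rect_width_mult:
  assumes d: "0 \<le> d" "d \<le> pi / 2"
  shows "((\<lambda>x. rect_width g h (x + c) * rect_width g h (x + c + d)) has_integral
     2 * (g\<^sup>2 + h\<^sup>2) * (sin d + (pi / 2 - d) * cos d) + 4 * (g * h) * (cos d + d * sin d)) {0..2 * pi}"
proof -
  let ?J = "\<lambda>d. 2 * (sin d + (pi / 2 - d) * cos d)"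
  have "((\<lambda>x. (g * g) * (\<bar>cos (x + c)\<bar> * \<bar>cos (x + c + d)\<bar>)
      + (g * h) * (\<bar>cos (x + c)\<bar> * \<bar>cos (x + c + (d + pi / 2))\<bar>)
      + (h * g) * (\<bar>cos (x + (c - pi / 2))\<bar> * \<bar>cos (x + (c - pi / 2) + (d + pi / 2))\<bar>)
      + (h * h) * (\<bar>cos (x + (c - pi / 2))\<bar> * \<bar>cos (x + (c - pi / 2) + d)\<bar>))
    has_integral (g * g) * ?J d + (g * h) * ?J (d + pi / 2) + (h * g) * ?J (d + pi / 2) + (h * h) * ?J d) {0..2 * pi}"
    by (intro has_integral_add has_integral_mult_right has_integral_abs_cos_cos_period) (use d in auto)
  moreover have "(g * g) * (\<bar>cos (x + c)\<bar> * \<bar>cos (x + c + d)\<bar>)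
      + (g * h) * (\<bar>cos (x + c)\<bar> * \<bar>cos (x + c + (d + pi / 2))\<bar>)
      + (h * g) * (\<bar>cos (x + (c - pi / 2))\<bar> * \<bar>cos (x + (c - pi / 2) + (d + pi / 2))\<bar>)
      + (h * h) * (\<bar>cos (x + (c - pi / 2))\<bar> * \<bar>cos (x + (c - pi / 2) + d)\<bar>)
     = rect_width g h (x + c) * rect_width g h (x + c + d)" for x
  proof -
    have "x + c + (d + pi / 2) = (x + c + d) + pi / 2" "x + (c - pi / 2) = (x + c) - pi / 2"
      "x + c - pi / 2 + (d + pi / 2) = x + c + d" "x + c - pi / 2 + d = (x + c + d) - pi / 2"
      by simp_all
    then have "\<bar>cos (x + c + (d + pi / 2))\<bar> = \<bar>sin (x + c + d)\<bar>" "\<bar>cos (x + (c - pi / 2))\<bar> = \<bar>sin (x + c)\<bar>"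
      "\<bar>cos (x + (c - pi / 2) + (d + pi / 2))\<bar> = \<bar>cos (x + c + d)\<bar>" "\<bar>cos (x + (c - pi / 2) + d)\<bar> = \<bar>sin (x + c + d)\<bar>"
      by (simp_all only: abs_sin_eq_abs_cos[symmetric])
    then show ?thesis by (simp only: rect_width_def) (simp add: algebra_simps)
  qed
  moreover have "(g * g) * ?J d + (g * h) * ?J (d + pi / 2) + (h * g) * ?J (d + pi / 2) + (h * h) * ?J d
     = 2 * (g\<^sup>2 + h\<^sup>2) * (sin d + (pi / 2 - d) * cos d) + 4 * (g * h) * (cos d + d * sin d)"
    by (simp add: sin_add cos_add power2_eq_square algebra_simps)
  ultimately show ?thesis by simp
qed

section \<open>The triangle and the passage to oblique coordinates\<close>

text \<open>
  The Lagrange identity turns the sine of the angle into a determinant, whose modulus is the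
  same at all three vertices.
\<close>

lemma angle_at_cos_sin:
  assumes "X \<noteq> V" "Y \<noteq> V"
  shows "cos (angle_at X V Y) * (dist V X * dist V Y) = (X - V) \<bullet> (Y - V)"
    and "sin (angle_at X V Y) * (dist V X * dist V Y) = \<bar>det2 (X - V) (Y - V)\<bar>"
    and "0 \<le> angle_at X V Y"
proof -
  define x y where "x = X - V" and "y = Y - V"
  have xy: "norm x > 0" "norm y > 0" using assms by (simp_all add: x_def y_def)
  have d: "dist V X = norm x" "dist V Y = norm y" by (simp_all add: x_def y_def dist_norm norm_minus_commute)
  have "\<bar>x \<bullet> y / (norm x * norm y)\<bar> \<le> 1"
    using xy Cauchy_Schwarz_ineq2[of x y] by (simp add: abs_divide abs_mult)
  then have b: "-1 \<le> x \<bullet> y / (norm x * norm y)" "x \<bullet> y / (norm x * norm y) \<le> 1" by linarith+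
  have ang: "angle_at X V Y = arccos (x \<bullet> y / (norm x * norm y))" by (simp add: angle_at_def x_def y_def)
  have c: "cos (angle_at X V Y) * (norm x * norm y) = x \<bullet> y"
    unfolding ang using b xy by (simp add: cos_arccos)
  then show "cos (angle_at X V Y) * (dist V X * dist V Y) = (X - V) \<bullet> (Y - V)"
    unfolding d by (simp add: x_def y_def)
  show nn: "0 \<le> angle_at X V Y" unfolding ang using b by (rule arccos_lbound)
  have s: "0 \<le> sin (angle_at X V Y)" unfolding ang using b by (intro sin_ge_zero arccos_lbound arccos_ubound)
  have "(sin (angle_at X V Y) * (norm x * norm y))\<^sup>2 = (norm x)\<^sup>2 * (norm y)\<^sup>2 - (x \<bullet> y)\<^sup>2"
    unfolding c[symmetric] power_mult_distrib sin_squared_eq by (simp add: algebra_simps)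
  also have "\<dots> = (det2 x y)\<^sup>2"
    unfolding power2_norm_eq_inner by (simp add: inner_prod_def det2_def power2_eq_square algebra_simps)
  finally have "\<bar>sin (angle_at X V Y) * (norm x * norm y)\<bar> = \<bar>det2 x y\<bar>" by (simp add: power2_eq_iff abs_eq_iff)
  then show "sin (angle_at X V Y) * (dist V X * dist V Y) = \<bar>det2 (X - V) (Y - V)\<bar>"
    unfolding d using s by (simp add: x_def y_def abs_mult)
qed

lemma collinear_if_det2_eq_0:
  assumes "det2 (B - A) (C - A) = 0"
  shows "collinear {A, B, C :: real \<times> real}"
proof (cases "B = A")
  case False
  define x y where "x = B - A" and "y = C - A"
  have x: "x \<bullet> x \<noteq> 0" using False by (simp add: x_def)
  have "(x \<bullet> x) *\<^sub>R y = (x \<bullet> y) *\<^sub>R x"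
    using assms unfolding x_def[symmetric] y_def[symmetric] det2_def
    by (simp add: prod_eq_iff inner_prod_def algebra_simps)
  then have "y = ((x \<bullet> y) / (x \<bullet> x)) *\<^sub>R x"
    using x by (metis divide_inverse_commute inverse_eq_divide scaleR_scaleR left_inverse scaleR_one)
  then have "collinear {0, x, y}" by (auto simp: collinear_lemma)
  then show ?thesis using collinear_3[of B A C] by (simp add: x_def y_def insert_commute)
qed simp

text \<open>
  The metric relations that are used of a non-obtuse triangle; \<open>Q\<close> is twice its area.
\<close>

locale acute_triangle =
  fixes a b c \<alpha> \<beta> \<gamma> Q :: real
  assumes pos: "0 < a" "0 < b" "0 < c" "0 < Q"
    and angles: "0 < \<alpha>" "\<alpha> \<le> pi / 2" "0 < \<beta>" "\<beta> \<le> pi / 2" "0 < \<gamma>" "\<gamma> \<le> pi / 2"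
    and sum: "\<alpha> + \<beta> + \<gamma> = pi"
    and area: "b * c * sin \<alpha> = Q" "a * c * sin \<beta> = Q" "a * b * sin \<gamma> = Q"
    and cosines: "2 * (b * c * cos \<alpha>) = b\<^sup>2 + c\<^sup>2 - a\<^sup>2" "2 * (a * c * cos \<beta>) = a\<^sup>2 + c\<^sup>2 - b\<^sup>2"
      "2 * (a * b * cos \<gamma>) = a\<^sup>2 + b\<^sup>2 - c\<^sup>2"

text \<open>
  The angle sum is obtained from \<open>cos (\<alpha> + \<beta>) = - cos \<gamma>\<close>, a polynomial consequence of the cosine theorem
  and the area formula. As \<open>\<alpha> + \<beta>\<close> does not exceed \<open>\<pi>\<close>, the cosine determines it.
\<close>

lemma acute_triangle_of_is_triangle:
  assumes "is_triangle a b c \<alpha> \<beta> \<gamma>" and le: "\<alpha> \<le> pi / 2" "\<beta> \<le> pi / 2" "\<gamma> \<le> pi / 2"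
  shows "acute_triangle a b c \<alpha> \<beta> \<gamma> (a * b * sin \<gamma>)"
proof -
  obtain A B C :: "real \<times> real" where nc: "\<not> collinear {A, B, C}"
    and sides: "a = dist B C" "b = dist C A" "c = dist A B"
    and ang: "\<alpha> = angle_at B A C" "\<beta> = angle_at C B A" "\<gamma> = angle_at A C B"
    using assms(1) unfolding is_triangle_def by blast
  have ne: "A \<noteq> B" "B \<noteq> C" "C \<noteq> A" using nc by (auto simp: insert_commute)
  define Q where "Q = \<bar>det2 (B - A) (C - A)\<bar>"
  have Q: "0 < Q" using nc collinear_if_det2_eq_0[of B A C] by (auto simp: Q_def)
  have dets: "\<bar>det2 (C - B) (A - B)\<bar> = Q" "\<bar>det2 (A - C) (B - C)\<bar> = Q"
    unfolding Q_def by (rule arg_cong[of _ _ abs], simp add: det2_def algebra_simps)+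
  have pos: "0 < a" "0 < b" "0 < c" using ne by (simp_all add: sides)
  have area: "b * c * sin \<alpha> = Q" "a * c * sin \<beta> = Q" "a * b * sin \<gamma> = Q"
    using angle_at_cos_sin(2)[of B A C] angle_at_cos_sin(2)[of C B A] angle_at_cos_sin(2)[of A C B] ne dets
    by (simp_all add: sides ang Q_def dist_commute mult_ac)
  have sq: "a\<^sup>2 = (C - B) \<bullet> (C - B)" "b\<^sup>2 = (C - A) \<bullet> (C - A)" "c\<^sup>2 = (B - A) \<bullet> (B - A)"
    by (simp_all add: sides dist_norm power2_norm_eq_inner inner_commute inner_diff algebra_simps)
  have cosines: "2 * (b * c * cos \<alpha>) = b\<^sup>2 + c\<^sup>2 - a\<^sup>2" "2 * (a * c * cos \<beta>) = a\<^sup>2 + c\<^sup>2 - b\<^sup>2"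
      "2 * (a * b * cos \<gamma>) = a\<^sup>2 + b\<^sup>2 - c\<^sup>2"
    using angle_at_cos_sin(1)[of B A C] angle_at_cos_sin(1)[of C B A] angle_at_cos_sin(1)[of A C B] ne
    unfolding sq by (simp_all add: sides ang dist_commute mult_ac inner_diff inner_commute algebra_simps)
  have nonneg: "0 \<le> \<alpha>" "0 \<le> \<beta>" "0 \<le> \<gamma>" unfolding ang using ne by (auto intro!: angle_at_cos_sin(3))
  have "\<alpha> \<noteq> 0" "\<beta> \<noteq> 0" "\<gamma> \<noteq> 0" using area Q by auto
  then have ang_pos: "0 < \<alpha>" "0 < \<beta>" "0 < \<gamma>" using nonneg by auto
  have "4 * (a * b * c\<^sup>2) * cos (\<alpha> + \<beta>) = (2 * (b * c * cos \<alpha>)) * (2 * (a * c * cos \<beta>)) - 4 * ((b * c * sin \<alpha>) * (a * c * sin \<beta>))"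
    by (simp add: cos_add power2_eq_square algebra_simps)
  also have "\<dots> = (2 * (b * c * cos \<alpha>)) * (2 * (a * c * cos \<beta>)) - 4 * (a * b * sin \<gamma>)\<^sup>2"
    unfolding area by (simp add: power2_eq_square)
  also have "4 * (a * b * sin \<gamma>)\<^sup>2 = 4 * a\<^sup>2 * b\<^sup>2 - (2 * (a * b * cos \<gamma>))\<^sup>2"
    by (simp add: power_mult_distrib sin_squared_eq algebra_simps)
  also have "(2 * (b * c * cos \<alpha>)) * (2 * (a * c * cos \<beta>)) - (4 * a\<^sup>2 * b\<^sup>2 - (2 * (a * b * cos \<gamma>))\<^sup>2)
     = 4 * (a * b * c\<^sup>2) * - cos \<gamma>"
  proof -
    have "4 * (a * b * c\<^sup>2) * - cos \<gamma> = - 2 * c\<^sup>2 * (2 * (a * b * cos \<gamma>))" by simp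
    then show ?thesis unfolding cosines by (simp add: power2_eq_square algebra_simps)
  qed
  finally have "4 * (a * b * c\<^sup>2) * cos (\<alpha> + \<beta>) = 4 * (a * b * c\<^sup>2) * - cos \<gamma>" .
  moreover have "4 * (a * b * c\<^sup>2) \<noteq> 0" using pos by simp
  ultimately have "cos (\<alpha> + \<beta>) = cos (pi - \<gamma>)"
    unfolding cos_pi_minus by (rule mult_left_cancel[THEN iffD1, rotated])
  then have "\<alpha> + \<beta> = pi - \<gamma>"
    using cos_inj_pi[of "\<alpha> + \<beta>" "pi - \<gamma>"] ang_pos le by simp
  then show ?thesis
    using pos Q ang_pos le area cosines by unfold_locales auto
qed

context acute_triangle
begin

text \<open>
  The vector \<open>(1, 0)\<close> is mapped to the side \<open>c\<close> and \<open>(0, 1)\<close> to the side \<open>b\<close> of the triangle. The term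
  \<open>0 * fst z\<close> keeps the matrix visible for the area formula of linear maps.
\<close>

definition lattice_map :: "real \<times> real \<Rightarrow> real \<times> real" where
  "lattice_map z = (c * fst z + (b * cos \<alpha>) * snd z, 0 * fst z + (b * sin \<alpha>) * snd z)"

definition lattice_coords :: "real \<times> real \<Rightarrow> real \<times> real" where
  "lattice_coords w = ((fst w * sin \<alpha> - snd w * cos \<alpha>) * (b / Q), snd w * (c / Q))"

lemma sines_pos: "0 < sin \<alpha>" "0 < sin \<beta>" "0 < sin \<gamma>"
  using angles pi_gt_zero by (auto intro!: sin_gt_zero)

lemma altitudes: "c * sin \<beta> = b * sin \<gamma>" "c * sin \<alpha> = a * sin \<gamma>" "b * sin \<alpha> = a * sin \<beta>"
proof -
  have "a * (c * sin \<beta>) = a * (b * sin \<gamma>)" "b * (c * sin \<alpha>) = b * (a * sin \<gamma>)" "c * (b * sin \<alpha>) = c * (a * sin \<beta>)"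
    using area by (simp_all add: mult_ac)
  then show "c * sin \<beta> = b * sin \<gamma>" "c * sin \<alpha> = a * sin \<gamma>" "b * sin \<alpha> = a * sin \<beta>"
    using pos by simp_all
qed

lemma coords_map: "lattice_coords (lattice_map z) = z"
proof -
  have "(c * fst z + b * cos \<alpha> * snd z) * sin \<alpha> - b * sin \<alpha> * snd z * cos \<alpha> = c * sin \<alpha> * fst z"
    by (simp add: algebra_simps)
  moreover have "c * sin \<alpha> * fst z * (b / Q) = fst z" "b * sin \<alpha> * snd z * (c / Q) = snd z"
    using area(1) pos by (simp_all add: field_simps)
  ultimately show ?thesis by (simp add: lattice_coords_def lattice_map_def prod_eq_iff)
qed

lemma map_coords: "lattice_map (lattice_coords w) = w"
proof -
  have 1: "b * sin \<alpha> * (snd w * (c / Q)) = snd w" using area(1) pos by (simp add: field_simps)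
  have "c * ((fst w * sin \<alpha> - snd w * cos \<alpha>) * (b / Q)) + b * cos \<alpha> * (snd w * (c / Q)) = fst w * (b * c * sin \<alpha>) / Q"
    using pos by (simp add: field_simps)
  also have "\<dots> = fst w" unfolding area(1) using pos by simp
  finally show ?thesis using 1 by (simp add: lattice_coords_def lattice_map_def prod_eq_iff)
qed

lemma linear_lattice_map: "linear lattice_map"
  by (rule linearI) (auto simp: lattice_map_def algebra_simps)

lemma linear_lattice_coords: "linear lattice_coords"
  by (rule linearI) (auto simp: lattice_coords_def algebra_simps)

lemma inj_lattice_map: "inj lattice_map"
  by (metis coords_map injI)

lemma lattice_map_image: "lattice_map ` S = {w. lattice_coords w \<in> S}"
  using coords_map map_coords by (auto simp: image_iff) (metis map_coords)

lemma mem_lattice_lines: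
  "lattice_map z \<in> lattice_lines a b \<alpha> \<beta> \<gamma> \<longleftrightarrow> fst z \<in> \<int> \<or> snd z \<in> \<int> \<or> fst z + snd z \<in> \<int>"
proof -
  define x y where "x = fst (lattice_map z)" and "y = snd (lattice_map z)"
  have g: "sin (\<alpha> + \<beta>) = sin \<gamma>"
  proof -
    have "\<alpha> + \<beta> = pi - \<gamma>" using sum by simp
    then show ?thesis by (simp only: sin_pi_minus)
  qed
  have "x * sin \<beta> + y * cos \<beta> = (c * sin \<beta>) * fst z + b * snd z * sin (\<alpha> + \<beta>)"
    by (simp add: x_def y_def lattice_map_def sin_add algebra_simps)
  then have 1: "x * sin \<beta> + y * cos \<beta> = (fst z + snd z) * (b * sin \<gamma>)"
    unfolding g altitudes(1) by (simp add: algebra_simps)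
  have "x * sin \<alpha> - y * cos \<alpha> = fst z * (c * sin \<alpha>)"
    by (simp add: x_def y_def lattice_map_def algebra_simps)
  then have 2: "x * sin \<alpha> - y * cos \<alpha> = fst z * (a * sin \<gamma>)" unfolding altitudes(2) .
  have 3: "y = snd z * (a * sin \<beta>)" unfolding altitudes(3)[symmetric]
    by (simp add: y_def lattice_map_def algebra_simps)
  have cancel: "r * s = of_int k * s \<longleftrightarrow> r = of_int k" if "s > 0" for r s :: real and k :: int
    using that by simp
  have h: "b * sin \<gamma> > 0" "a * sin \<gamma> > 0" "a * sin \<beta> > 0" using pos sines_pos by simp_all
  have e1: "x * sin \<beta> + y * cos \<beta> = of_int k * (b * sin \<gamma>) \<longleftrightarrow> fst z + snd z = of_int k" for k :: int
    unfolding 1 by (rule cancel[OF h(1)])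
  have e2: "x * sin \<alpha> - y * cos \<alpha> = of_int k * (a * sin \<gamma>) \<longleftrightarrow> fst z = of_int k" for k :: int
    unfolding 2 by (rule cancel[OF h(2)])
  have e3: "y = of_int k * (a * sin \<beta>) \<longleftrightarrow> snd z = of_int k" for k :: int
    unfolding 3 by (rule cancel[OF h(3)])
  have "lattice_map z = (x, y)" by (simp add: x_def y_def)
  then have "lattice_map z \<in> lattice_lines a b \<alpha> \<beta> \<gamma> \<longleftrightarrow>
      (\<exists>k::int. fst z + snd z = of_int k) \<or> (\<exists>k::int. fst z = of_int k) \<or> (\<exists>k::int. snd z = of_int k)"
    unfolding lattice_lines_def
    by (simp only: Un_iff UN_iff UNIV_I mem_Collect_eq prod.case e1 e2 e3 simp_thms Bex_def disj_assoc)
  then show ?thesis by (auto simp: Ints_def)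
qed

lemma Union_cells: "z \<in> (\<Union>i. cell i) \<longleftrightarrow> \<not> (fst z \<in> \<int> \<or> snd z \<in> \<int> \<or> fst z + snd z \<in> \<int>)"
proof -
  have slot: "(\<exists>i::int. of_int i < x \<and> x < of_int i + 1) \<longleftrightarrow> x \<notin> \<int>" for x :: real
  proof
    assume "\<exists>i::int. of_int i < x \<and> x < of_int i + 1"
    then obtain i :: int where i: "of_int i < x" "x < of_int i + 1" by blast
    show "x \<notin> \<int>"
    proof
      assume "x \<in> \<int>"
      then obtain n :: int where "x = of_int n" by (elim Ints_cases)
      with i have "i < n" "n < i + 1" by linarith+
      then show False by simp
    qed
  next
    assume "x \<notin> \<int>"
    then have "x \<noteq> of_int \<lfloor>x\<rfloor>" by (metis Ints_of_int)
    then show "\<exists>i::int. of_int i < x \<and> x < of_int i + 1"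
      by (intro exI[of _ "\<lfloor>x\<rfloor>"]) linarith
  qed
  have "z \<in> (\<Union>i. cell i) \<longleftrightarrow> (\<exists>i::int. of_int i < fst z \<and> fst z < of_int i + 1)
     \<and> (\<exists>i::int. of_int i < snd z \<and> snd z < of_int i + 1) \<and> (\<exists>i::int. of_int i < fst z + snd z \<and> fst z + snd z < of_int i + 1)"
    by (simp add: cell_def case_prod_unfold split_paired_Ex) blast
  then show ?thesis unfolding slot by blast
qed

lemma cell_index_unique:
  assumes "z \<in> cell i" "z \<in> cell j" shows "i = j"
proof -
  have eq: "m = n" if "of_int m < x" "x < of_int m + 1" "of_int n < x" "x < of_int n + 1" for x :: real and m n :: int
    using that by linarith
  show ?thesis using assms unfolding cell_def case_prod_unfold
    by (auto simp: prod_eq_iff intro: eq[of _ "fst z"] eq[of _ "snd z"] eq[of _ "fst z + snd z"])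
qed

text \<open>
  The images of the cells are open, connected and pairwise disjoint and cover the complement of
  the lines, hence they are its components.
\<close>

lemma components_complement_lattice_lines:
  "components (- lattice_lines a b \<alpha> \<beta> \<gamma>) = (\<lambda>i. lattice_map ` cell i) ` {i. cell i \<noteq> {}}"
proof (rule components_open_unique)
  show "pairwise disjnt ((\<lambda>i. lattice_map ` cell i) ` {i. cell i \<noteq> {}})"
    unfolding pairwise_def disjnt_def lattice_map_image using cell_index_unique by blast
  show "\<Union> ((\<lambda>i. lattice_map ` cell i) ` {i. cell i \<noteq> {}}) = - lattice_lines a b \<alpha> \<beta> \<gamma>"
  proof (rule set_eqI)
    fix w
    have "w \<in> \<Union> ((\<lambda>i. lattice_map ` cell i) ` {i. cell i \<noteq> {}}) \<longleftrightarrow> lattice_coords w \<in> (\<Union>i. cell i)"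
      unfolding lattice_map_image by auto
    also have "\<dots> \<longleftrightarrow> lattice_map (lattice_coords w) \<notin> lattice_lines a b \<alpha> \<beta> \<gamma>"
      unfolding Union_cells mem_lattice_lines ..
    finally show "w \<in> \<Union> ((\<lambda>i. lattice_map ` cell i) ` {i. cell i \<noteq> {}}) \<longleftrightarrow> w \<in> - lattice_lines a b \<alpha> \<beta> \<gamma>"
      by (simp add: map_coords)
  qed
next
  fix X assume "X \<in> (\<lambda>i. lattice_map ` cell i) ` {i. cell i \<noteq> {}}"
  then obtain i where i: "X = lattice_map ` cell i" "cell i \<noteq> {}" by blast
  have "surj lattice_map" by (metis map_coords surjI)
  then show "open X \<and> connected X \<and> X \<noteq> {}"
    using i open_surjective_linear_image[OF open_cell linear_lattice_map]
      convex_connected[OF convex_linear_image[OF linear_lattice_map convex_cell]] by blast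
qed

text \<open>
  Different cells have different closures, because an open convex set is the interior of its
  closure. So counting triangles amounts to counting indices of cells.
\<close>

lemma card_lattice_triangles_hit:
  "card {T \<in> lattice_triangles a b \<alpha> \<beta> \<gamma>. T \<inter> B \<noteq> {}} = card {i. closure (cell i) \<inter> lattice_coords ` B \<noteq> {}}"
proof -
  let ?f = "\<lambda>i. lattice_map ` closure (cell i)"
  have closure_image: "closure (lattice_map ` S) = lattice_map ` closure S" for S
    by (rule closure_injective_linear_image[OF linear_lattice_map inj_lattice_map, symmetric])
  have hit: "?f i \<inter> B \<noteq> {} \<longleftrightarrow> closure (cell i) \<inter> lattice_coords ` B \<noteq> {}" for i
    unfolding lattice_map_image by blast
  have "{T \<in> lattice_triangles a b \<alpha> \<beta> \<gamma>. T \<inter> B \<noteq> {}} = ?f ` {i. closure (cell i) \<inter> lattice_coords ` B \<noteq> {}}"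
  proof -
    have "{T \<in> f ` A. T \<inter> B \<noteq> {}} = f ` {i \<in> A. f i \<inter> B \<noteq> {}}" for f and A :: "((int \<times> int) \<times> int) set" by blast
    moreover have "{i \<in> {i. cell i \<noteq> {}}. ?f i \<inter> B \<noteq> {}} = {i. closure (cell i) \<inter> lattice_coords ` B \<noteq> {}}"
      unfolding hit by (rule Collect_cong) (metis closure_empty inf_bot_left mem_Collect_eq)
    ultimately show ?thesis
      unfolding lattice_triangles_def components_complement_lattice_lines image_image closure_image by (simp only:)
  qed
  moreover have "inj_on ?f {i. closure (cell i) \<inter> lattice_coords ` B \<noteq> {}}"
  proof (rule inj_onI)
    fix i j assume i: "i \<in> {i. closure (cell i) \<inter> lattice_coords ` B \<noteq> {}}" and eq: "?f i = ?f j"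
    have "closure (cell i) = closure (cell j)" using eq inj_lattice_map by (simp add: inj_image_eq_iff)
    then have "interior (cell i) = interior (cell j)"
      using convex_interior_closure[OF convex_cell] by metis
    then have "cell i = cell j" by (simp add: interior_open open_cell)
    moreover have "cell i \<noteq> {}" using i by auto
    ultimately show "i = j" using cell_index_unique by blast
  qed
  ultimately show ?thesis by (simp add: card_image)
qed

end

section \<open>The thrown rectangle and its support function\<close>

definition dir :: "real \<Rightarrow> real \<times> real" where "dir x = (cos x, sin x)"

lemma linear_rotate2: "linear (rotate2 t)"
  by (rule linearI) (auto simp: rotate2_def algebra_simps)

lemma rotate2_dir: "rotate2 t (dir x) = dir (x + t)"
  by (simp add: rotate2_def dir_def cos_add sin_add algebra_simps)

lemma linear_image_closed_par:
  assumes "linear f"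
  shows "f ` closed_par m p q = closed_par (f m) (f p) (f q)"
  unfolding closed_par_def image_image
  by (simp add: linear_add[OF assms] linear_scale[OF assms])

text \<open>
  The sign \<open>\<epsilon>\<close> records the orientation of the pair of sides, which rotations preserve.
\<close>

lemma rectangle_closed_par:
  assumes "is_rectangle g h C"
  obtains ctr \<omega> \<epsilon> where "\<bar>\<epsilon>\<bar> = 1"
    "C = closed_par ctr ((g / 2) *\<^sub>R dir \<omega>) ((\<epsilon> * h / 2) *\<^sub>R dir (\<omega> + pi / 2))"
proof -
  obtain p u v where gh: "g > 0" "h > 0" and uv: "norm u = 1" "norm v = 1" "u \<bullet> v = 0"
    and C: "C = {p + s *\<^sub>R u + t *\<^sub>R v | s t. 0 \<le> s \<and> s \<le> g \<and> 0 \<le> t \<and> t \<le> h}"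
    using assms unfolding is_rectangle_def by blast
  have u: "(fst u)\<^sup>2 + (snd u)\<^sup>2 = 1" and v: "(fst v)\<^sup>2 + (snd v)\<^sup>2 = 1" and o: "fst u * fst v + snd u * snd v = 0"
    using uv by (simp_all add: norm_prod_def inner_prod_def)
  obtain \<omega> where \<omega>: "fst u = cos \<omega>" "snd u = sin \<omega>" using sincos_total_2pi[OF u] by metis
  define \<epsilon> where "\<epsilon> = fst u * snd v - snd u * fst v"
  have "\<epsilon>\<^sup>2 = ((fst u)\<^sup>2 + (snd u)\<^sup>2) * ((fst v)\<^sup>2 + (snd v)\<^sup>2) - (fst u * fst v + snd u * snd v)\<^sup>2"
    by (simp add: \<epsilon>_def power2_eq_square algebra_simps)
  then have "\<epsilon>\<^sup>2 = 1" by (simp only: u v o) simp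
  then have e: "\<bar>\<epsilon>\<bar> = 1" by (auto simp: power2_eq_1_iff)
  have "fst v = fst v * ((fst u)\<^sup>2 + (snd u)\<^sup>2) - fst u * (fst u * fst v + snd u * snd v)" "snd v = snd v * ((fst u)\<^sup>2 + (snd u)\<^sup>2) - snd u * (fst u * fst v + snd u * snd v)"
    unfolding u o by simp_all
  then have "fst v = - \<epsilon> * snd u" "snd v = \<epsilon> * fst u"
    by (simp_all add: \<epsilon>_def power2_eq_square algebra_simps)
  then have dirs: "u = dir \<omega>" "v = \<epsilon> *\<^sub>R dir (\<omega> + pi / 2)"
    using \<omega> by (simp_all add: prod_eq_iff dir_def cos_add sin_add)
  define ctr where "ctr = p + (g / 2) *\<^sub>R u + (h / 2) *\<^sub>R v"
  have "C = closed_par ctr ((g / 2) *\<^sub>R u) ((h / 2) *\<^sub>R v)"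
  proof (intro set_eqI iffI)
    fix w assume "w \<in> C"
    then obtain s t where st: "0 \<le> s" "s \<le> g" "0 \<le> t" "t \<le> h" "w = p + s *\<^sub>R u + t *\<^sub>R v" unfolding C by blast
    have "w = ctr + ((2 * s / g - 1) *\<^sub>R (g / 2) *\<^sub>R u + (2 * t / h - 1) *\<^sub>R (h / 2) *\<^sub>R v)"
      using gh unfolding st(5) ctr_def by (simp add: prod_eq_iff field_simps)
    moreover have "(2 * s / g - 1, 2 * t / h - 1) \<in> {-1..1} \<times> {-1..1}"
      using gh st by (simp add: field_simps)
    ultimately show "w \<in> closed_par ctr ((g / 2) *\<^sub>R u) ((h / 2) *\<^sub>R v)"
      unfolding closed_par_def by (intro image_eqI[of _ _ "(2 * s / g - 1, 2 * t / h - 1)"]) auto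
  next
    fix w assume "w \<in> closed_par ctr ((g / 2) *\<^sub>R u) ((h / 2) *\<^sub>R v)"
    then obtain x y where xy: "-1 \<le> x" "x \<le> 1" "-1 \<le> y" "y \<le> 1" "w = ctr + (x *\<^sub>R (g / 2) *\<^sub>R u + y *\<^sub>R (h / 2) *\<^sub>R v)"
      unfolding closed_par_def by (elim imageE) auto
    have "w = p + (g / 2 * (1 + x)) *\<^sub>R u + (h / 2 * (1 + y)) *\<^sub>R v"
      unfolding xy(5) ctr_def by (simp add: prod_eq_iff algebra_simps add_divide_distrib)
    moreover have "0 \<le> g / 2 * (1 + x)" "0 \<le> h / 2 * (1 + y)"
      using gh xy by (intro mult_nonneg_nonneg; simp)+
    moreover have "g / 2 * (1 + x) \<le> g" "h / 2 * (1 + y) \<le> h"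
      using gh xy by (simp_all add: field_simps)
    ultimately show "w \<in> C" unfolding C by blast
  qed
  then have "C = closed_par ctr ((g / 2) *\<^sub>R dir \<omega>) ((\<epsilon> * h / 2) *\<^sub>R dir (\<omega> + pi / 2))"
    unfolding dirs by (simp add: mult.commute)
  with e that show ?thesis by blast
qed

lemma placed_closed_par:
  assumes "C = closed_par ctr (k *\<^sub>R dir \<omega>) (l *\<^sub>R dir (\<omega> + pi / 2))"
  shows "placed C P E z \<theta> = closed_par (z + rotate2 (\<theta> - direction_angle (E - P)) (ctr - P))
     (k *\<^sub>R dir (\<theta> + (\<omega> - direction_angle (E - P)))) (l *\<^sub>R dir (\<theta> + (\<omega> - direction_angle (E - P)) + pi / 2))"
proof -
  let ?r = "\<theta> - direction_angle (E - P)"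
  have "placed C P E z \<theta> = (+) z ` rotate2 ?r ` (+) (- P) ` C"
    unfolding placed_def image_image by simp
  also have "(+) (- P) ` C = closed_par (ctr - P) (k *\<^sub>R dir \<omega>) (l *\<^sub>R dir (\<omega> + pi / 2))"
    unfolding assms par_translate(2)[symmetric] by simp
  also have "(+) z ` rotate2 ?r ` \<dots> = closed_par (z + rotate2 ?r (ctr - P)) (rotate2 ?r (k *\<^sub>R dir \<omega>)) (rotate2 ?r (l *\<^sub>R dir (\<omega> + pi / 2)))"
    unfolding linear_image_closed_par[OF linear_rotate2] par_translate(2)[symmetric] ..
  finally show ?thesis
    by (simp add: linear_scale[OF linear_rotate2] rotate2_dir algebra_simps)
qed

text \<open>
  The right-hand side is attained by the corner of the placed rectangle that is farthest in the
  direction of the first coordinate axis; the first summand is the contribution of the centre.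
\<close>

lemma support_fun_ge:
  assumes C: "C = closed_par ctr ((g / 2) *\<^sub>R dir \<omega>) ((\<epsilon> * h / 2) *\<^sub>R dir (\<omega> + pi / 2))"
    and e: "\<bar>\<epsilon>\<bar> = 1" and gh: "0 \<le> g" "0 \<le> h"
  shows "fst (rotate2 (\<phi> - direction_angle (E - P)) (ctr - P)) + rect_width g h (\<phi> + (\<omega> - direction_angle (E - P))) / 2
      \<le> support_fun C P E \<phi>"
proof -
  let ?t = "\<phi> + (\<omega> - direction_angle (E - P))"
  let ?m = "rotate2 (\<phi> - direction_angle (E - P)) (ctr - P)"
  let ?p = "(g / 2) *\<^sub>R dir ?t" and ?q = "(\<epsilon> * h / 2) *\<^sub>R dir (?t + pi / 2)"
  define w where "w = ?m + (sgn (fst ?p) *\<^sub>R ?p + sgn (fst ?q) *\<^sub>R ?q)"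
  have pl: "placed C P E (0, 0) \<phi> = closed_par ?m ?p ?q"
    using placed_closed_par[OF C, of P E "(0, 0)" \<phi>] by (simp flip: zero_prod_def)
  have sgn: "sgn x \<in> {-1..1}" for x :: real by (simp add: sgn_if)
  have "w \<in> placed C P E (0, 0) \<phi>"
    unfolding pl closed_par_def w_def using sgn
    by (intro image_eqI[of _ _ "(sgn (fst ?p), sgn (fst ?q))"]) (simp_all only: fst_conv snd_conv mem_Sigma_iff simp_thms)
  moreover have "bdd_above (fst ` placed C P E (0, 0) \<phi>)"
    unfolding pl by (intro bounded_imp_bdd_above compact_imp_bounded compact_continuous_image compact_closed_par continuous_intros)
  ultimately have "fst w \<le> support_fun C P E \<phi>"
    unfolding support_fun_def by (rule cSUP_upper)
  moreover have "fst w = fst ?m + (\<bar>fst ?p\<bar> + \<bar>fst ?q\<bar>)"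
    by (simp add: w_def abs_sgn[of "fst _"] del: scaleR_scaleR) (simp add: abs_sgn mult.commute)
  moreover have "\<bar>fst ?p\<bar> + \<bar>fst ?q\<bar> = rect_width g h ?t / 2"
    using e gh by (simp add: dir_def rect_width_def abs_mult cos_add)
  ultimately show ?thesis by simp
qed

context acute_triangle
begin

lemma projection: "b * cos \<alpha> + a * cos \<beta> = c"
proof -
  have "2 * c * (b * cos \<alpha> + a * cos \<beta>) = 2 * c * c"
    using cosines(1,2) by (simp add: power2_eq_square algebra_simps)
  then show ?thesis using pos by simp
qed

text \<open>
  Up to sign, the three functionals are sines of the angles between the direction and the sides \<open>b\<close>, \<open>c\<close>, \<open>a\<close>,
  divided by the altitudes \<open>Q / b\<close>, \<open>Q / c\<close>, \<open>Q / a\<close>.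
\<close>

lemma coords_dir:
  "fst (lattice_coords (dir t)) = - (b / Q) * sin (t - \<alpha>)"
  "snd (lattice_coords (dir t)) = (c / Q) * sin t"
  "fst (lattice_coords (dir t)) + snd (lattice_coords (dir t)) = (a / Q) * sin (t + \<beta>)"
proof -
  show 1: "fst (lattice_coords (dir t)) = - (b / Q) * sin (t - \<alpha>)"
    by (simp add: lattice_coords_def dir_def sin_diff algebra_simps diff_divide_distrib)
  show 2: "snd (lattice_coords (dir t)) = (c / Q) * sin t"
    by (simp add: lattice_coords_def dir_def)
  have "- b * sin (t - \<alpha>) + c * sin t = a * sin (t + \<beta>)"
    using altitudes(3) unfolding projection[symmetric] sin_diff sin_add by (simp add: algebra_simps)
  then show "fst (lattice_coords (dir t)) + snd (lattice_coords (dir t)) = (a / Q) * sin (t + \<beta>)"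
    unfolding 1 2 using pos by (simp add: field_simps)
qed

lemma det2_coords: "det2 (lattice_coords x) (lattice_coords y) = det2 x y / Q"
proof -
  have "det2 (lattice_coords x) (lattice_coords y) = (b * c * sin \<alpha>) * det2 x y / (Q * Q)"
    using pos by (simp add: det2_def lattice_coords_def field_simps)
  then show ?thesis unfolding area using pos by simp
qed

text \<open>
  Twice the support distances from the centre are the widths of the rectangle. The position of
  the reference point cancels because the outward normals of a triangle, weighted with the side
  lengths, add up to zero.
\<close>

lemma c_star_ge:
  assumes C: "C = closed_par ctr ((g / 2) *\<^sub>R dir \<omega>) ((\<epsilon> * h / 2) *\<^sub>R dir (\<omega> + pi / 2))"
    and e: "\<bar>\<epsilon>\<bar> = 1" and gh: "0 \<le> g" "0 \<le> h"
    and y: "y = \<phi> + \<alpha> + (\<omega> - direction_angle (E - P))"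
  shows "c / 2 * (b / Q * rect_width g h (y - \<alpha>) + c / Q * rect_width g h y + a / Q * rect_width g h (y + \<beta>))
     \<le> c_star (support_fun C P E) \<alpha> \<beta> \<phi>"
proof -
  let ?s = "support_fun C P E" and ?W = "rect_width g h"
  let ?d = "direction_angle (E - P)"
  define M where "M \<psi> = fst (rotate2 (\<psi> - ?d) (ctr - P))" for \<psi>
  have s: "M \<psi> + ?W (\<psi> + (\<omega> - ?d)) / 2 \<le> ?s \<psi>" for \<psi>
    unfolding M_def by (rule support_fun_ge[OF C e gh])
  have coef: "1 / sin \<alpha> = b * c / Q" "1 / sin \<beta> = a * c / Q"
    using area sines_pos pos by (auto simp: field_simps)
  have "cot \<alpha> + cot \<beta> = cos \<alpha> * (1 / sin \<alpha>) + cos \<beta> * (1 / sin \<beta>)" by (simp add: cot_def)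
  also have "\<dots> = c * (b * cos \<alpha> + a * cos \<beta>) / Q" unfolding coef using pos by (simp add: field_simps)
  finally have cots: "cot \<alpha> + cot \<beta> = c * c / Q" unfolding projection .
  have cs: "c_star ?s \<alpha> \<beta> \<phi> = (b * c / Q) * ?s \<phi> + (a * c / Q) * ?s (\<phi> + \<alpha> + \<beta>) + (c * c / Q) * ?s (\<phi> + \<alpha> + pi)"
  proof -
    have "c_star ?s \<alpha> \<beta> \<phi> = (1 / sin \<alpha>) * ?s \<phi> + (1 / sin \<beta>) * ?s (\<phi> + \<alpha> + \<beta>) + (cot \<alpha> + cot \<beta>) * ?s (\<phi> + \<alpha> + pi)"
      by (simp add: c_star_def)
    then show ?thesis unfolding coef cots .
  qed
  have "b * M \<phi> + a * M (\<phi> + \<alpha> + \<beta>) + c * M (\<phi> + \<alpha> + pi) = 0"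
  proof -
    define x where "x = \<phi> + \<alpha> - ?d"
    define v where "v = ctr - P"
    have eqs: "\<phi> - ?d = x - \<alpha>" "\<phi> + \<alpha> + \<beta> - ?d = x + \<beta>" "\<phi> + \<alpha> + pi - ?d = x + pi" by (simp_all add: x_def)
    have "b * M \<phi> + a * M (\<phi> + \<alpha> + \<beta>) + c * M (\<phi> + \<alpha> + pi)
      = (fst v * cos x - snd v * sin x) * ((b * cos \<alpha> + a * cos \<beta>) - c)
        + (fst v * sin x + snd v * cos x) * (b * sin \<alpha> - a * sin \<beta>)"
      unfolding M_def eqs v_def[symmetric] rotate2_def by (simp add: cos_add cos_diff sin_add sin_diff algebra_simps)
    then show ?thesis unfolding projection altitudes(3) by simp
  qed
  then have M0: "(b * c / Q) * M \<phi> + (a * c / Q) * M (\<phi> + \<alpha> + \<beta>) + (c * c / Q) * M (\<phi> + \<alpha> + pi) = 0"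
  proof -
    assume *: "b * M \<phi> + a * M (\<phi> + \<alpha> + \<beta>) + c * M (\<phi> + \<alpha> + pi) = 0"
    have "(b * c / Q) * M \<phi> + (a * c / Q) * M (\<phi> + \<alpha> + \<beta>) + (c * c / Q) * M (\<phi> + \<alpha> + pi)
      = c / Q * (b * M \<phi> + a * M (\<phi> + \<alpha> + \<beta>) + c * M (\<phi> + \<alpha> + pi))" by (simp add: algebra_simps add_divide_distrib)
    then show ?thesis unfolding * by simp
  qed
  have args: "\<phi> + (\<omega> - ?d) = y - \<alpha>" "\<phi> + \<alpha> + \<beta> + (\<omega> - ?d) = y + \<beta>" "\<phi> + \<alpha> + pi + (\<omega> - ?d) = y + pi"
    by (simp_all add: y)
  have Wpi: "?W (y + pi) = ?W y" by (simp add: rect_width_def)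
  have "(b * c / Q) * (M \<phi> + ?W (y - \<alpha>) / 2) + (a * c / Q) * (M (\<phi> + \<alpha> + \<beta>) + ?W (y + \<beta>) / 2) + (c * c / Q) * (M (\<phi> + \<alpha> + pi) + ?W y / 2)
     \<le> c_star ?s \<alpha> \<beta> \<phi>"
    unfolding cs using s[of \<phi>] s[of "\<phi> + \<alpha> + \<beta>"] s[of "\<phi> + \<alpha> + pi"] pos
    unfolding args Wpi by (intro add_mono mult_left_mono) auto
  moreover have "(b * c / Q) * (M \<phi> + ?W (y - \<alpha>) / 2) + (a * c / Q) * (M (\<phi> + \<alpha> + \<beta>) + ?W (y + \<beta>) / 2) + (c * c / Q) * (M (\<phi> + \<alpha> + pi) + ?W y / 2)
    = ((b * c / Q) * M \<phi> + (a * c / Q) * M (\<phi> + \<alpha> + \<beta>) + (c * c / Q) * M (\<phi> + \<alpha> + pi))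
      + c / 2 * (b / Q * ?W (y - \<alpha>) + c / Q * ?W y + a / Q * ?W (y + \<beta>))"
    by (simp add: algebra_simps)
  ultimately show ?thesis by (simp only: M0 add_0_left)
qed

end

section \<open>Disintegration of the random throw\<close>

context acute_triangle
begin

lemma lattice_map_mem_Q:
  "lattice_map z \<in> parallelogram_Q a c \<alpha> \<beta> \<longleftrightarrow> z \<in> {0..1} \<times> {0..1}"
proof -
  have h: "0 < b * sin \<alpha>" using pos sines_pos by simp
  have l: "snd (lattice_map z) = b * sin \<alpha> * snd z" "fst (lattice_map z) = c * fst z + b * cos \<alpha> * snd z"
    "snd (lattice_map z) * cot \<alpha> = b * cos \<alpha> * snd z"
    using sines_pos by (simp_all add: lattice_map_def cot_def)
  have "lattice_map z \<in> parallelogram_Q a c \<alpha> \<beta> \<longleftrightarrow> 0 \<le> snd (lattice_map z) \<and> snd (lattice_map z) \<le> b * sin \<alpha>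
      \<and> snd (lattice_map z) * cot \<alpha> \<le> fst (lattice_map z) \<and> fst (lattice_map z) \<le> c + snd (lattice_map z) * cot \<alpha>"
    unfolding parallelogram_Q_def altitudes(3)[symmetric] by (simp add: case_prod_unfold)
  also have "\<dots> \<longleftrightarrow> b * sin \<alpha> * 0 \<le> b * sin \<alpha> * snd z \<and> b * sin \<alpha> * snd z \<le> b * sin \<alpha> * 1
      \<and> c * 0 \<le> c * fst z \<and> c * fst z \<le> c * 1"
    unfolding l(3) unfolding l(1,2) by auto
  also have "\<dots> \<longleftrightarrow> z \<in> {0..1} \<times> {0..1}"
    unfolding mult_le_cancel_left_pos[OF h] mult_le_cancel_left_pos[OF pos(3)] by (auto simp: mem_Times_iff)
  finally show ?thesis .
qed

lemma parallelogram_Q_measurable: "parallelogram_Q a c \<alpha> \<beta> \<in> sets borel"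
proof -
  have "parallelogram_Q a c \<alpha> \<beta> = lattice_map ` ({0..1} \<times> {0..1})"
    unfolding lattice_map_image lattice_map_mem_Q[symmetric] map_coords by simp
  moreover have "compact (lattice_map ` ({0..1} \<times> {0..1}))"
    using linear_lattice_map by (intro compact_continuous_image compact_Times linear_continuous_on) (auto simp: linear_conv_bounded_linear)
  ultimately show ?thesis by (metis borel_compact)
qed

text \<open>
  The linear map \<open>lattice_map\<close> scales areas by \<open>Q\<close> and the closed unit square differs from the
  half-open one by a null set.
\<close>

lemma emeasure_uniform_Q:
  assumes S: "S \<in> sets borel"
  shows "emeasure (uniform_measure lborel (parallelogram_Q a c \<alpha> \<beta>)) S = emeasure lborel {z \<in> unit_square. lattice_map z \<in> S}"
proof -
  let ?P = "parallelogram_Q a c \<alpha> \<beta>"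
  note P = parallelogram_Q_measurable
  have det: "c * (b * sin \<alpha>) - (b * cos \<alpha>) * 0 \<noteq> 0" "\<bar>c * (b * sin \<alpha>) - (b * cos \<alpha>) * 0\<bar> = Q"
    using area(1) pos by (simp_all add: mult_ac)
  have lm[measurable]: "lattice_map \<in> borel \<rightarrow>\<^sub>M borel"
    unfolding lattice_map_def by measurable
  have scale: "emeasure lborel A = ennreal Q * emeasure lborel {z. lattice_map z \<in> A}" if "A \<in> sets borel" for A
    using emeasure_linear_preimage_plane[OF that det(1)] unfolding det(2) lattice_map_def by simp
  have sq: "emeasure lborel {z \<in> {0..1} \<times> {0..1}. lattice_map z \<in> A} = emeasure lborel {z \<in> unit_square. lattice_map z \<in> A}"
    if [measurable]: "A \<in> sets borel" for A
  proof (rule emeasure_eq_AE)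
    have [measurable]: "({0..1} \<times> {0..1} :: (real \<times> real) set) \<in> sets borel"
      by (intro borel_closed closed_Times) auto
    have "emeasure lborel ({0..1} \<times> {0..1} - unit_square :: (real \<times> real) set) = 0"
    proof -
      have "emeasure lborel ({0..1} \<times> {0..1} :: (real \<times> real) set) = 1"
        unfolding lborel_prod[symmetric] by (subst lborel.emeasure_pair_measure_Times) auto
      moreover have "unit_square \<subseteq> {0..1} \<times> {0..1}" by (auto simp: unit_square_def)
      ultimately show ?thesis
        using emeasure_unit_square by (subst emeasure_Diff) auto
    qed
    then have "AE z in lborel. z \<notin> ({0..1} \<times> {0..1} - unit_square :: (real \<times> real) set)"
      by (intro AE_not_in) (auto simp: null_sets_def)
    moreover have "unit_square \<subseteq> {0..1} \<times> {0..1}" by (auto simp: unit_square_def)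
    ultimately show "AE z in lborel. z \<in> {z \<in> {0..1} \<times> {0..1}. lattice_map z \<in> A} \<longleftrightarrow> z \<in> {z \<in> unit_square. lattice_map z \<in> A}"
      by (auto elim!: eventually_mono)
    show "{z \<in> {0..1} \<times> {0..1}. lattice_map z \<in> A} \<in> sets lborel" "{z \<in> unit_square. lattice_map z \<in> A} \<in> sets lborel"
      by (simp; measurable)+
  qed
  have "{z. lattice_map z \<in> ?P \<inter> A} = {z \<in> {0..1} \<times> {0..1}. lattice_map z \<in> A}" for A
    using lattice_map_mem_Q by auto
  then have cap: "emeasure lborel (?P \<inter> A) = ennreal Q * emeasure lborel {z \<in> unit_square. lattice_map z \<in> A}" if "A \<in> sets borel" for A
    using scale[of "?P \<inter> A"] sq[OF that] P that by simp
  have eP: "emeasure lborel ?P = ennreal Q"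
    using cap[of UNIV] emeasure_unit_square by simp
  have "ennreal Q * x / ennreal Q = x" for x
    using pos by (simp add: ennreal_mult_divide_eq mult.commute)
  then show "emeasure (uniform_measure lborel ?P) S = emeasure lborel {z \<in> unit_square. lattice_map z \<in> S}"
    using S P cap[OF S] by (subst emeasure_uniform_measure) (auto simp: eP)
qed

text \<open>
  Fubini, with the position in oblique coordinates as the inner variable.
\<close>

lemma measure_throw:
  assumes A: "A \<in> sets borel"
    and f: "\<And>\<phi>. \<phi> \<in> {0..2 * pi} \<Longrightarrow> measure lborel {z \<in> unit_square. (lattice_map z, \<phi>) \<in> A} = f \<phi>"
    and I: "(f has_integral I) {0..2 * pi}"
  shows "measure (throw_measure a c \<alpha> \<beta>) A = I / (2 * pi)"
proof -
  let ?M1 = "uniform_measure lborel (parallelogram_Q a c \<alpha> \<beta>)" and ?M2 = "uniform_measure lborel {0..2 * pi}"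
  have e1: "emeasure ?M1 UNIV = 1"
    using emeasure_uniform_Q[of UNIV] emeasure_unit_square by simp
  have e2: "emeasure ?M2 UNIV = 1"
    using emeasure_uniform_measure_1[of lborel "{0..2 * pi}"] by (simp add: divide_ennreal_def)
  interpret M1: finite_measure ?M1 by (rule finite_measureI) (simp add: e1)
  interpret M2: finite_measure ?M2 by (rule finite_measureI) (simp add: divide_eq_0_iff ennreal_divide_eq_top_iff)
  interpret pair_sigma_finite ?M1 ?M2 ..
  have A': "A \<in> sets (?M1 \<Otimes>\<^sub>M ?M2)"
    using A by (simp add: borel_prod[symmetric] cong: sets_pair_measure_cong)
  have nonneg: "0 \<le> f \<phi>" if "\<phi> \<in> {0..2 * pi}" for \<phi>
    unfolding f[OF that, symmetric] by (rule measure_nonneg)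
  have slice: "emeasure ?M1 ((\<lambda>z. (z, \<phi>)) -` A) = ennreal (f \<phi>)" if "\<phi> \<in> {0..2 * pi}" for \<phi>
  proof -
    have [measurable]: "(\<lambda>z. (z, \<phi>)) -` A \<in> sets borel"
      using sets_Pair2[OF A', of \<phi>] by simp
    have "emeasure ?M1 ((\<lambda>z. (z, \<phi>)) -` A) = emeasure lborel {z \<in> unit_square. (lattice_map z, \<phi>) \<in> A}"
      using emeasure_uniform_Q[of "(\<lambda>z. (z, \<phi>)) -` A"] by simp
    also have "\<dots> = ennreal (measure lborel {z \<in> unit_square. (lattice_map z, \<phi>) \<in> A})"
    proof (rule emeasure_eq_ennreal_measure)
      have "emeasure lborel {z \<in> unit_square. (lattice_map z, \<phi>) \<in> A} \<le> emeasure lborel unit_square"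
        by (intro emeasure_mono) auto
      then show "emeasure lborel {z \<in> unit_square. (lattice_map z, \<phi>) \<in> A} \<noteq> top"
        unfolding emeasure_unit_square by (auto simp: top_unique)
    qed
    finally show ?thesis unfolding f[OF that] .
  qed
  have "(\<lambda>\<phi>. emeasure ?M1 ((\<lambda>z. (z, \<phi>)) -` A)) \<in> borel_measurable ?M2"
    by (rule measurable_emeasure_Pair2[OF A'])
  then have meas: "(\<lambda>\<phi>. emeasure ?M1 ((\<lambda>z. (z, \<phi>)) -` A)) \<in> borel_measurable lborel"
    by (simp add: measurable_def)
  have "emeasure (throw_measure a c \<alpha> \<beta>) A = (\<integral>\<^sup>+\<phi>. emeasure ?M1 ((\<lambda>z. (z, \<phi>)) -` A) \<partial>?M2)"
    unfolding throw_measure_def by (rule emeasure_pair_measure_alt2[OF A'])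
  also have "\<dots> = (\<integral>\<^sup>+\<phi>. emeasure ?M1 ((\<lambda>z. (z, \<phi>)) -` A) * indicator {0..2 * pi} \<phi> \<partial>lborel) / emeasure lborel {0..2 * pi}"
    by (rule nn_integral_uniform_measure[OF meas]) simp
  also have "(\<integral>\<^sup>+\<phi>. emeasure ?M1 ((\<lambda>z. (z, \<phi>)) -` A) * indicator {0..2 * pi} \<phi> \<partial>lborel)
      = (\<integral>\<^sup>+\<phi>. ennreal (f \<phi>) * indicator {0..2 * pi} \<phi> \<partial>lborel)"
    by (intro nn_integral_cong) (auto simp: slice indicator_def)
  also have "\<dots> = ennreal I" by (rule nn_integral_has_integral_lebesgue'[OF nonneg I])
  also have "emeasure lborel {0..2 * pi} = ennreal (2 * pi)" by simp
  also have "ennreal I / ennreal (2 * pi) = ennreal (I / (2 * pi))"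
    using has_integral_nonneg[OF I nonneg] by (intro divide_ennreal) auto
  finally show ?thesis
    using has_integral_nonneg[OF I nonneg] by (simp add: measure_def)
qed

text \<open>
  The pairs of position and angle at which the compact body meets a given closed triangle form a
  closed set, namely a projection along the compact factor \<open>C\<close>, and there are only countably many triangles.
\<close>

lemma card_triangles_hit_measurable:
  assumes "compact C"
  shows "(\<lambda>(z, \<phi>). card {T \<in> lattice_triangles a b \<alpha> \<beta> \<gamma>. T \<inter> placed C P E z (\<phi> + e) \<noteq> {}}) \<in> measurable borel (count_space UNIV)"
proof -
  define d where "d = direction_angle (E - P)"
  have "closed {x :: (real \<times> real) \<times> real. closure (cell i) \<inter> lattice_coords ` placed C P E (fst x) (snd x + e) \<noteq> {}}" for i
  proof -
    let ?f = "\<lambda>y :: (real \<times> real) \<times> (real \<times> real) \<times> real. lattice_coords (fst (snd y) + rotate2 (snd (snd y) + e - d) (fst y - P))"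
    have "continuous_on UNIV ?f"
      unfolding lattice_coords_def rotate2_def by (intro continuous_intros)
    then have "closed (?f -` closure (cell i))"
      by (intro closed_vimage) auto
    from closed_compact_projection[OF assms this]
    have "closed {x. \<exists>w. w \<in> C \<and> (w, x) \<in> ?f -` closure (cell i)}" .
    also have "{x. \<exists>w. w \<in> C \<and> (w, x) \<in> ?f -` closure (cell i)}
       = {x :: (real \<times> real) \<times> real. closure (cell i) \<inter> lattice_coords ` placed C P E (fst x) (snd x + e) \<noteq> {}}"
      unfolding placed_def d_def by (auto simp: image_image)
    finally show ?thesis .
  qed
  then have "(\<lambda>x. card {i. closure (cell i) \<inter> lattice_coords ` placed C P E (fst x) (snd x + e) \<noteq> {}}) \<in> measurable borel (count_space UNIV)"
    by (intro measurable_card_Collect) (simp add: borel_closed)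
  then show ?thesis by (simp add: card_lattice_triangles_hit case_prod_unfold)
qed

end

section \<open>Mean widths and the hitting probabilities\<close>

context acute_triangle
begin

text \<open>
  The width of the rectangle across the lines parallel to the side \<open>a\<close>, divided by the distance
  \<open>Q / a\<close> of neighbouring lines, when its side \<open>g\<close> makes the angle \<open>y\<close> with the normal of
  the sides \<open>c\<close>; similarly for the sides \<open>b\<close> and \<open>c\<close>.
\<close>

definition width_a :: "real \<Rightarrow> real \<Rightarrow> real \<Rightarrow> real" where "width_a g h y = a / Q * rect_width g h (y + \<beta>)"
definition width_b :: "real \<Rightarrow> real \<Rightarrow> real \<Rightarrow> real" where "width_b g h y = b / Q * rect_width g h (y - \<alpha>)"
definition width_c :: "real \<Rightarrow> real \<Rightarrow> real \<Rightarrow> real" where "width_c g h y = c / Q * rect_width g h y"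

definition width_sum :: "real \<Rightarrow> real \<Rightarrow> real \<Rightarrow> real" where
  "width_sum g h y = width_a g h y + width_b g h y + width_c g h y"
definition width_products :: "real \<Rightarrow> real \<Rightarrow> real \<Rightarrow> real" where
  "width_products g h y = width_a g h y * width_b g h y + width_a g h y * width_c g h y + width_b g h y * width_c g h y"
definition width_squares :: "real \<Rightarrow> real \<Rightarrow> real \<Rightarrow> real" where
  "width_squares g h y = (width_a g h y)\<^sup>2 + (width_b g h y)\<^sup>2 + (width_c g h y)\<^sup>2"

lemma has_integral_width_sum:
  "((\<lambda>\<phi>. width_sum g h (\<phi> + k)) has_integral 4 * (g + h) * (a + b + c) / Q) {0..2 * pi}"
proof -
  have "((\<lambda>\<phi>. a / Q * rect_width g h (\<phi> + (k + \<beta>)) + b / Q * rect_width g h (\<phi> + (k - \<alpha>)) + c / Q * rect_width g h (\<phi> + k))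
    has_integral a / Q * (4 * (g + h)) + b / Q * (4 * (g + h)) + c / Q * (4 * (g + h))) {0..2 * pi}"
    by (intro has_integral_add has_integral_mult_right has_integral_rect_width)
  moreover have "a / Q * (4 * (g + h)) + b / Q * (4 * (g + h)) + c / Q * (4 * (g + h)) = 4 * (g + h) * (a + b + c) / Q"
    using pos by (simp add: field_simps)
  ultimately show ?thesis
    unfolding width_sum_def width_a_def width_b_def width_c_def by (simp add: algebra_simps)
qed

lemma has_integral_width_squares:
  "((\<lambda>\<phi>. width_squares g h (\<phi> + k)) has_integral (a\<^sup>2 + b\<^sup>2 + c\<^sup>2) * (pi * (g\<^sup>2 + h\<^sup>2) + 4 * (g * h)) / Q\<^sup>2) {0..2 * pi}"
proof -
  have sq: "((\<lambda>\<phi>. (rect_width g h (\<phi> + e))\<^sup>2) has_integral pi * (g\<^sup>2 + h\<^sup>2) + 4 * (g * h)) {0..2 * pi}" for e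
    using has_integral_rect_width_mult[of 0 g h e] by (simp add: power2_eq_square algebra_simps)
  have "((\<lambda>\<phi>. (a / Q)\<^sup>2 * (rect_width g h (\<phi> + (k + \<beta>)))\<^sup>2 + (b / Q)\<^sup>2 * (rect_width g h (\<phi> + (k - \<alpha>)))\<^sup>2 + (c / Q)\<^sup>2 * (rect_width g h (\<phi> + k))\<^sup>2)
    has_integral (a / Q)\<^sup>2 * (pi * (g\<^sup>2 + h\<^sup>2) + 4 * (g * h)) + (b / Q)\<^sup>2 * (pi * (g\<^sup>2 + h\<^sup>2) + 4 * (g * h))
      + (c / Q)\<^sup>2 * (pi * (g\<^sup>2 + h\<^sup>2) + 4 * (g * h))) {0..2 * pi}"
    by (intro has_integral_add has_integral_mult_right sq)
  moreover have "(a / Q)\<^sup>2 * (pi * (g\<^sup>2 + h\<^sup>2) + 4 * (g * h)) + (b / Q)\<^sup>2 * (pi * (g\<^sup>2 + h\<^sup>2) + 4 * (g * h))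
      + (c / Q)\<^sup>2 * (pi * (g\<^sup>2 + h\<^sup>2) + 4 * (g * h)) = (a\<^sup>2 + b\<^sup>2 + c\<^sup>2) * (pi * (g\<^sup>2 + h\<^sup>2) + 4 * (g * h)) / Q\<^sup>2"
    by (simp add: power_divide add_divide_distrib distrib_right)
  moreover have "(a / Q)\<^sup>2 * (rect_width g h (\<phi> + (k + \<beta>)))\<^sup>2 + (b / Q)\<^sup>2 * (rect_width g h (\<phi> + (k - \<alpha>)))\<^sup>2 + (c / Q)\<^sup>2 * (rect_width g h (\<phi> + k))\<^sup>2
     = width_squares g h (\<phi> + k)" for \<phi>
    unfolding width_squares_def width_a_def width_b_def width_c_def power_mult_distrib by (simp add: add.assoc add_diff_eq)
  ultimately show ?thesis by (simp only:)
qed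

lemma rect_width_pi: "rect_width g h (x + pi) = rect_width g h x"
  by (simp add: rect_width_def)

text \<open>
  The normals of two sides enclose, up to half turns, the angle of the triangle between them, to
  which \<open>has_integral_rect_width_mult\<close> applies.
\<close>

lemma has_integral_width_products:
  "((\<lambda>\<phi>. width_products g h (\<phi> + k)) has_integral
     (2 * (g\<^sup>2 + h\<^sup>2) * (3 * Q - pi * (a\<^sup>2 + b\<^sup>2 + c\<^sup>2) / 4 + (\<alpha> * a\<^sup>2 + \<beta> * b\<^sup>2 + \<gamma> * c\<^sup>2))
      + 4 * (g * h) * ((a\<^sup>2 + b\<^sup>2 + c\<^sup>2) / 2 + pi * Q)) / Q\<^sup>2) {0..2 * pi}"
proof -
  let ?w = "rect_width g h"
  let ?J = "\<lambda>d. 2 * (g\<^sup>2 + h\<^sup>2) * (sin d + (pi / 2 - d) * cos d) + 4 * (g * h) * (cos d + d * sin d)"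
  have int: "((\<lambda>\<phi>. ?w (\<phi> + e) * ?w (\<phi> + e + d)) has_integral ?J d) {0..2 * pi}" if "0 < d" "d \<le> pi / 2" for e d
    by (rule has_integral_rect_width_mult) (use that in auto)
  have "((\<lambda>\<phi>. a * b / Q\<^sup>2 * (?w (\<phi> + (k + \<beta>)) * ?w (\<phi> + (k + \<beta>) + \<gamma>)) + a * c / Q\<^sup>2 * (?w (\<phi> + k) * ?w (\<phi> + k + \<beta>))
      + b * c / Q\<^sup>2 * (?w (\<phi> + (k - \<alpha>)) * ?w (\<phi> + (k - \<alpha>) + \<alpha>)))
    has_integral a * b / Q\<^sup>2 * ?J \<gamma> + a * c / Q\<^sup>2 * ?J \<beta> + b * c / Q\<^sup>2 * ?J \<alpha>) {0..2 * pi}"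
    by (intro has_integral_add has_integral_mult_right int angles)
  moreover have "a * b / Q\<^sup>2 * (?w (\<phi> + (k + \<beta>)) * ?w (\<phi> + (k + \<beta>) + \<gamma>)) + a * c / Q\<^sup>2 * (?w (\<phi> + k) * ?w (\<phi> + k + \<beta>))
      + b * c / Q\<^sup>2 * (?w (\<phi> + (k - \<alpha>)) * ?w (\<phi> + (k - \<alpha>) + \<alpha>)) = width_products g h (\<phi> + k)" for \<phi>
  proof -
    have "\<phi> + (k + \<beta>) + \<gamma> = (\<phi> + k - \<alpha>) + pi" using sum by simp
    then have 1: "?w (\<phi> + (k + \<beta>) + \<gamma>) = ?w (\<phi> + k - \<alpha>)" by (simp only: rect_width_pi)
    have 2: "\<phi> + (k + \<beta>) = \<phi> + k + \<beta>" "\<phi> + (k - \<alpha>) = \<phi> + k - \<alpha>" "\<phi> + k - \<alpha> + \<alpha> = \<phi> + k" by simp_all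
    show ?thesis unfolding 1 unfolding 2 width_products_def width_a_def width_b_def width_c_def
      by (simp add: power2_eq_square mult_ac)
  qed
  moreover have "a * b / Q\<^sup>2 * ?J \<gamma> + a * c / Q\<^sup>2 * ?J \<beta> + b * c / Q\<^sup>2 * ?J \<alpha>
    = (2 * (g\<^sup>2 + h\<^sup>2) * (3 * Q - pi * (a\<^sup>2 + b\<^sup>2 + c\<^sup>2) / 4 + (\<alpha> * a\<^sup>2 + \<beta> * b\<^sup>2 + \<gamma> * c\<^sup>2))
      + 4 * (g * h) * ((a\<^sup>2 + b\<^sup>2 + c\<^sup>2) / 2 + pi * Q)) / Q\<^sup>2"
  proof -
    define A B C where "A = b * c * cos \<alpha>" and "B = a * c * cos \<beta>" and "C = a * b * cos \<gamma>"
    have cos: "A = (b\<^sup>2 + c\<^sup>2 - a\<^sup>2) / 2" "B = (a\<^sup>2 + c\<^sup>2 - b\<^sup>2) / 2" "C = (a\<^sup>2 + b\<^sup>2 - c\<^sup>2) / 2"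
      using cosines by (simp_all add: A_def B_def C_def)
    have g: "\<gamma> = pi - \<alpha> - \<beta>" using sum by simp
    have Jx: "x * (2 * (g\<^sup>2 + h\<^sup>2) * (s + (pi / 2 - d) * co) + 4 * (g * h) * (co + d * s))
       = 2 * (g\<^sup>2 + h\<^sup>2) * (x * s + (pi / 2 - d) * (x * co)) + 4 * (g * h) * (x * co + d * (x * s))" for x s co d
      by (simp add: algebra_simps)
    have "a * b * ?J \<gamma> + a * c * ?J \<beta> + b * c * ?J \<alpha>
       = 2 * (g\<^sup>2 + h\<^sup>2) * (3 * Q + ((pi / 2 - \<gamma>) * C + (pi / 2 - \<beta>) * B + (pi / 2 - \<alpha>) * A))
         + 4 * (g * h) * ((A + B + C) + (\<alpha> + \<beta> + \<gamma>) * Q)"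
      unfolding Jx area A_def[symmetric] B_def[symmetric] C_def[symmetric] by (simp add: algebra_simps)
    also have "(pi / 2 - \<gamma>) * C + (pi / 2 - \<beta>) * B + (pi / 2 - \<alpha>) * A
       = - pi * (a\<^sup>2 + b\<^sup>2 + c\<^sup>2) / 4 + (\<alpha> * a\<^sup>2 + \<beta> * b\<^sup>2 + \<gamma> * c\<^sup>2)"
      unfolding cos g by (simp add: field_simps)
    also have "A + B + C = (a\<^sup>2 + b\<^sup>2 + c\<^sup>2) / 2" unfolding cos by (simp add: field_simps)
    finally have "a * b * ?J \<gamma> + a * c * ?J \<beta> + b * c * ?J \<alpha> = 2 * (g\<^sup>2 + h\<^sup>2) * (3 * Q - pi * (a\<^sup>2 + b\<^sup>2 + c\<^sup>2) / 4 + (\<alpha> * a\<^sup>2 + \<beta> * b\<^sup>2 + \<gamma> * c\<^sup>2))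
      + 4 * (g * h) * ((a\<^sup>2 + b\<^sup>2 + c\<^sup>2) / 2 + pi * Q)" unfolding sum by simp
    moreover have "a * b / Q\<^sup>2 * ?J \<gamma> + a * c / Q\<^sup>2 * ?J \<beta> + b * c / Q\<^sup>2 * ?J \<alpha> = (a * b * ?J \<gamma> + a * c * ?J \<beta> + b * c * ?J \<alpha>) / Q\<^sup>2"
      by (simp only: add_divide_distrib times_divide_eq_left)
    ultimately show ?thesis by (simp only:)
  qed
  ultimately show ?thesis by (simp only:)
qed

text \<open>
  At a fixed angle the rectangle becomes a parallelogram in oblique coordinates whose half-widths
  are \<open>t\<^sub>i / 2\<close> and whose area is \<open>g h / Q\<close>. The probability that no line is met is expanded by
  \<open>(1 - S / 2)\<^sup>2 = 1 - S + (squares) / 4 + (products) / 2\<close> with \<open>S\<close> the sum of the \<open>t\<^sub>i\<close>.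
\<close>

lemma measure_hits_fixed_angle:
  fixes C and P E :: "real \<times> real" and z :: "real \<times> real" and \<phi> y :: real
  defines "N \<equiv> \<lambda>z. card {T \<in> lattice_triangles a b \<alpha> \<beta> \<gamma>. T \<inter> placed C P E (lattice_map z) (\<phi> + \<alpha> + pi / 2) \<noteq> {}}"
  assumes C: "C = closed_par ctr ((g / 2) *\<^sub>R dir \<omega>) ((\<epsilon> * h / 2) *\<^sub>R dir (\<omega> + pi / 2))"
    and e: "\<bar>\<epsilon>\<bar> = 1" and gh: "0 < g" "0 < h"
    and y: "y = \<phi> + (\<alpha> + (\<omega> - direction_angle (E - P)))"
    and fits: "width_sum g h y \<le> 2"
  shows "measure lborel {z \<in> unit_square. N z = 1} = 1 - width_sum g h y + width_squares g h y / 4 + width_products g h y / 2"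
    "measure lborel {z \<in> unit_square. N z = 2} = width_sum g h y - width_products g h y / 2 - 3 / 4 * width_squares g h y"
    "measure lborel {z \<in> unit_square. N z = 3} = 3 / 4 * width_squares g h y - width_products g h y / 2"
    "measure lborel {z \<in> unit_square. N z = 4} = width_products g h y / 2 - width_squares g h y / 4 - g * h / Q"
    "measure lborel {z \<in> unit_square. N z = 5} = 0"
    "measure lborel {z \<in> unit_square. N z = 6} = g * h / Q"
proof -
  \<comment> \<open>The offset of the centre from the reference point only shifts the position.\<close>
  define v where "v = rotate2 (\<phi> + \<alpha> + pi / 2 - direction_angle (E - P)) (ctr - P)"
  define p where "p = lattice_coords ((g / 2) *\<^sub>R dir (y + pi / 2))"
  define q where "q = lattice_coords ((\<epsilon> * h / 2) *\<^sub>R dir (y + pi / 2 + pi / 2))"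
  have ang: "\<phi> + \<alpha> + pi / 2 + (\<omega> - direction_angle (E - P)) = y + pi / 2" by (simp add: y)
  have "lattice_coords ` placed C P E (lattice_map z) (\<phi> + \<alpha> + pi / 2) = closed_par (z + lattice_coords v) p q" for z
    unfolding placed_closed_par[OF C] linear_image_closed_par[OF linear_lattice_coords] ang
    by (simp add: linear_add[OF linear_lattice_coords] coords_map p_def q_def v_def)
  then have N: "N z = card {i. closure (cell i) \<inter> closed_par (z + lattice_coords v) p q \<noteq> {}}" for z
    unfolding N_def card_lattice_triangles_hit by simp
  have p: "fst p = - (g / 2 * (b / Q)) * cos (y - \<alpha>)" "snd p = (g / 2 * (c / Q)) * cos y" "fst p + snd p = (g / 2 * (a / Q)) * cos (y + \<beta>)"
  proof -
    have s: "sin (y + pi / 2 - \<alpha>) = cos (y - \<alpha>)" "sin (y + pi / 2) = cos y" "sin (y + pi / 2 + \<beta>) = cos (y + \<beta>)"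
      by (simp_all add: sin_add sin_diff cos_add cos_diff)
    have "p = (g / 2) *\<^sub>R lattice_coords (dir (y + pi / 2))" by (simp add: p_def linear_scale[OF linear_lattice_coords])
    then have F: "fst p = g / 2 * fst (lattice_coords (dir (y + pi / 2)))" "snd p = g / 2 * snd (lattice_coords (dir (y + pi / 2)))"
      "fst p + snd p = g / 2 * (fst (lattice_coords (dir (y + pi / 2))) + snd (lattice_coords (dir (y + pi / 2))))"
      by (simp_all add: algebra_simps)
    show "fst p = - (g / 2 * (b / Q)) * cos (y - \<alpha>)" using F(1) unfolding coords_dir(1) s by (simp only: mult.assoc mult_minus_left mult_minus_right)
    show "snd p = (g / 2 * (c / Q)) * cos y" using F(2) unfolding coords_dir(2) s by (simp only: mult.assoc mult_minus_left mult_minus_right)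
    show "fst p + snd p = (g / 2 * (a / Q)) * cos (y + \<beta>)" using F(3) unfolding coords_dir(3) s by (simp only: mult.assoc mult_minus_left mult_minus_right)
  qed
  have q: "fst q = (\<epsilon> * h / 2 * (b / Q)) * sin (y - \<alpha>)" "snd q = - (\<epsilon> * h / 2 * (c / Q)) * sin y" "fst q + snd q = - (\<epsilon> * h / 2 * (a / Q)) * sin (y + \<beta>)"
  proof -
    have s: "sin (y + pi / 2 + pi / 2 - \<alpha>) = - sin (y - \<alpha>)" "sin (y + pi / 2 + pi / 2) = - sin y" "sin (y + pi / 2 + pi / 2 + \<beta>) = - sin (y + \<beta>)"
      by (simp_all add: sin_add sin_diff cos_add cos_diff)
    have "q = (\<epsilon> * h / 2) *\<^sub>R lattice_coords (dir (y + pi / 2 + pi / 2))" by (simp add: q_def linear_scale[OF linear_lattice_coords])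
    then have F: "fst q = \<epsilon> * h / 2 * fst (lattice_coords (dir (y + pi / 2 + pi / 2)))" "snd q = \<epsilon> * h / 2 * snd (lattice_coords (dir (y + pi / 2 + pi / 2)))"
      "fst q + snd q = \<epsilon> * h / 2 * (fst (lattice_coords (dir (y + pi / 2 + pi / 2))) + snd (lattice_coords (dir (y + pi / 2 + pi / 2))))"
      by (simp_all add: algebra_simps)
    show "fst q = (\<epsilon> * h / 2 * (b / Q)) * sin (y - \<alpha>)" using F(1) unfolding coords_dir(1) s by (simp only: mult.assoc mult_minus_left mult_minus_right)
    show "snd q = - (\<epsilon> * h / 2 * (c / Q)) * sin y" using F(2) unfolding coords_dir(2) s by (simp only: mult.assoc mult_minus_left mult_minus_right)
    show "fst q + snd q = - (\<epsilon> * h / 2 * (a / Q)) * sin (y + \<beta>)" using F(3) unfolding coords_dir(3) s by (simp only: mult.assoc mult_minus_left mult_minus_right)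
  qed
  have r1: "\<bar>fst p\<bar> + \<bar>fst q\<bar> = width_b g h y / 2"
    unfolding p(1) q(1) using e gh pos by (simp add: width_b_def rect_width_def abs_mult field_simps)
  have r2: "\<bar>snd p\<bar> + \<bar>snd q\<bar> = width_c g h y / 2"
    unfolding p(2) q(2) using e gh pos by (simp add: width_c_def rect_width_def abs_mult field_simps)
  have r3: "\<bar>fst p + snd p\<bar> + \<bar>fst q + snd q\<bar> = width_a g h y / 2"
    unfolding p(3) q(3) using e gh pos by (simp add: width_a_def rect_width_def abs_mult field_simps)
  note r = r1 r2 r3
  have "det2 ((g / 2) *\<^sub>R dir (y + pi / 2)) ((\<epsilon> * h / 2) *\<^sub>R dir (y + pi / 2 + pi / 2)) = g * (\<epsilon> * h) / 4 * (cos y * cos y + sin y * sin y)"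
    by (simp add: det2_def dir_def sin_add cos_add algebra_simps del: sin_cos_squared_add3)
  then have "det2 p q = g * (\<epsilon> * h) / (4 * Q)"
    unfolding p_def q_def det2_coords sin_cos_squared_add3 by (simp only: mult_1_right divide_divide_eq_left)
  then have det: "4 * \<bar>det2 p q\<bar> = g * h / Q" using e gh pos by (simp add: abs_mult)
  interpret sp: small_par p q
  proof
    have "0 < g * h / Q" using gh pos by simp
    then show "det2 p q \<noteq> 0" using det by auto
    show "\<bar>fst p\<bar> + \<bar>fst q\<bar> + (\<bar>snd p\<bar> + \<bar>snd q\<bar>) + (\<bar>fst p + snd p\<bar> + \<bar>fst q + snd q\<bar>) \<le> 1"
      unfolding r using fits by (simp add: width_sum_def)
  qed
  have sr: "sp.r1 = width_b g h y / 2" "sp.r2 = width_c g h y / 2" "sp.r3 = width_a g h y / 2"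
    unfolding sp.r1_def sp.r2_def sp.r3_def r by simp_all
  have hits: "measure lborel {z \<in> unit_square. N z = i} = measure lborel {z \<in> unit_square. card {c. cell c \<inter> open_par (z + lattice_coords v) p q \<noteq> {}} = i}" for i
    unfolding N by (rule sp.measure_closed_hits_eq_open_hits)
  have none: "sp.p_none = 1 - width_sum g h y + width_squares g h y / 4 + width_products g h y / 2"
    unfolding sp.p_none_def sr width_sum_def width_squares_def width_products_def by (simp add: power2_eq_square field_simps)
  have all: "sp.p_all = width_products g h y / 2 - width_squares g h y / 4"
    unfolding sp.p_all_def sp.p_none_def sr width_squares_def width_products_def by (simp add: power2_eq_square field_simps)
  have sums: "2 * (sp.r1 + sp.r2 + sp.r3) = width_sum g h y" "4 * (sp.r1 * sp.r2 + sp.r1 * sp.r3 + sp.r2 * sp.r3) = width_products g h y"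
    unfolding sr width_sum_def width_products_def by (simp_all add: algebra_simps)
  then have sums8: "8 * (sp.r1 * sp.r2 + sp.r1 * sp.r3 + sp.r2 * sp.r3) = 2 * width_products g h y" by linarith
  show "measure lborel {z \<in> unit_square. N z = 1} = 1 - width_sum g h y + width_squares g h y / 4 + width_products g h y / 2"
    unfolding hits sp.measure_open_hits none ..
  show "measure lborel {z \<in> unit_square. N z = 2} = width_sum g h y - width_products g h y / 2 - 3 / 4 * width_squares g h y"
    unfolding hits sp.measure_open_hits sums sums8 all by (simp add: field_simps)
  show "measure lborel {z \<in> unit_square. N z = 3} = 3 / 4 * width_squares g h y - width_products g h y / 2"
    unfolding hits sp.measure_open_hits sums all by (simp add: field_simps)
  show "measure lborel {z \<in> unit_square. N z = 4} = width_products g h y / 2 - width_squares g h y / 4 - g * h / Q"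
    unfolding hits sp.measure_open_hits all det ..
  show "measure lborel {z \<in> unit_square. N z = 5} = 0" unfolding hits sp.measure_open_hits ..
  show "measure lborel {z \<in> unit_square. N z = 6} = g * h / Q" unfolding hits sp.measure_open_hits det ..
qed

end

lemma rect_width_2pi: "rect_width g h (x + 2 * pi) = rect_width g h x"
  by (simp add: rect_width_def)

text \<open>
  Here \<open>R = g\<^sup>2 + h\<^sup>2\<close>, \<open>A = a\<^sup>2 + b\<^sup>2 + c\<^sup>2\<close>, \<open>W = \<alpha> a\<^sup>2 + \<beta> b\<^sup>2 + \<gamma> c\<^sup>2\<close>, \<open>L = a + b + c\<close>, and \<open>I1\<close>, \<open>Is\<close>, \<open>Ip\<close> are the integrals over
  all angles of the sum of the \<open>t\<^sub>i\<close>, of their squares and of their products.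
\<close>

lemma hit_probability_algebra:
  fixes Q R F A W L u :: real
  assumes Q: "Q \<noteq> 0"
    and I1: "I1 = 2 * u * L / Q" and Is: "Is = A * (pi * R + 4 * F) / Q\<^sup>2"
    and Ip: "Ip = (2 * R * (3 * Q - pi * A / 4 + W) + 4 * F * (A / 2 + pi * Q)) / Q\<^sup>2"
  shows "(2 * pi * 1 - I1 + Is / 4 + Ip / 2) / (2 * pi)
      = 1 - L * u / (pi * Q) + W * R / (2 * pi * Q\<^sup>2) + 3 * R / (2 * pi * Q) + A * F / (pi * Q\<^sup>2) + F / Q"
    and "(I1 - Ip / 2 - 3 / 4 * Is) / (2 * pi)
      = L * u / (pi * Q) - A * R / (4 * Q\<^sup>2) - W * R / (2 * pi * Q\<^sup>2) - 3 * R / (2 * pi * Q) - 2 * A * F / (pi * Q\<^sup>2) - F / Q"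
    and "(3 / 4 * Is - Ip / 2) / (2 * pi)
      = A * R / (2 * Q\<^sup>2) - W * R / (2 * pi * Q\<^sup>2) - 3 * R / (2 * pi * Q) + A * F / (pi * Q\<^sup>2) - F / Q"
    and "(Ip / 2 - Is / 4 - 2 * pi * (F / Q)) / (2 * pi)
      = 3 * R / (2 * pi * Q) - A * R / (4 * Q\<^sup>2) + W * R / (2 * pi * Q\<^sup>2)"
  unfolding I1 Is Ip using Q by (simp_all add: field_simps power2_eq_square)

theorem corollary2:
  fixes a b c \<alpha> \<beta> \<gamma> g h u F Q :: real
    and C :: "(real \<times> real) set"
    and P E :: "real \<times> real"
    and s :: "real \<Rightarrow> real"
    and p :: "nat \<Rightarrow> real"
  assumes "is_triangle a b c \<alpha> \<beta> \<gamma>"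
    and "\<alpha> \<le> pi / 2" and "\<beta> \<le> pi / 2" and "\<gamma> \<le> pi / 2"
    and "is_rectangle g h C"
    and "P \<in> C" and "E \<noteq> P"
    and "s = support_fun C P E"
    and "\<forall>\<phi>. 0 \<le> \<phi> \<and> \<phi> < 2 * pi \<longrightarrow> c_star s \<alpha> \<beta> \<phi> \<le> c"
    and "u = 2 * (g + h)" and "F = g * h" and "Q = a * b * sin \<gamma>"
    and "p = hit_prob a b c \<alpha> \<beta> \<gamma> C P E"
  shows
    "p 1 = 1 - (a + b + c) * u / (pi * Q)
         + (\<alpha> * a\<^sup>2 + \<beta> * b\<^sup>2 + \<gamma> * c\<^sup>2) * (g\<^sup>2 + h\<^sup>2) / (2 * pi * Q\<^sup>2)
         + 3 * (g\<^sup>2 + h\<^sup>2) / (2 * pi * Q)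
         + (a\<^sup>2 + b\<^sup>2 + c\<^sup>2) * F / (pi * Q\<^sup>2)
         + F / Q
   \<and> p 2 = (a + b + c) * u / (pi * Q)
         - (a\<^sup>2 + b\<^sup>2 + c\<^sup>2) * (g\<^sup>2 + h\<^sup>2) / (4 * Q\<^sup>2)
         - (\<alpha> * a\<^sup>2 + \<beta> * b\<^sup>2 + \<gamma> * c\<^sup>2) * (g\<^sup>2 + h\<^sup>2) / (2 * pi * Q\<^sup>2)
         - 3 * (g\<^sup>2 + h\<^sup>2) / (2 * pi * Q)
         - 2 * (a\<^sup>2 + b\<^sup>2 + c\<^sup>2) * F / (pi * Q\<^sup>2)
         - F / Q
   \<and> p 3 = (a\<^sup>2 + b\<^sup>2 + c\<^sup>2) * (g\<^sup>2 + h\<^sup>2) / (2 * Q\<^sup>2)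
         - (\<alpha> * a\<^sup>2 + \<beta> * b\<^sup>2 + \<gamma> * c\<^sup>2) * (g\<^sup>2 + h\<^sup>2) / (2 * pi * Q\<^sup>2)
         - 3 * (g\<^sup>2 + h\<^sup>2) / (2 * pi * Q)
         + (a\<^sup>2 + b\<^sup>2 + c\<^sup>2) * F / (pi * Q\<^sup>2)
         - F / Q
   \<and> p 4 = 3 * (g\<^sup>2 + h\<^sup>2) / (2 * pi * Q)
         - (a\<^sup>2 + b\<^sup>2 + c\<^sup>2) * (g\<^sup>2 + h\<^sup>2) / (4 * Q\<^sup>2)
         + (\<alpha> * a\<^sup>2 + \<beta> * b\<^sup>2 + \<gamma> * c\<^sup>2) * (g\<^sup>2 + h\<^sup>2) / (2 * pi * Q\<^sup>2)
   \<and> p 5 = 0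
   \<and> p 6 = F / Q"
proof -
  note isC = \<open>is_rectangle g h C\<close>
  interpret acute_triangle a b c \<alpha> \<beta> \<gamma> Q
    using acute_triangle_of_is_triangle assms(1-4,12) by simp
  have gh: "0 < g" "0 < h" using isC by (simp_all add: is_rectangle_def)
  obtain ctr \<omega> \<epsilon> where e: "\<bar>\<epsilon>\<bar> = 1"
    and C: "C = closed_par ctr ((g / 2) *\<^sub>R dir \<omega>) ((\<epsilon> * h / 2) *\<^sub>R dir (\<omega> + pi / 2))"
    using rectangle_closed_par[OF isC] .
  \<comment> \<open>The constant by which the thrown angle differs from the angle of the side g to the normal of the sides c.\<close>
  define k where "k = \<alpha> + (\<omega> - direction_angle (E - P))"
  have period: "width_sum g h (y + 2 * pi) = width_sum g h y" for y
  proof -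
    have "y + 2 * pi + \<beta> = (y + \<beta>) + 2 * pi" "y + 2 * pi - \<alpha> = (y - \<alpha>) + 2 * pi" by simp_all
    then show ?thesis by (simp only: width_sum_def width_a_def width_b_def width_c_def rect_width_2pi)
  qed
  have fits0: "width_sum g h (\<phi> + k) \<le> 2" if "0 \<le> \<phi>" "\<phi> < 2 * pi" for \<phi>
  proof -
    have "c / 2 * (b / Q * rect_width g h (\<phi> + k - \<alpha>) + c / Q * rect_width g h (\<phi> + k) + a / Q * rect_width g h (\<phi> + k + \<beta>))
       \<le> c_star (support_fun C P E) \<alpha> \<beta> \<phi>"
      using gh by (intro c_star_ge[OF C e]) (simp_all add: k_def)
    also have "\<dots> \<le> c" using assms(8,9) that by simp
    finally have "c * width_sum g h (\<phi> + k) \<le> c * 2"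
      by (simp add: width_sum_def width_a_def width_b_def width_c_def algebra_simps)
    then show ?thesis using pos by simp
  qed
  have fits: "width_sum g h (\<phi> + k) \<le> 2" if "\<phi> \<in> {0..2 * pi}" for \<phi>
  \<comment> \<open>The hypothesis on \<open>c_star\<close> covers only the half-open period.\<close>
  proof (cases "\<phi> = 2 * pi")
    case True
    then have "width_sum g h (\<phi> + k) = width_sum g h (0 + k)" using period[of k] by (simp add: add.commute)
    then show ?thesis using fits0[of 0] by simp
  qed (use that fits0 in auto)
  define A where "A i = {(z, \<phi>). card {T \<in> lattice_triangles a b \<alpha> \<beta> \<gamma>. T \<inter> placed C P E z (\<phi> + \<alpha> + pi / 2) \<noteq> {}} = i}" for i
  have A: "A i \<in> sets borel" for i
  proof -
    have "compact C" unfolding C by (rule compact_closed_par)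
    from measurable_sets[OF card_triangles_hit_measurable[OF this, of P E "\<alpha> + pi / 2"], of "{i}"]
    have "(\<lambda>(z, \<phi>). card {T \<in> lattice_triangles a b \<alpha> \<beta> \<gamma>. T \<inter> placed C P E z (\<phi> + (\<alpha> + pi / 2)) \<noteq> {}}) -` {i} \<in> sets borel"
      by simp
    also have "(\<lambda>(z, \<phi>). card {T \<in> lattice_triangles a b \<alpha> \<beta> \<gamma>. T \<inter> placed C P E z (\<phi> + (\<alpha> + pi / 2)) \<noteq> {}}) -` {i} = A i"
      by (auto simp: A_def add.assoc)
    finally show ?thesis .
  qed
  have "space (throw_measure a c \<alpha> \<beta>) = UNIV" by (simp add: throw_measure_def space_pair_measure)
  then have p_A: "p i = measure (throw_measure a c \<alpha> \<beta>) (A i)" for i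
    unfolding assms(13) hit_prob_def A_def by simp
  have slice: "{z \<in> unit_square. (lattice_map z, \<phi>) \<in> A i} = {z \<in> unit_square.
      card {T \<in> lattice_triangles a b \<alpha> \<beta> \<gamma>. T \<inter> placed C P E (lattice_map z) (\<phi> + \<alpha> + pi / 2) \<noteq> {}} = i}" for \<phi> i
    by (simp add: A_def)
  have fixed: "measure lborel {z \<in> unit_square. (lattice_map z, \<phi>) \<in> A 1} = 1 - width_sum g h (\<phi> + k) + width_squares g h (\<phi> + k) / 4 + width_products g h (\<phi> + k) / 2"
    "measure lborel {z \<in> unit_square. (lattice_map z, \<phi>) \<in> A 2} = width_sum g h (\<phi> + k) - width_products g h (\<phi> + k) / 2 - 3 / 4 * width_squares g h (\<phi> + k)"
    "measure lborel {z \<in> unit_square. (lattice_map z, \<phi>) \<in> A 3} = 3 / 4 * width_squares g h (\<phi> + k) - width_products g h (\<phi> + k) / 2"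
    "measure lborel {z \<in> unit_square. (lattice_map z, \<phi>) \<in> A 4} = width_products g h (\<phi> + k) / 2 - width_squares g h (\<phi> + k) / 4 - F / Q"
    "measure lborel {z \<in> unit_square. (lattice_map z, \<phi>) \<in> A 5} = 0"
    "measure lborel {z \<in> unit_square. (lattice_map z, \<phi>) \<in> A 6} = F / Q" if "\<phi> \<in> {0..2 * pi}" for \<phi>
  proof -
    have y: "\<phi> + k = \<phi> + (\<alpha> + (\<omega> - direction_angle (E - P)))" by (simp add: k_def)
    note m = measure_hits_fixed_angle[OF C e gh y fits[OF that]]
    show "measure lborel {z \<in> unit_square. (lattice_map z, \<phi>) \<in> A 1} = 1 - width_sum g h (\<phi> + k) + width_squares g h (\<phi> + k) / 4 + width_products g h (\<phi> + k) / 2"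
      unfolding slice by (rule m(1))
    show "measure lborel {z \<in> unit_square. (lattice_map z, \<phi>) \<in> A 2} = width_sum g h (\<phi> + k) - width_products g h (\<phi> + k) / 2 - 3 / 4 * width_squares g h (\<phi> + k)"
      unfolding slice by (rule m(2))
    show "measure lborel {z \<in> unit_square. (lattice_map z, \<phi>) \<in> A 3} = 3 / 4 * width_squares g h (\<phi> + k) - width_products g h (\<phi> + k) / 2"
      unfolding slice by (rule m(3))
    show "measure lborel {z \<in> unit_square. (lattice_map z, \<phi>) \<in> A 4} = width_products g h (\<phi> + k) / 2 - width_squares g h (\<phi> + k) / 4 - F / Q"
      unfolding slice assms(11) by (rule m(4))
    show "measure lborel {z \<in> unit_square. (lattice_map z, \<phi>) \<in> A 5} = 0"
      unfolding slice by (rule m(5))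
    show "measure lborel {z \<in> unit_square. (lattice_map z, \<phi>) \<in> A 6} = F / Q"
      unfolding slice assms(11) by (rule m(6))
  qed
  define I1 Is Ip where "I1 = 4 * (g + h) * (a + b + c) / Q"
    and "Is = (a\<^sup>2 + b\<^sup>2 + c\<^sup>2) * (pi * (g\<^sup>2 + h\<^sup>2) + 4 * (g * h)) / Q\<^sup>2"
    and "Ip = (2 * (g\<^sup>2 + h\<^sup>2) * (3 * Q - pi * (a\<^sup>2 + b\<^sup>2 + c\<^sup>2) / 4 + (\<alpha> * a\<^sup>2 + \<beta> * b\<^sup>2 + \<gamma> * c\<^sup>2))
      + 4 * (g * h) * ((a\<^sup>2 + b\<^sup>2 + c\<^sup>2) / 2 + pi * Q)) / Q\<^sup>2"
  have const: "((\<lambda>\<phi>. r) has_integral 2 * pi * r) {0..2 * pi}" for r :: real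
    using has_integral_const_real[of r 0 "2 * pi"] by simp
  note ints = has_integral_width_sum[of g h k, folded I1_def] has_integral_width_squares[of g h k, folded Is_def]
    has_integral_width_products[of g h k, folded Ip_def]
  note intros = has_integral_add has_integral_diff has_integral_divide has_integral_mult_right ints const
  have "p 1 = (2 * pi * 1 - I1 + Is / 4 + Ip / 2) / (2 * pi)"
    unfolding p_A by (rule measure_throw[OF A fixed(1)]) (assumption, intro intros)
  moreover have "p 2 = (I1 - Ip / 2 - 3 / 4 * Is) / (2 * pi)"
    unfolding p_A by (rule measure_throw[OF A fixed(2)]) (assumption, intro intros)
  moreover have "p 3 = (3 / 4 * Is - Ip / 2) / (2 * pi)"
    unfolding p_A by (rule measure_throw[OF A fixed(3)]) (assumption, intro intros)
  moreover have "p 4 = (Ip / 2 - Is / 4 - 2 * pi * (F / Q)) / (2 * pi)"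
    unfolding p_A by (rule measure_throw[OF A fixed(4)]) (assumption, intro intros)
  moreover have "p 5 = (2 * pi * 0) / (2 * pi)"
    unfolding p_A by (rule measure_throw[OF A fixed(5)]) (assumption, intro intros)
  moreover have "p 6 = (2 * pi * (F / Q)) / (2 * pi)"
    unfolding p_A by (rule measure_throw[OF A fixed(6)]) (assumption, intro intros)
  moreover have "I1 = 2 * u * (a + b + c) / Q" by (simp add: I1_def assms(10))
  note alg = hit_probability_algebra[OF pos(4)[THEN less_imp_neq, symmetric] this Is_def[folded assms(11)] Ip_def[folded assms(11)]]
  ultimately show ?thesis
    unfolding alg by simp
qed

end
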